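(* Let $X$ be a compact complex manifold, and let $E$ be a weakly semiample holomorphic vector bundle on $X$. Then the determinant line bundle $\det(E)$ is semiample.
   Context: For a holomorphic vector bundle $E$ on $X$, $\pi\colon\mathbb{P}(E)\to X$ denotes the projective bundle of $1$-dimensional quotients of $E$ (Grothendieck's convention), $\mathbb{P}(E)=\mathrm{Proj}_{\mathcal{O}_X}(\bigoplus_{m\ge 0}\mathrm{Sym}^m E)$, and $\mathcal{O}_{\mathbb{P}(E)}(1)$ is the tautological quotient line bundle of $\pi^*E$; $\mathcal{O}_{\mathbb{P}(E)}(m)=\mathcal{O}_{\mathbb{P}(E)}(1)^{\otimes m}$. $E$ is called weakly semiample if $\mathcal{O}_{\mathbb{P}(E)}(m)$ is a base point free line bundle on $\mathbb{P}(E)$ for some integer $m>0$. A line bundle $L$ is semiample if $L^{\otimes k}$ is base point free (globally generated) for some integer $k>0$. *)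

theory Defs
  imports "HOL-Analysis.Analysis"
begin

section \<open>Complex manifolds\<close>

text \<open>Complex affine n-space is encoded as in \<^const>\<open>Euclidean_space\<close>: sequences supported below n,
  with the topology inherited from the product topology.\<close>

definition cspace :: "nat \<Rightarrow> (nat \<Rightarrow> complex) set" where
  "cspace n = {z. \<forall>i\<ge>n. z i = 0}"

text \<open>Holomorphic functions of n variables: continuous and complex differentiable in each variable
  separately. Only meant for V open in n-space.\<close>

definition holo_on :: "nat \<Rightarrow> (nat \<Rightarrow> complex) set \<Rightarrow> ((nat \<Rightarrow> complex) \<Rightarrow> complex) \<Rightarrow> bool" where
  "holo_on n V f \<longleftrightarrow> continuous_on V f \<and>
     (\<forall>z\<in>V. \<forall>i<n. (\<lambda>w. f (z(i := w))) field_differentiable at (z i))"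

text \<open>A chart is a pair of its domain and its coordinate map; the coordinate map is irrelevant
  outside the domain.\<close>

record 'x cmfd =
  topo :: "'x topology"
  cdim :: nat
  charts :: "('x set \<times> ('x \<Rightarrow> nat \<Rightarrow> complex)) set"

definition complex_manifold :: "'x cmfd \<Rightarrow> bool" where
  "complex_manifold M \<longleftrightarrow>
     Hausdorff_space (topo M) \<and> second_countable (topo M) \<and>
     topspace (topo M) = (\<Union>(U, \<psi>)\<in>charts M. U) \<and>
     (\<forall>(U, \<psi>)\<in>charts M.
        openin (topo M) U \<and>
        openin (top_of_set (cspace (cdim M))) (\<psi> ` U) \<and>
        homeomorphic_map (subtopology (topo M) U) (top_of_set (\<psi> ` U)) \<psi>) \<and>
     (\<forall>(U, \<psi>)\<in>charts M. \<forall>(V, \<theta>)\<in>charts M. \<forall>i<cdim M.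
        holo_on (cdim M) (\<psi> ` (U \<inter> V)) (\<lambda>z. \<theta> (inv_into U \<psi> z) i))"

text \<open>Holomorphic functions on an open subset W of M.\<close>

definition holo_fun :: "'x cmfd \<Rightarrow> 'x set \<Rightarrow> ('x \<Rightarrow> complex) \<Rightarrow> bool" where
  "holo_fun M W f \<longleftrightarrow>
     (\<forall>(U, \<psi>)\<in>charts M. holo_on (cdim M) (\<psi> ` (U \<inter> W)) (\<lambda>z. f (inv_into U \<psi> z)))"

section \<open>Holomorphic vector bundles\<close>

text \<open>A trivialisation over U is given by its fibre component, a map from the part of the
  total space over U to complex affine space of dimension the rank. The topology and complex structure of the total space
  are those making the trivialisations biholomorphic, so they are not recorded. Addition is only
  meaningful for two vectors of the same fibre.\<close>

record ('x, 'e) vbundle =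
  total_space :: "'e set"
  proj :: "'e \<Rightarrow> 'x"
  vrank :: nat
  vadd :: "'e \<Rightarrow> 'e \<Rightarrow> 'e"
  smul :: "complex \<Rightarrow> 'e \<Rightarrow> 'e"
  trivs :: "('x set \<times> ('e \<Rightarrow> nat \<Rightarrow> complex)) set"

definition fibre :: "('x, 'e) vbundle \<Rightarrow> 'x \<Rightarrow> 'e set" where
  "fibre E x = {e \<in> total_space E. proj E e = x}"

text \<open>The vector space axioms for the fibres follow, since a trivialisation is a bijection from
  each fibre to a vector space and respects both operations.\<close>

definition holomorphic_vector_bundle :: "'x cmfd \<Rightarrow> ('x, 'e) vbundle \<Rightarrow> bool" where
  "holomorphic_vector_bundle M E \<longleftrightarrow>
     proj E ` total_space E \<subseteq> topspace (topo M) \<and>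
     topspace (topo M) = (\<Union>(U, \<phi>)\<in>trivs E. U) \<and>
     (\<forall>x\<in>topspace (topo M). \<forall>u\<in>fibre E x.
        (\<forall>v\<in>fibre E x. vadd E u v \<in> fibre E x) \<and> (\<forall>c. smul E c u \<in> fibre E x)) \<and>
     (\<forall>(U, \<phi>)\<in>trivs E. openin (topo M) U \<and>
        (\<forall>x\<in>U. bij_betw \<phi> (fibre E x) (cspace (vrank E)) \<and>
           (\<forall>u\<in>fibre E x. \<forall>v\<in>fibre E x. \<phi> (vadd E u v) = (\<lambda>i. \<phi> u i + \<phi> v i)) \<and>
           (\<forall>u\<in>fibre E x. \<forall>c. \<phi> (smul E c u) = (\<lambda>i. c * \<phi> u i)))) \<and>
     (\<forall>(U, \<phi>)\<in>trivs E. \<forall>(V, \<theta>)\<in>trivs E.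
        \<exists>g :: 'x \<Rightarrow> nat \<Rightarrow> nat \<Rightarrow> complex.
          (\<forall>i<vrank E. \<forall>j<vrank E. holo_fun M (U \<inter> V) (\<lambda>x. g x i j)) \<and>
          (\<forall>x\<in>U \<inter> V. \<forall>e\<in>fibre E x. \<forall>i<vrank E.
             \<theta> e i = (\<Sum>j<vrank E. g x i j * \<phi> e j)))"

definition holomorphic_section :: "'x cmfd \<Rightarrow> ('x, 'e) vbundle \<Rightarrow> ('x \<Rightarrow> 'e) \<Rightarrow> bool" where
  "holomorphic_section M E s \<longleftrightarrow>
     (\<forall>x\<in>topspace (topo M). s x \<in> fibre E x) \<and>
     (\<forall>(U, \<phi>)\<in>trivs E. \<forall>i<vrank E. holo_fun M U (\<lambda>x. \<phi> (s x) i))"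

text \<open>The zero vector of the fibre containing u is written as 0 times u.\<close>

definition base_point_free :: "'x cmfd \<Rightarrow> ('x, 'e) vbundle \<Rightarrow> bool" where
  "base_point_free M L \<longleftrightarrow>
     (\<forall>x\<in>topspace (topo M). \<exists>s. holomorphic_section M L s \<and> s x \<noteq> smul L 0 (s x))"

section \<open>Tensor powers and determinants\<close>

text \<open>The k-th tensor power of a finite-dimensional space is taken to be the space of k-linear
  functions on its dual, and the k-th exterior power the subspace of alternating ones. Functions
  are extensional, so that they are determined by their values on their domain.\<close>

definition dual :: "('x, 'e) vbundle \<Rightarrow> 'x \<Rightarrow> ('e \<Rightarrow> complex) set" where
  "dual E x = {l \<in> extensional (fibre E x).
     (\<forall>u\<in>fibre E x. \<forall>v\<in>fibre E x. l (vadd E u v) = l u + l v) \<and>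
     (\<forall>u\<in>fibre E x. \<forall>c. l (smul E c u) = c * l u)}"

definition tensors ::
  "('x, 'e) vbundle \<Rightarrow> nat \<Rightarrow> 'x \<Rightarrow> ((nat \<Rightarrow> 'e \<Rightarrow> complex) \<Rightarrow> complex) set" where
  "tensors E k x = {t \<in> extensional ({..<k} \<rightarrow>\<^sub>E dual E x).
     \<forall>w \<in> {..<k} \<rightarrow>\<^sub>E dual E x. \<forall>j<k. \<forall>l\<in>dual E x.
       t (w(j := \<lambda>e\<in>fibre E x. w j e + l e)) = t w + t (w(j := l)) \<and>
       (\<forall>c. t (w(j := \<lambda>e\<in>fibre E x. c * l e)) = c * t (w(j := l)))}"

definition alternating_tensors ::
  "('x, 'e) vbundle \<Rightarrow> nat \<Rightarrow> 'x \<Rightarrow> ((nat \<Rightarrow> 'e \<Rightarrow> complex) \<Rightarrow> complex) set" where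
  "alternating_tensors E k x = {t \<in> tensors E k x.
     \<forall>w \<in> {..<k} \<rightarrow>\<^sub>E dual E x. \<forall>i<k. \<forall>j<k. i \<noteq> j \<and> w i = w j \<longrightarrow> t w = 0}"

text \<open>The i-th member of the frame of the dual bundle given by a trivialisation.\<close>

definition coord_form :: "('x, 'e) vbundle \<Rightarrow> ('e \<Rightarrow> nat \<Rightarrow> complex) \<Rightarrow> 'x \<Rightarrow> nat \<Rightarrow> 'e \<Rightarrow> complex" where
  "coord_form E \<phi> x i = (\<lambda>e\<in>fibre E x. \<phi> e i)"

definition tensor_add ::
  "('x, 'e) vbundle \<Rightarrow> nat \<Rightarrow> 'x \<times> ((nat \<Rightarrow> 'e \<Rightarrow> complex) \<Rightarrow> complex)
     \<Rightarrow> 'x \<times> ((nat \<Rightarrow> 'e \<Rightarrow> complex) \<Rightarrow> complex) \<Rightarrow> 'x \<times> ((nat \<Rightarrow> 'e \<Rightarrow> complex) \<Rightarrow> complex)" where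
  "tensor_add E k = (\<lambda>(x, t) (y, u). (x, \<lambda>w\<in>{..<k} \<rightarrow>\<^sub>E dual E x. t w + u w))"

definition tensor_smul ::
  "('x, 'e) vbundle \<Rightarrow> nat \<Rightarrow> complex
     \<Rightarrow> 'x \<times> ((nat \<Rightarrow> 'e \<Rightarrow> complex) \<Rightarrow> complex) \<Rightarrow> 'x \<times> ((nat \<Rightarrow> 'e \<Rightarrow> complex) \<Rightarrow> complex)" where
  "tensor_smul E k c = (\<lambda>(x, t). (x, \<lambda>w\<in>{..<k} \<rightarrow>\<^sub>E dual E x. c * t w))"

text \<open>The k-th tensor power of a line bundle L. A frame f of L with dual frame f' induces the
  frame f tensored k times, and the corresponding coordinate of t is its value at (f', ..., f').\<close>

definition line_power ::
  "'x cmfd \<Rightarrow> ('x, 'e) vbundle \<Rightarrow> nat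
     \<Rightarrow> ('x, 'x \<times> ((nat \<Rightarrow> 'e \<Rightarrow> complex) \<Rightarrow> complex)) vbundle" where
  "line_power M L k =
     \<lparr> total_space = {(x, t). x \<in> topspace (topo M) \<and> t \<in> tensors L k x},
       proj = fst,
       vrank = 1,
       vadd = tensor_add L k,
       smul = tensor_smul L k,
       trivs = (\<lambda>(U, \<phi>). (U, \<lambda>(x, t) i.
         if i = 0 then t (\<lambda>j\<in>{..<k}. coord_form L \<phi> x 0) else 0)) ` trivs L \<rparr>"

text \<open>The determinant, i.e. the top exterior power. A frame of E with dual frame (f'(0), f'(1), ...)
  induces the wedge product of its members, and the corresponding coordinate of t is its value at
  that dual frame.\<close>

definition det_bundle ::
  "'x cmfd \<Rightarrow> ('x, 'e) vbundle
     \<Rightarrow> ('x, 'x \<times> ((nat \<Rightarrow> 'e \<Rightarrow> complex) \<Rightarrow> complex)) vbundle" where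
  "det_bundle M E =
     \<lparr> total_space = {(x, t). x \<in> topspace (topo M) \<and> t \<in> alternating_tensors E (vrank E) x},
       proj = fst,
       vrank = 1,
       vadd = tensor_add E (vrank E),
       smul = tensor_smul E (vrank E),
       trivs = (\<lambda>(U, \<phi>). (U, \<lambda>(x, t) i.
         if i = 0 then t (\<lambda>j\<in>{..<vrank E}. coord_form E \<phi> x j) else 0)) ` trivs E \<rparr>"

definition semiample :: "'x cmfd \<Rightarrow> ('x, 'e) vbundle \<Rightarrow> bool" where
  "semiample M L \<longleftrightarrow> (\<exists>k>0. base_point_free M (line_power M L k))"

section \<open>The projective bundle of one-dimensional quotients\<close>

text \<open>A one-dimensional quotient of the fibre over x is represented by its kernel H, a linear
  hyperplane; the quotient space consists of the cosets of H.\<close>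

definition coset :: "('x, 'e) vbundle \<Rightarrow> 'e set \<Rightarrow> 'e \<Rightarrow> 'e set" where
  "coset E H u = vadd E u ` H"

definition hyperplane :: "('x, 'e) vbundle \<Rightarrow> 'x \<Rightarrow> 'e set \<Rightarrow> bool" where
  "hyperplane E x H \<longleftrightarrow>
     H \<subseteq> fibre E x \<and> H \<noteq> {} \<and>
     (\<forall>u\<in>H. \<forall>v\<in>H. vadd E u v \<in> H) \<and> (\<forall>u\<in>H. \<forall>c. smul E c u \<in> H) \<and>
     (\<exists>v \<in> fibre E x - H. \<forall>u\<in>fibre E x. \<exists>c. u \<in> coset E H (smul E c v))"

definition proj_points :: "'x cmfd \<Rightarrow> ('x, 'e) vbundle \<Rightarrow> ('x \<times> 'e set) set" where
  "proj_points M E = {(x, H). x \<in> topspace (topo M) \<and> hyperplane E x H}"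

definition frame :: "('x, 'e) vbundle \<Rightarrow> ('e \<Rightarrow> nat \<Rightarrow> complex) \<Rightarrow> 'x \<Rightarrow> nat \<Rightarrow> 'e" where
  "frame E \<phi> x a = inv_into (fibre E x) \<phi> (\<lambda>i. if i = a then 1 else 0)"

text \<open>The standard open set where the class of the a-th frame vector generates the quotient, and
  the coordinate of a coset C with respect to this generator.\<close>

definition std_open ::
  "'x cmfd \<Rightarrow> ('x, 'e) vbundle \<Rightarrow> 'x set \<Rightarrow> ('e \<Rightarrow> nat \<Rightarrow> complex) \<Rightarrow> nat \<Rightarrow> ('x \<times> 'e set) set" where
  "std_open M E W \<phi> a = {(x, H) \<in> proj_points M E. x \<in> W \<and> frame E \<phi> x a \<notin> H}"

definition coset_coord ::
  "('x, 'e) vbundle \<Rightarrow> ('e \<Rightarrow> nat \<Rightarrow> complex) \<Rightarrow> 'x \<Rightarrow> nat \<Rightarrow> 'e set \<Rightarrow> complex" where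
  "coset_coord E \<phi> x a C = (THE c. smul E c (frame E \<phi> x a) \<in> C)"

text \<open>The coordinates of (x, H) are those of x, followed by the coordinates of the classes of the
  frame vectors other than the a-th one, i.e. by the affine coordinates of the quotient map
  (as a point of the projectivised dual of the fibre) normalised to be 1 on the a-th frame vector.\<close>

definition proj_chart ::
  "'x cmfd \<Rightarrow> ('x, 'e) vbundle \<Rightarrow> ('x \<Rightarrow> nat \<Rightarrow> complex) \<Rightarrow> ('e \<Rightarrow> nat \<Rightarrow> complex) \<Rightarrow> nat
     \<Rightarrow> 'x \<times> 'e set \<Rightarrow> nat \<Rightarrow> complex" where
  "proj_chart M E \<psi> \<phi> a = (\<lambda>(x, H) i.
     if i < cdim M then \<psi> x i
     else if i < cdim M + (vrank E - 1) then
       (let j = i - cdim M; b = (if j < a then j else Suc j)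
        in coset_coord E \<phi> x a (coset E H (frame E \<phi> x b)))
     else 0)"

definition proj_charts ::
  "'x cmfd \<Rightarrow> ('x, 'e) vbundle
     \<Rightarrow> (('x \<times> 'e set) set \<times> ('x \<times> 'e set \<Rightarrow> nat \<Rightarrow> complex)) set" where
  "proj_charts M E = {(std_open M E (U \<inter> W) \<phi> a, proj_chart M E \<psi> \<phi> a) | U \<psi> W \<phi> a.
     (U, \<psi>) \<in> charts M \<and> (W, \<phi>) \<in> trivs E \<and> a < vrank E}"

definition proj_bundle :: "'x cmfd \<Rightarrow> ('x, 'e) vbundle \<Rightarrow> ('x \<times> 'e set) cmfd" where
  "proj_bundle M E =
     \<lparr> topo = topology_generated_by {{p \<in> D. \<kappa> p \<in> V} | D \<kappa> V.
         (D, \<kappa>) \<in> proj_charts M E \<and>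
         openin (top_of_set (cspace (cdim M + (vrank E - 1)))) V},
       cdim = cdim M + (vrank E - 1),
       charts = proj_charts M E \<rparr>"

text \<open>The tautological quotient line bundle, whose fibre over (x, H) is the quotient of the fibre
  of E over x by H.\<close>

definition taut_bundle ::
  "'x cmfd \<Rightarrow> ('x, 'e) vbundle \<Rightarrow> ('x \<times> 'e set, ('x \<times> 'e set) \<times> 'e set) vbundle" where
  "taut_bundle M E =
     \<lparr> total_space = {((x, H), coset E H u) | x H u. (x, H) \<in> proj_points M E \<and> u \<in> fibre E x},
       proj = fst,
       vrank = 1,
       vadd = (\<lambda>(p, C) (q, D). (p, {vadd E c d | c d. c \<in> C \<and> d \<in> D})),
       smul = (\<lambda>z ((x, H), C). ((x, H), {vadd E (smul E z c) h | c h. c \<in> C \<and> h \<in> H})),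
       trivs = {(std_open M E W \<phi> a, \<lambda>((x, H), C) i.
           if i = 0 then coset_coord E \<phi> x a C else 0) | W \<phi> a.
         (W, \<phi>) \<in> trivs E \<and> a < vrank E} \<rparr>"

definition weakly_semiample :: "'x cmfd \<Rightarrow> ('x, 'e) vbundle \<Rightarrow> bool" where
  "weakly_semiample M E \<longleftrightarrow>
     (\<exists>m>0. base_point_free (proj_bundle M E) (line_power (proj_bundle M E) (taut_bundle M E) m))"

end

theory Submission
  imports
    "HOL-Library.Function_Algebras"
    "HOL-Computational_Algebra.Fundamental_Theorem_Algebra"
    "HOL-Complex_Analysis.Cauchy_Integral_Formula"
    "Jordan_Normal_Form.Char_Poly"
    Defs
begin

text \<open>A section of \<open>O(m)\<close> on \<open>P(E)\<close> is, on each dual fibre \<open>E\<^sub>x\<^sup>*\<close>, a form of degree \<open>m\<close>, and base point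
  freeness says that these forms have no common zero other than \<open>0\<close>. Composing them with the columns of an
  \<open>r \<times> r\<close> matrix \<open>g\<close>, viewed as an \<open>r\<close>-tuple of covectors, gives forms on the space of matrices without common
  zeros other than \<open>0\<close>. By the Nullstellensatz all polynomials in \<open>g\<close> are finite over the algebra \<open>B\<close> they
  generate, so \<open>det\<^sup>n + b\<^sub>1 det\<^sup>n\<^sup>-\<^sup>1 + \<dots> + b\<^sub>n = 0\<close> with \<open>b\<^sub>q \<in> B\<close> of degree \<open>r q\<close>. Pairing with \<open>det\<^sup>n\<close> in the
  unitarily invariant inner product, some \<open>b\<^sub>q det\<^sup>n\<^sup>-\<^sup>q\<close> pairs to a nonzero number. Now let the base point vary in
  the coefficients of \<open>b\<^sub>q\<close>: since pairing with \<open>det\<^sup>n\<close> is semi-invariant under \<open>g \<mapsto> A g\<close>, the result is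
  a holomorphic section of \<open>det(E)\<^sup>q\<close> that does not vanish at the given point. As \<open>q\<close> depends on the point,
  compactness is needed to find a common power.\<close>

section \<open>Graded algebras of functions and the Nullstellensatz\<close>

text \<open>The coefficients of the integral equation have the right degree but are not
  semi-invariant under a change of trivialisation. Extracting the semi-invariant part would
  classically be an average over the unitary group; pairing with \<open>det^n\<close> takes its
  place. As \<open>det^n\<close> is a sum of powers of linear forms, the pairing is a finite sum
  over fixed matrices with fixed weights, so the base point enters only through values of sections
  at fixed covector coordinates, and holomorphy can be read off in charts of the projective bundle.
  The weight count behind the power q: the form \<open>b_q * det^(n - q)\<close> has degree r n, its
  pairing picks up \<open>det(A)^n\<close> under left multiplication by A, and the factor
  \<open>det^(n - q)\<close> accounts for n - q of these, which leaves weight q. Polynomials are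
  plain functions here, so a degree is a property of a derivation and not of the function. Wherever
  degrees must be compared, the argument is scaled by a parameter t and coefficients of polynomials
  in t are compared.\<close>

text \<open>The part of degree \<open>d\<close> of the algebra generated by \<open>G\<close>, every generator having degree \<open>m\<close>. For \<open>m = d = 0\<close>
  this is the whole algebra.\<close>

inductive galg :: "('p \<Rightarrow> complex) set \<Rightarrow> nat \<Rightarrow> nat \<Rightarrow> ('p \<Rightarrow> complex) \<Rightarrow> bool" for G m where
  const: "galg G m 0 (\<lambda>x. c)"
| zero: "galg G m d (\<lambda>x. 0)"
| gen: "g \<in> G \<Longrightarrow> galg G m d b \<Longrightarrow> galg G m (d + m) (\<lambda>x. g x * b x)"
| add: "galg G m d a \<Longrightarrow> galg G m d b \<Longrightarrow> galg G m d (\<lambda>x. a x + b x)"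

lemma galg_scale: "galg G m d b \<Longrightarrow> galg G m d (\<lambda>x. c * b x)"
proof (induction rule: galg.induct)
  case (const c')
  show ?case by (rule galg.const)
next
  case (zero d)
  show ?case using galg.zero by simp
next
  case (gen g d b)
  have "galg G m (d + m) (\<lambda>x. g x * (c * b x))" by (rule galg.gen) (use gen in auto)
  then show ?case by (simp add: mult.left_commute)
next
  case (add d a b)
  have "galg G m d (\<lambda>x. c * a x + c * b x)" by (rule galg.add) (use add in auto)
  then show ?case by (simp add: distrib_left)
qed

lemma galg_mult: "galg G m d a \<Longrightarrow> galg G m e b \<Longrightarrow> galg G m (d + e) (\<lambda>x. a x * b x)"
proof (induction rule: galg.induct)
  case (const c)
  then show ?case by (simp add: galg_scale)
next
  case (zero d)
  show ?case using galg.zero by simp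
next
  case (gen g d a)
  have "galg G m ((d + e) + m) (\<lambda>x. g x * (a x * b x))" by (rule galg.gen) (use gen in auto)
  then show ?case by (simp add: mult.assoc add_ac)
next
  case (add d a a')
  have "galg G m (d + e) (\<lambda>x. a x * b x + a' x * b x)" by (rule galg.add) (use add in auto)
  then show ?case by (simp add: distrib_right)
qed

lemma galg_diff: "galg G m d a \<Longrightarrow> galg G m d b \<Longrightarrow> galg G m d (\<lambda>x. a x - b x)"
  using galg.add[of G m d a "\<lambda>x. -1 * b x"] galg_scale[of G m d b "-1"] by simp

lemma galg_generator: "g \<in> G \<Longrightarrow> galg G m m g"
  using galg.gen[OF _ galg.const, of g G m 1] by simp

lemma galg_sum: "(\<And>i. i \<in> S \<Longrightarrow> galg G m d (b i)) \<Longrightarrow> galg G m d (\<lambda>x. \<Sum>i\<in>S. b i x)"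
  by (induction S rule: infinite_finite_induct) (auto intro: galg.zero galg.add)

lemma galg_prod:
  "(\<And>i. i \<in> S \<Longrightarrow> galg G m (d i) (b i)) \<Longrightarrow> galg G m (\<Sum>i\<in>S. d i) (\<lambda>x. \<Prod>i\<in>S. b i x)"
  by (induction S rule: infinite_finite_induct) (auto intro: galg.const galg_mult)

lemma galg_power: "galg G m d b \<Longrightarrow> galg G m (d * n) (\<lambda>x. b x ^ n)"
  using galg_prod[of "{..<n}" G m "\<lambda>_. d" "\<lambda>_. b"] by (simp add: mult.commute)

lemma galg_homogeneous:
  assumes "galg G m d b" and "\<And>g x. g \<in> G \<Longrightarrow> g (h x) = c ^ m * g x"
  shows "b (h x) = c ^ d * b x"
  using assms(1) by (induction rule: galg.induct) (auto simp: assms(2) power_add algebra_simps)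

lemma galg_trans:
  assumes "galg G m d b" and "\<And>g. g \<in> G \<Longrightarrow> galg H 1 m g"
  shows "galg H 1 d b"
  using assms(1)
proof (induction rule: galg.induct)
  case (gen g d b)
  then show ?case using galg_mult[OF assms(2)[OF gen.hyps(1)] gen.IH] by (simp add: add.commute)
qed (auto intro: galg.intros)

lemma galg_ungraded: "galg G m d b \<Longrightarrow> galg G 0 0 b"
proof (induction rule: galg.induct)
  case (gen g d b)
  then show ?case using galg.gen[of g G 0 0 b] by simp
qed (auto intro: galg.intros)

text \<open>Components are only claimed to exist: generators may satisfy relations, so one function
  can have several decompositions. The degree \<open>m\<close> of the generators is chosen anew,
  which lets an element of \<open>galg G 0 0\<close> regain a grading; vanishing from
  \<open>N\<close> on allows sums of different lengths to be merged.\<close>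

lemma galg_graded_decomp:
  assumes "galg G m' d' p"
  shows "\<exists>N c. (\<forall>d. galg G m d (c d)) \<and> (\<forall>x. p x = (\<Sum>d<N. c d x)) \<and> (\<forall>d\<ge>N. c d = (\<lambda>x. 0))"
  using assms
proof (induction rule: galg.induct)
  case (const k)
  show ?case
    by (rule exI[of _ 1], rule exI[of _ "\<lambda>d x. if d = 0 then k else 0"]) (auto intro: galg.const galg.zero)
next
  case (zero d)
  show ?case by (rule exI[of _ 0], rule exI[of _ "\<lambda>d x. 0"]) (auto intro: galg.zero)
next
  case (gen g d b)
  then obtain N c where c: "\<forall>d. galg G m d (c d)" "\<forall>x. b x = (\<Sum>d<N. c d x)" "\<forall>d\<ge>N. c d = (\<lambda>x. 0)"
    by (elim exE conjE)
  define c' where "c' = (\<lambda>d x. if d < m then 0 else g x * c (d - m) x)"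
  show ?case
  proof (intro exI[of _ "N + m"] exI[of _ c'] conjI allI impI)
    show "galg G m d (c' d)" for d
      using galg.gen[OF gen.hyps(1) c(1)[rule_format, of "d - m"]]
      by (cases "d < m") (simp_all add: c'_def galg.zero)
    show "c' d = (\<lambda>x. 0)" if "N + m \<le> d" for d
    proof -
      have "c (d - m) = (\<lambda>x. 0)" using c(3) that by simp
      then show ?thesis by (simp add: c'_def fun_eq_iff)
    qed
    show "g x * b x = (\<Sum>d<N + m. c' d x)" for x
    proof -
      have "(\<Sum>d<N + m. c' d x) = (\<Sum>d\<in>{m..<N + m}. c' d x)"
        by (rule sum.mono_neutral_right) (auto simp: c'_def)
      also have "\<dots> = (\<Sum>d\<in>{0..<N}. c' (d + m) x)"
        using sum.shift_bounds_nat_ivl[of "\<lambda>d. c' d x" 0 m N] by simp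
      also have "\<dots> = g x * b x" using c(2) by (simp add: c'_def sum_distrib_left atLeast0LessThan)
      finally show ?thesis by simp
    qed
  qed
next
  case (add d a b)
  from add.IH(1) obtain N c where c: "\<forall>d. galg G m d (c d)" "\<forall>x. a x = (\<Sum>d<N. c d x)" "\<forall>d\<ge>N. c d = (\<lambda>x. 0)"
    by (elim exE conjE)
  from add.IH(2) obtain N' c' where c': "\<forall>d. galg G m d (c' d)" "\<forall>x. b x = (\<Sum>d<N'. c' d x)" "\<forall>d\<ge>N'. c' d = (\<lambda>x. 0)"
    by (elim exE conjE)
  show ?case
  proof (intro exI[of _ "max N N'"] exI[of _ "\<lambda>d x. c d x + c' d x"] conjI allI impI)
    show "galg G m d (\<lambda>x. c d x + c' d x)" for d by (intro galg.add c(1)[rule_format] c'(1)[rule_format])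
    show "(\<lambda>x. c d x + c' d x) = (\<lambda>x. 0)" if "max N N' \<le> d" for d using c(3) c'(3) that by simp
    show "a x + b x = (\<Sum>d<max N N'. c d x + c' d x)" for x
    proof -
      have "(\<Sum>d<max N N'. c d x) = (\<Sum>d<N. c d x)"
        using c(3) by (intro sum.mono_neutral_right) auto
      moreover have "(\<Sum>d<max N N'. c' d x) = (\<Sum>d<N'. c' d x)"
        using c'(3) by (intro sum.mono_neutral_right) auto
      ultimately show ?thesis using c(2) c'(2) by (simp add: sum.distrib)
    qed
  qed
qed

section \<open>Maximal ideals of the ring of polynomial functions and the weak
  Nullstellensatz\<close>

definition coord :: "'i set \<Rightarrow> (('i \<Rightarrow> complex) \<Rightarrow> complex) set" where
  "coord I = (\<lambda>i x. x i) ` I"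

definition ideal_of :: "(('p \<Rightarrow> complex) \<Rightarrow> bool) \<Rightarrow> ('p \<Rightarrow> complex) set \<Rightarrow> bool" where
  "ideal_of R J \<longleftrightarrow> (\<forall>p\<in>J. R p) \<and> (\<lambda>x. 0) \<in> J \<and> (\<forall>p\<in>J. \<forall>q\<in>J. (\<lambda>x. p x + q x) \<in> J) \<and>
     (\<forall>p\<in>J. \<forall>r. R r \<longrightarrow> (\<lambda>x. r x * p x) \<in> J)"

lemma ideal_mem: "ideal_of R J \<Longrightarrow> p \<in> J \<Longrightarrow> R p"
  and ideal_zero: "ideal_of R J \<Longrightarrow> (\<lambda>x. 0) \<in> J"
  and ideal_add: "ideal_of R J \<Longrightarrow> p \<in> J \<Longrightarrow> q \<in> J \<Longrightarrow> (\<lambda>x. p x + q x) \<in> J"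
  and ideal_mult: "ideal_of R J \<Longrightarrow> R r \<Longrightarrow> p \<in> J \<Longrightarrow> (\<lambda>x. r x * p x) \<in> J"
  by (simp_all add: ideal_of_def)

lemma maximal_ideal_exists:
  assumes "ideal_of R J" and "(\<lambda>x. 1) \<notin> J"
  obtains M where "ideal_of R M" and "J \<subseteq> M" and "(\<lambda>x. 1) \<notin> M"
    and "\<And>N. ideal_of R N \<Longrightarrow> M \<subseteq> N \<Longrightarrow> (\<lambda>x. 1) \<notin> N \<Longrightarrow> N = M"
proof -
  let ?A = "{N. ideal_of R N \<and> J \<subseteq> N \<and> (\<lambda>x. 1) \<notin> N}"
  have "\<exists>M\<in>?A. \<forall>X\<in>?A. M \<subseteq> X \<longrightarrow> X = M"
  proof (rule subset_Zorn_nonempty)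
    show "?A \<noteq> {}" using assms by auto
  next
    fix C assume ne: "C \<noteq> {}" and ch: "subset.chain ?A C"
    have sub: "C \<subseteq> ?A" and lin: "\<And>N N'. N \<in> C \<Longrightarrow> N' \<in> C \<Longrightarrow> N \<subseteq> N' \<or> N' \<subseteq> N"
      using ch unfolding subset_chain_def by (simp, blast)
    have idC: "ideal_of R N" if "N \<in> C" for N using subsetD[OF sub that] by simp
    have "ideal_of R (\<Union>C)" unfolding ideal_of_def
    proof (intro conjI ballI allI impI)
      obtain N where N: "N \<in> C" using ne by blast
      show "(\<lambda>x. 0) \<in> \<Union>C" using N ideal_zero[OF idC[OF N]] by (rule UnionI)
    next
      fix p assume "p \<in> \<Union>C"
      then obtain N where N: "N \<in> C" "p \<in> N" by (rule UnionE)
      show "R p" by (rule ideal_mem[OF idC[OF N(1)] N(2)])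
      show "(\<lambda>x. r x * p x) \<in> \<Union>C" if "R r" for r
        using ideal_mult[OF idC[OF N(1)] that N(2)] N(1) by (rule UnionI[rotated])
      show "(\<lambda>x. p x + q x) \<in> \<Union>C" if "q \<in> \<Union>C" for q
      proof -
        from that obtain N' where N': "N' \<in> C" "q \<in> N'" by (rule UnionE)
        consider "N \<subseteq> N'" | "N' \<subseteq> N" using lin[OF N(1) N'(1)] by (elim disjE)
        then show ?thesis
        proof cases
          case 1
          show ?thesis
            using ideal_add[OF idC[OF N'(1)] subsetD[OF 1 N(2)] N'(2)] N'(1) by (rule UnionI[rotated])
        next
          case 2
          show ?thesis
            using ideal_add[OF idC[OF N(1)] N(2) subsetD[OF 2 N'(2)]] N(1) by (rule UnionI[rotated])
        qed
      qed
    qed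
    then show "\<Union>C \<in> ?A" using ne sub by auto
  qed
  then obtain M where M: "M \<in> ?A" "\<forall>X\<in>?A. M \<subseteq> X \<longrightarrow> X = M" by (rule bexE)
  show ?thesis by (rule that[of M]) (use M in auto)
qed

text \<open>Countable dimension of the polynomial algebra, in the form needed for a counting
  argument: a countable union of spans of finite sets.\<close>

lemma span_of_polynomials:
  assumes "finite I"
  obtains F :: "nat \<Rightarrow> (('i \<Rightarrow> complex) \<Rightarrow> complex) set" where "\<And>N. finite (F N)"
    and "\<And>p. galg (coord I) 0 0 p \<Longrightarrow>
      \<exists>N. p \<in> module.span (\<lambda>(c::complex) f x. c * f x) (F N)"
proof -
  interpret vector_space "\<lambda>(c::complex) (f::('i \<Rightarrow> complex) \<Rightarrow> complex) x. c * f x"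
    by unfold_locales (auto simp: fun_eq_iff algebra_simps)
  \<comment> \<open>\<open>F N\<close> consists of the monomials of degree at most \<open>N\<close>;
    multiplication by a coordinate raises the index by one.\<close>
  define F :: "nat \<Rightarrow> (('i \<Rightarrow> complex) \<Rightarrow> complex) set" where
    "F = rec_nat {\<lambda>x. 1} (\<lambda>_ S. S \<union> (\<lambda>(i, f) x. x i * f x) ` (I \<times> S))"
  have F0: "F 0 = {\<lambda>x. 1}" and FS: "F (Suc N) = F N \<union> (\<lambda>(i, f) x. x i * f x) ` (I \<times> F N)" for N
    by (simp_all add: F_def)
  have fin: "finite (F N)" for N
    by (induction N) (use assms in \<open>simp_all add: F0 FS\<close>)
  have mono: "F N \<subseteq> F N'" if "N \<le> N'" for N N'
    by (rule lift_Suc_mono_le[OF _ that]) (simp add: FS)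
  have up: "(\<lambda>x. x i * p x) \<in> span (F (Suc N))" if "i \<in> I" "p \<in> span (F N)" for i p N
    using that(2)
  proof (induction rule: span_induct_alt)
    case base
    show ?case using span_zero by (simp add: zero_fun_def)
  next
    case (step c f y)
    have "(\<lambda>x. x i * f x) \<in> F (Suc N)" using step(1) that(1) by (force simp: FS)
    then have "(\<lambda>x. c * (x i * f x)) \<in> span (F (Suc N))" by (intro span_scale span_base)
    from span_add[OF this step(2)] show ?case
      by (simp add: plus_fun_def algebra_simps)
  qed
  have "\<exists>N. p \<in> span (F N)" if "galg (coord I) m d p" for p m d
    using that
  proof (induction rule: galg.induct)
    case (const c)
    have "(\<lambda>x. c * 1) \<in> span (F 0)"
      using span_scale[of "\<lambda>x. 1" "F 0" c] span_base[of "\<lambda>x. 1" "F 0"] by (simp add: F0)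
    then show ?case by auto
  next
    case (zero d)
    show ?case using span_zero by (auto simp: zero_fun_def)
  next
    case (gen g d b)
    then show ?case using up by (auto simp: coord_def)
  next
    case (add d a b)
    then obtain N N' where "a \<in> span (F N)" "b \<in> span (F N')" by auto
    then have "a \<in> span (F (max N N'))" "b \<in> span (F (max N N'))"
      using span_mono[OF mono[of N "max N N'"]] span_mono[OF mono[of N' "max N N'"]] by auto
    from span_add[OF this] show ?case by (auto simp: plus_fun_def)
  qed
  then show ?thesis using that fin by blast
qed

lemma galg_coord: "i \<in> I \<Longrightarrow> galg (coord I) m m (\<lambda>x. x i)"
  by (rule galg_generator) (simp add: coord_def)

lemma galg_poly:
  assumes "i \<in> I" shows "galg (coord I) 0 0 (\<lambda>x. poly u (x i))"
proof (induction u)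
  case 0
  show ?case by (simp add: galg.zero)
next
  case (pCons a u)
  have "galg (coord I) 0 0 (\<lambda>x. a + x i * poly u (x i))"
    by (intro galg.add galg.const galg_mult[where d=0 and e=0, simplified] galg_coord assms pCons)
  then show ?case by simp
qed

text \<open>By maximality the ideal generated by \<open>M\<close> and \<open>p\<close> contains 1,
  and an expression \<open>j + p * q\<close> for 1 exhibits the inverse: the quotient by
  \<open>M\<close> is a field.\<close>

lemma maximal_ideal_inverse:
  assumes "ideal_of (galg X 0 0) M" and "(\<lambda>x. 1) \<notin> M"
    and max: "\<And>N. ideal_of (galg X 0 0) N \<Longrightarrow> M \<subseteq> N \<Longrightarrow> (\<lambda>x. 1) \<notin> N \<Longrightarrow> N = M"
    and p: "galg X 0 0 p" "p \<notin> M"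
  obtains q where "galg X 0 0 q" and "(\<lambda>x. p x * q x - 1) \<in> M"
proof -
  let ?R = "galg X 0 0"
  define N where "N = {r. \<exists>j\<in>M. \<exists>q. ?R q \<and> r = (\<lambda>x. j x + p x * q x)}"
  note mul = galg_mult[where d=0 and e=0, simplified]
  have NI: "(\<lambda>x. j x + p x * q x) \<in> N" if "j \<in> M" "?R q" for j q
    unfolding N_def by (intro CollectI bexI[of _ j] exI[of _ q] conjI refl that)
  have "ideal_of ?R N" unfolding ideal_of_def
  proof (intro conjI ballI allI impI)
    show "(\<lambda>x. 0) \<in> N" using NI[OF ideal_zero[OF assms(1)] galg.zero] by simp
  next
    fix a assume "a \<in> N"
    then obtain j q where a: "j \<in> M" "?R q" "a = (\<lambda>x. j x + p x * q x)" by (auto simp: N_def)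
    show "?R a" unfolding a(3)
      by (intro galg.add mul p(1) a(2) ideal_mem[OF assms(1) a(1)])
    show "(\<lambda>x. r x * a x) \<in> N" if "?R r" for r
    proof -
      have "(\<lambda>x. r x * a x) = (\<lambda>x. r x * j x + p x * (r x * q x))"
        by (simp add: a(3) fun_eq_iff algebra_simps)
      also have "\<dots> \<in> N"
        by (rule NI[OF ideal_mult[OF assms(1), OF that a(1)] mul[OF that a(2)]])
      finally show ?thesis .
    qed
    show "(\<lambda>x. a x + b x) \<in> N" if "b \<in> N" for b
    proof -
      from that obtain j' q' where b: "j' \<in> M" "?R q'" "b = (\<lambda>x. j' x + p x * q' x)"
        by (auto simp: N_def)
      have "(\<lambda>x. a x + b x) = (\<lambda>x. (j x + j' x) + p x * (q x + q' x))"
        by (simp add: a(3) b(3) fun_eq_iff algebra_simps)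
      also have "\<dots> \<in> N"
        by (rule NI[OF ideal_add[OF assms(1) a(1) b(1)] galg.add[OF a(2) b(2)]])
      finally show ?thesis .
    qed
  qed
  moreover have "M \<subseteq> N" using NI[OF _ galg.zero] by auto
  moreover have "p \<in> N" using NI[OF ideal_zero[OF assms(1)] galg.const[where c=1]] by simp
  ultimately have "(\<lambda>x. 1) \<in> N" using max p(2) by auto
  then obtain j q where jq: "j \<in> M" "?R q" "(\<lambda>x. 1) = (\<lambda>x. j x + p x * q x)"
    by (auto simp: N_def)
  have "(\<lambda>x. p x * q x - 1) = (\<lambda>x. (\<lambda>x. -1) x * j x)"
    using fun_cong[OF jq(3)] by (simp add: fun_eq_iff algebra_simps add_eq_0_iff)
  then have "(\<lambda>x. p x * q x - 1) \<in> M" using ideal_mult[OF assms(1), OF galg.const jq(1), of "-1"] by simp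
  then show ?thesis by (rule that[OF jq(2)])
qed

text \<open>The quotient by a maximal ideal has countable dimension over the uncountable field of complex
  numbers, whereas the inverses of the elements \<open>x\<^sub>i - c\<close> would be linearly independent.\<close>

lemma maximal_ideal_contains_linear:
  assumes I: "finite I" "i \<in> I"
    and M: "ideal_of (galg (coord I) 0 0) M" "(\<lambda>x. 1) \<notin> M"
    and max: "\<And>N. ideal_of (galg (coord I) 0 0) N \<Longrightarrow> M \<subseteq> N \<Longrightarrow> (\<lambda>x. 1) \<notin> N \<Longrightarrow> N = M"
  shows "\<exists>c. (\<lambda>x. x i - c) \<in> M"
proof (rule ccontr)
  let ?R = "galg (coord I) 0 0"
  interpret vector_space "\<lambda>(c::complex) (f::('a \<Rightarrow> complex) \<Rightarrow> complex) x. c * f x"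
    by unfold_locales (auto simp: fun_eq_iff algebra_simps)
  note mul = galg_mult[where d=0 and e=0, simplified]
  assume "\<nexists>c. (\<lambda>x. x i - c) \<in> M"
  then have nM: "(\<lambda>x. x i - c) \<notin> M" for c by simp
  have lin: "?R (\<lambda>x. x i - c)" for c by (intro galg_diff galg.const galg_coord I)
  have "\<forall>c. \<exists>q. ?R q \<and> (\<lambda>x. (x i - c) * q x - 1) \<in> M"
  proof
    fix c
    obtain q where "?R q" "(\<lambda>x. (x i - c) * q x - 1) \<in> M"
      by (rule maximal_ideal_inverse[OF M max lin nM])
    then show "\<exists>q. ?R q \<and> (\<lambda>x. (x i - c) * q x - 1) \<in> M" by (intro exI conjI)
  qed
  from choice[OF this] obtain q where "\<forall>c. ?R (q c) \<and> (\<lambda>x. (x i - c) * q c x - 1) \<in> M"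
    by (rule exE)
  then have q: "\<And>c. ?R (q c)" "\<And>c. (\<lambda>x. (x i - c) * q c x - 1) \<in> M" by simp_all
  have sc: "(\<lambda>x. k * p x) \<in> M" if "p \<in> M" for p k
    using ideal_mult[OF M(1), OF galg.const that] .
  have dif: "(\<lambda>x. p x - p' x) \<in> M" if "p \<in> M" "p' \<in> M" for p p'
    using ideal_add[OF M(1) that(1) sc[OF that(2), of "-1"]] by simp
  \<comment> \<open>If two inverses coincided, the difference of their congruences would be a
    nonzero multiple of \<open>q c\<close>; so \<open>q c\<close> would lie in \<open>M\<close>, and
    with it 1.\<close>
  have inj: "inj q"
  proof (rule injI, rule ccontr)
    fix c c' assume eq: "q c = q c'" and ne: "c \<noteq> c'"
    have "(\<lambda>x. 1 / (c' - c) * (((x i - c) * q c x - 1) - ((x i - c') * q c' x - 1))) \<in> M"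
      by (intro sc dif q)
    also have "(\<lambda>x. 1 / (c' - c) * (((x i - c) * q c x - 1) - ((x i - c') * q c' x - 1))) = q c"
      using ne by (simp add: eq fun_eq_iff field_simps)
    finally have "(\<lambda>x. (x i - c) * q c x) \<in> M" using ideal_mult[OF M(1), OF lin] by blast
    from dif[OF this q(2)[of c]] M(2) show False by simp
  qed
  obtain F where F: "\<And>N. finite (F N)" "\<And>p. ?R p \<Longrightarrow> \<exists>N::nat. p \<in> span (F N)"
    using span_of_polynomials[OF I(1)] by blast
  \<comment> \<open>Uncountably many \<open>q c\<close> are distributed over countably many spans of
    finite sets, so one span contains infinitely many of them, more than its dimension permits for
    independent elements.\<close>
  have "\<exists>N. infinite {c. q c \<in> span (F N)}"
  proof (rule ccontr)
    assume "\<nexists>N. infinite {c. q c \<in> span (F N)}"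
    then have "countable (\<Union>N. {c. q c \<in> span (F N)})" by (intro countable_UN) (auto intro: countable_finite)
    moreover have "(\<Union>N. {c. q c \<in> span (F N)}) = UNIV" using F(2)[OF q(1)] by auto
    ultimately have "countable (range complex_of_real)" by (metis countable_subset subset_UNIV)
    then have "countable (UNIV :: real set)" by (rule countable_image_inj_on) (simp add: inj_def)
    then show False using uncountable_UNIV_real by simp
  qed
  then obtain N where N: "infinite {c. q c \<in> span (F N)}" by blast
  define C where "C = {c. q c \<in> span (F N)}"
  have "dependent (q ` C)"
  proof (rule ccontr)
    assume "independent (q ` C)"
    then have "finite (q ` C)" using independent_span_bound[OF F(1)[of N]] by (auto simp: C_def)
    then show False using N inj by (metis C_def finite_imageD inj_on_subset subset_UNIV)
  qed
  then obtain S u where S: "finite S" "S \<subseteq> q ` C" "(\<Sum>v\<in>S. (\<lambda>x. u v * v x)) = 0" "\<exists>v\<in>S. u v \<noteq> 0"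
    unfolding dependent_explicit by (elim exE conjE)
  obtain C' where C': "C' \<subseteq> C" "S = q ` C'" using S(2) by (rule subset_imageE)
  have injC: "inj_on q C'" using inj by (rule inj_on_subset) simp
  have finC: "finite C'" using S(1) C'(2) injC by (simp add: finite_image_iff)
  obtain a c0 where a: "c0 \<in> C'" "a c0 \<noteq> 0" "\<And>x. (\<Sum>c\<in>C'. a c * q c x) = 0"
  proof -
    obtain c0 where "c0 \<in> C'" "u (q c0) \<noteq> 0" using S(4) C'(2) by auto
    moreover have "(\<Sum>c\<in>C'. u (q c) * q c x) = 0" for x
    proof -
      have "(\<Sum>v\<in>T. (\<lambda>x. u v * v x)) x = (\<Sum>v\<in>T. u v * v x)" if "finite T" for T :: "(('a \<Rightarrow> complex) \<Rightarrow> complex) set"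
        using that by (induction T) auto
      from this[OF S(1)] S(3) show ?thesis by (simp add: C'(2) sum.reindex[OF injC])
    qed
    ultimately show ?thesis using that[of c0 "\<lambda>c. u (q c)"] by blast
  qed
  \<comment> \<open>The numerator of the sum of the partial fractions
    \<open>a c / (x i - c)\<close>: when the relation between the \<open>q c\<close> is multiplied
    by all factors \<open>x i - c\<close>, each \<open>q c\<close> cancels its own factor modulo
    \<open>M\<close>.\<close>
  define w where "w = (\<Sum>c\<in>C'. [:a c:] * (\<Prod>c'\<in>C' - {c}. [:-c', 1:]))"
  have "(\<lambda>x. poly w (x i)) \<in> M"
  proof -
    have prodR: "?R (\<lambda>x. \<Prod>c'\<in>T. (x i - c'))" for T
      using galg_prod[of T "coord I" 0 "\<lambda>_. 0" "\<lambda>c' x. x i - c'"] lin by simp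
    have sumM: "(\<lambda>x. \<Sum>c\<in>T. f c x) \<in> M" if "finite T" "\<And>c. c \<in> T \<Longrightarrow> f c \<in> M"
      for f :: "complex \<Rightarrow> ('a \<Rightarrow> complex) \<Rightarrow> complex" and T
      using that by (induction T) (auto intro: ideal_zero[OF M(1)] ideal_add[OF M(1)])
    have "(\<lambda>x. \<Sum>c\<in>C'. a c * ((\<Prod>c'\<in>C' - {c}. (x i - c')) * ((x i - c) * q c x - 1))) \<in> M"
      by (rule sumM[OF finC]) (intro sc ideal_mult[OF M(1)] prodR q)
    from sc[OF this, of "-1"]
    have "(\<lambda>x. - (\<Sum>c\<in>C'. a c * ((\<Prod>c'\<in>C' - {c}. (x i - c')) * ((x i - c) * q c x - 1)))) \<in> M"
      by simp
    also have "(\<lambda>x. - (\<Sum>c\<in>C'. a c * ((\<Prod>c'\<in>C' - {c}. (x i - c')) * ((x i - c) * q c x - 1)))) =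
      (\<lambda>x. poly w (x i))"
    proof
      fix x :: "'a \<Rightarrow> complex"
      have "(\<Sum>c\<in>C'. a c * ((\<Prod>c'\<in>C' - {c}. (x i - c')) * ((x i - c) * q c x - 1))) =
        (\<Sum>c\<in>C'. (\<Prod>c'\<in>C'. (x i - c')) * (a c * q c x) - a c * (\<Prod>c'\<in>C' - {c}. (x i - c')))"
        by (rule sum.cong[OF refl]) (simp add: prod.remove[OF finC] algebra_simps)
      also have "\<dots> = - poly w (x i)"
        by (simp add: sum_subtractf sum_distrib_left[symmetric] a(3) w_def poly_sum poly_prod)
      finally show "- (\<Sum>c\<in>C'. a c * ((\<Prod>c'\<in>C' - {c}. (x i - c')) * ((x i - c) * q c x - 1))) =
        poly w (x i)" by simp
    qed
    finally show ?thesis .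
  qed
  \<comment> \<open>At \<open>c0\<close> every summand but one contains the factor that vanishes
    there.\<close>
  moreover have "w \<noteq> 0"
  proof -
    have "poly w c0 = (\<Sum>c\<in>C'. if c = c0 then a c0 * (\<Prod>c'\<in>C' - {c0}. c0 - c') else 0)"
      unfolding w_def poly_sum
    proof (rule sum.cong[OF refl])
      fix c assume c: "c \<in> C'"
      show "poly ([:a c:] * (\<Prod>c'\<in>C' - {c}. [:- c', 1:])) c0 =
        (if c = c0 then a c0 * (\<Prod>c'\<in>C' - {c0}. c0 - c') else 0)"
        using a(1) c finC by (auto simp: poly_prod)
    qed
    also have "\<dots> = a c0 * (\<Prod>c'\<in>C' - {c0}. c0 - c')" using a(1) finC by simp
    also have "\<dots> \<noteq> 0" using a(2) finC by auto
    finally show ?thesis by auto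
  qed
  \<comment> \<open>A root \<open>c\<close> of \<open>w\<close> splits off \<open>x i - c\<close>,
    which is invertible modulo \<open>M\<close>; the remaining factor therefore still lies in
    \<open>M\<close>, and the degree drops until a nonzero constant does.\<close>
  ultimately show False
  proof (induction "degree w" arbitrary: w rule: less_induct)
    case less
    show False
    proof (cases "degree w = 0")
      case True
      then obtain k where k: "w = [:k:]" by (metis degree_eq_zeroE)
      then have "(\<lambda>x. 1 / k * poly w (x i)) = (\<lambda>x. 1)" using less.prems(2) by (simp add: fun_eq_iff)
      then show False using sc[OF less.prems(1), of "1 / k"] M(2) by simp
    next
      case False
      then obtain c where "poly w c = 0"
        using fundamental_theorem_of_algebra[of w] by (auto simp: constant_degree)
      then obtain v where v: "w = [:-c, 1:] * v" by (metis dvdE poly_eq_0_iff_dvd)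
      have v0: "v \<noteq> 0" using v less.prems(2) by auto
      have "(\<lambda>x. q c x * poly w (x i) - poly v (x i) * ((x i - c) * q c x - 1)) \<in> M"
        by (intro dif ideal_mult[OF M(1)] less.prems q galg_poly I)
      also have "(\<lambda>x. q c x * poly w (x i) - poly v (x i) * ((x i - c) * q c x - 1)) =
        (\<lambda>x. poly v (x i))"
        by (simp add: v fun_eq_iff algebra_simps)
      finally have "(\<lambda>x. poly v (x i)) \<in> M" .
      moreover have "degree v < degree w" using v0 by (simp add: v degree_mult_eq del: mult_pCons_left)
      ultimately show False using less.hyps v0 by blast
    qed
  qed
qed

text \<open>A maximal ideal above \<open>J\<close> contains \<open>x i - z i\<close> for suitable
  \<open>z\<close>, hence \<open>p - p z\<close> for every polynomial \<open>p\<close>; an element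
  of \<open>J\<close> with \<open>p z \<noteq> 0\<close> would put 1 into that ideal.\<close>

lemma weak_nullstellensatz:
  assumes I: "finite I" and J: "ideal_of (galg (coord I) 0 0) J" "(\<lambda>x. 1) \<notin> J"
  obtains z where "\<And>p. p \<in> J \<Longrightarrow> p z = 0"
proof -
  let ?R = "galg (coord I) 0 0"
  obtain M where M: "ideal_of ?R M" "J \<subseteq> M" "(\<lambda>x. 1) \<notin> M"
    and max: "\<And>N. ideal_of ?R N \<Longrightarrow> M \<subseteq> N \<Longrightarrow> (\<lambda>x. 1) \<notin> N \<Longrightarrow> N = M"
    using maximal_ideal_exists[OF J] by blast
  have "\<forall>i\<in>I. \<exists>c. (\<lambda>x. x i - c) \<in> M"
    using maximal_ideal_contains_linear[OF I _ M(1,3) max] by blast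
  then obtain z where z: "\<And>i. i \<in> I \<Longrightarrow> (\<lambda>x. x i - z i) \<in> M" by metis
  have ev: "(\<lambda>x. p x - p z) \<in> M" if "galg (coord I) m d p" for p m d
    using that
  proof (induction rule: galg.induct)
    case (gen g d b)
    then obtain i where i: "i \<in> I" "g = (\<lambda>x. x i)" by (auto simp: coord_def)
    have "(\<lambda>x. (b x * (x i - z i)) + (z i * (b x - b z))) \<in> M"
      by (intro ideal_add[OF M(1)] ideal_mult[OF M(1)] z i(1) gen.IH galg.const
          galg_ungraded[OF gen.hyps(2)])
    then show ?case by (simp add: i(2) algebra_simps)
  next
    case (add d a b)
    from ideal_add[OF M(1) add.IH] show ?case by (simp add: algebra_simps)
  qed (simp_all add: ideal_zero[OF M(1)])
  have "p z = 0" if "p \<in> J" for p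
  proof (rule ccontr)
    assume nz: "p z \<noteq> 0"
    have pM: "p \<in> M" using that M(2) by blast
    have "(\<lambda>x. 1 / p z * (p x + (-1) * (p x - p z))) \<in> M"
      by (intro ideal_mult[OF M(1)] ideal_add[OF M(1)] galg.const pM ev[OF ideal_mem[OF M(1) pM]])
    then show False using M(3) nz by simp
  qed
  then show ?thesis using that by blast
qed

section \<open>Forms, homogenisation and the projective Nullstellensatz\<close>

abbreviation form :: "'i set \<Rightarrow> nat \<Rightarrow> (('i \<Rightarrow> complex) \<Rightarrow> complex) \<Rightarrow> bool" where
  "form I \<equiv> galg (coord I) 1"

lemma form_homogeneous: "form I d p \<Longrightarrow> p (\<lambda>k. c * x k) = c ^ d * p x"
  by (erule galg_homogeneous) (auto simp: coord_def)

lemma form_var: "i \<in> I \<Longrightarrow> form I (Suc 0) (\<lambda>x. x i)"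
  using galg_coord[of i I 1] by simp

text \<open>The ideal generated by \<open>G\<close>, with coefficients confined to \<open>H\<close> in order to keep track of degrees.\<close>

inductive gid :: "('p \<Rightarrow> complex) set \<Rightarrow> (('p \<Rightarrow> complex) \<Rightarrow> bool) \<Rightarrow> ('p \<Rightarrow> complex) \<Rightarrow> bool"
  for G H where
  zero: "gid G H (\<lambda>x. 0)"
| add: "gid G H a \<Longrightarrow> gid G H b \<Longrightarrow> gid G H (\<lambda>x. a x + b x)"
| mult: "g \<in> G \<Longrightarrow> H h \<Longrightarrow> gid G H (\<lambda>x. g x * h x)"

lemma gid_times:
  assumes "gid G H a" and "\<And>h. H h \<Longrightarrow> H' (\<lambda>x. r x * h x)"
  shows "gid G H' (\<lambda>x. r x * a x)"
  using assms(1)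
proof (induction rule: gid.induct)
  case zero
  show ?case by (simp add: gid.zero)
next
  case (add a b)
  from gid.add[OF add.IH] show ?case by (simp add: algebra_simps)
next
  case (mult g h)
  from gid.mult[where H=H', OF mult(1) assms(2)[OF mult(2)]] show ?case by (simp add: algebra_simps)
qed

lemma polynomial_homogenize:
  assumes i: "i \<in> I" and p: "galg (coord I) m d p"
  shows "\<exists>e0. \<forall>e\<ge>e0. \<exists>P. form I e P \<and> (\<forall>x. x i \<noteq> 0 \<longrightarrow> x i ^ e * p (\<lambda>k. x k / x i) = P x)"
proof -
  obtain N c where c: "\<forall>d. form I d (c d)" "\<forall>x. p x = (\<Sum>d<N. c d x)"
    using galg_graded_decomp[OF p, of 1] by (elim exE conjE)
  show ?thesis
  proof (rule exI[of _ N], intro allI impI)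
    fix e assume e: "N \<le> e"
    show "\<exists>P. form I e P \<and> (\<forall>x. x i \<noteq> 0 \<longrightarrow> x i ^ e * p (\<lambda>k. x k / x i) = P x)"
    proof (rule exI[of _ "\<lambda>x. \<Sum>d<N. c d x * x i ^ (e - d)"], intro conjI allI impI)
      show "form I e (\<lambda>x. \<Sum>d<N. c d x * x i ^ (e - d))"
      proof (rule galg_sum)
        fix d assume "d \<in> {..<N}"
        then have "d + 1 * (e - d) = e" using e by simp
        with galg_mult[OF c(1)[rule_format, of d] galg_power[OF galg_coord[OF i, of 1], of "e - d"]]
        show "form I e (\<lambda>x. c d x * x i ^ (e - d))" by (simp only:)
      qed
      fix x :: "'a \<Rightarrow> complex" assume x: "x i \<noteq> 0"
      have "x i ^ e * c d (\<lambda>k. x k / x i) = c d x * x i ^ (e - d)" if "d < N" for d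
      proof -
        have "(\<lambda>k. x k / x i) = (\<lambda>k. inverse (x i) * x k)" by (simp add: divide_inverse mult.commute)
        then have "c d (\<lambda>k. x k / x i) = inverse (x i) ^ d * c d x"
          by (simp only: form_homogeneous[OF c(1)[rule_format]])
        moreover have "x i ^ e = x i ^ (e - d) * x i ^ d" using that e by (simp add: power_add[symmetric])
        ultimately show ?thesis using x by (simp add: power_inverse)
      qed
      then show "x i ^ e * p (\<lambda>k. x k / x i) = (\<Sum>d<N. c d x * x i ^ (e - d))"
        unfolding c(2)[rule_format] sum_distrib_left by (intro sum.cong refl) simp
    qed
  qed
qed

text \<open>All cofactors receive the common degree \<open>e\<close>, and the generators contribute
  the remaining \<open>m\<close> by their own homogeneity. The cofactor degree recorded in
  \<open>gid G (form I e)\<close> is what lets degrees drop in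
  \<open>forms_finitely_generated\<close>.\<close>

lemma ideal_homogenize:
  assumes i: "i \<in> I" and G: "\<And>g. g \<in> G \<Longrightarrow> form I m g"
    and "gid G (galg (coord I) 0 0) u"
  shows "\<exists>e0. \<forall>e\<ge>e0. \<exists>U. gid G (form I e) U \<and>
    (\<forall>x. x i \<noteq> 0 \<longrightarrow> x i ^ (e + m) * u (\<lambda>k. x k / x i) = U x)"
  using assms(3)
proof (induction rule: gid.induct)
  case zero
  show ?case
  proof (rule exI[of _ 0], intro allI impI)
    fix e :: nat
    show "\<exists>U. gid G (form I e) U \<and> (\<forall>x. x i \<noteq> 0 \<longrightarrow> x i ^ (e + m) * 0 = U x)"
      by (intro exI[of _ "\<lambda>x. 0"]) (simp add: gid.zero)
  qed
next
  case (add a b)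
  obtain e1 where e1: "\<forall>e\<ge>e1. \<exists>P. gid G (form I e) P \<and> (\<forall>x. x i \<noteq> 0 \<longrightarrow> x i ^ (e + m) * a (\<lambda>k. x k / x i) = P x)"
    using add.IH(1) by (rule exE)
  obtain e2 where e2: "\<forall>e\<ge>e2. \<exists>P. gid G (form I e) P \<and> (\<forall>x. x i \<noteq> 0 \<longrightarrow> x i ^ (e + m) * b (\<lambda>k. x k / x i) = P x)"
    using add.IH(2) by (rule exE)
  show ?case
  proof (rule exI[of _ "max e1 e2"], intro allI impI)
    fix e assume "max e1 e2 \<le> e"
    then have e: "e1 \<le> e" "e2 \<le> e" by auto
    from e1[rule_format, OF e(1)] obtain P where P: "gid G (form I e) P"
      "\<forall>x. x i \<noteq> 0 \<longrightarrow> x i ^ (e + m) * a (\<lambda>k. x k / x i) = P x" by (elim exE conjE)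
    from e2[rule_format, OF e(2)] obtain Q where Q: "gid G (form I e) Q"
      "\<forall>x. x i \<noteq> 0 \<longrightarrow> x i ^ (e + m) * b (\<lambda>k. x k / x i) = Q x" by (elim exE conjE)
    show "\<exists>P. gid G (form I e) P \<and> (\<forall>x. x i \<noteq> 0 \<longrightarrow> x i ^ (e + m) * (a (\<lambda>k. x k / x i) + b (\<lambda>k. x k / x i)) = P x)"
      using P(2) Q(2) by (intro exI[of _ "\<lambda>x. P x + Q x"] conjI gid.add P(1) Q(1))
        (simp add: distrib_left)
  qed
next
  case (mult g h)
  obtain e0 where e0: "\<forall>e\<ge>e0. \<exists>P. form I e P \<and> (\<forall>x. x i \<noteq> 0 \<longrightarrow> x i ^ e * h (\<lambda>k. x k / x i) = P x)"
    using polynomial_homogenize[OF i mult(2)] by (rule exE)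
  show ?case
  proof (rule exI[of _ e0], intro allI impI)
    fix e assume "e0 \<le> e"
    from e0[rule_format, OF this] obtain P where P: "form I e P"
      "\<forall>x. x i \<noteq> 0 \<longrightarrow> x i ^ e * h (\<lambda>k. x k / x i) = P x" by (elim exE conjE)
    have eq: "x i ^ (e + m) * (g (\<lambda>k. x k / x i) * h (\<lambda>k. x k / x i)) = g x * P x" if "x i \<noteq> 0" for x
    proof -
      have "(\<lambda>k. x i * (x k / x i)) = x" using that by (simp add: fun_eq_iff)
      then have "x i ^ m * g (\<lambda>k. x k / x i) = g x"
        using form_homogeneous[OF G[OF mult(1)], of "x i" "\<lambda>k. x k / x i"] by simp
      moreover have "x i ^ e * h (\<lambda>k. x k / x i) = P x" using P(2) that by simp
      ultimately show ?thesis by (metis (no_types, lifting) mult.assoc mult.left_commute power_add)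
    qed
    show "\<exists>U. gid G (form I e) U \<and> (\<forall>x. x i \<noteq> 0 \<longrightarrow>
        x i ^ (e + m) * (g (\<lambda>k. x k / x i) * h (\<lambda>k. x k / x i)) = U x)"
      by (intro exI[of _ "\<lambda>x. g x * P x"] conjI allI impI eq gid.mult mult(1) P(1))
  qed
qed

text \<open>The affine system given by \<open>G\<close> and \<open>x i = 1\<close> has no solution,
  so 1 is the sum of an element of the ideal of \<open>G\<close> and a multiple of
  \<open>x i - 1\<close>. Substituting \<open>x k / x i\<close> for \<open>x k\<close> kills the
  second summand, and homogenising the first yields a power of \<open>x i\<close>.\<close>

lemma projective_nullstellensatz:
  assumes I: "finite I" "i \<in> I" and G: "\<And>g. g \<in> G \<Longrightarrow> form I m g"
    and noz: "\<And>x. (\<And>g. g \<in> G \<Longrightarrow> g x = 0) \<Longrightarrow> x i = 0"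
  shows "\<exists>N. gid G (form I N) (\<lambda>x. x i ^ (N + m))"
proof -
  let ?R = "galg (coord I) 0 0"
  note mul = galg_mult[where d=0 and e=0, simplified]
  define J where "J = {p. \<exists>u q. gid G ?R u \<and> ?R q \<and> p = (\<lambda>x. u x + (x i - 1) * q x)}"
  have JI: "(\<lambda>x. u x + (x i - 1) * q x) \<in> J" if "gid G ?R u" "?R q" for u q
    unfolding J_def by (intro CollectI exI[of _ u] exI[of _ q] conjI refl that)
  have gidR: "?R u" if "gid G ?R u" for u
    using that by (induction rule: gid.induct) (auto intro: galg.zero galg.add mul galg_ungraded[OF G])
  have lin: "?R (\<lambda>x. x i - 1)" by (intro galg_diff galg.const galg_coord I)
  have idJ: "ideal_of ?R J" unfolding ideal_of_def
  proof (intro conjI ballI allI impI)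
    show "(\<lambda>x. 0) \<in> J" using JI[OF gid.zero galg.zero] by simp
  next
    fix a assume "a \<in> J"
    then obtain u q where a: "gid G ?R u" "?R q" "a = (\<lambda>x. u x + (x i - 1) * q x)"
      unfolding J_def by (elim CollectE exE conjE)
    show "?R a" unfolding a(3) by (intro galg.add mul lin a(2) gidR a(1))
    show "(\<lambda>x. r x * a x) \<in> J" if "?R r" for r
    proof -
      have "(\<lambda>x. r x * a x) = (\<lambda>x. r x * u x + (x i - 1) * (r x * q x))"
        by (simp add: a(3) fun_eq_iff algebra_simps)
      also have "\<dots> \<in> J"
      proof (rule JI[OF _ mul[OF that a(2)]])
        show "gid G ?R (\<lambda>x. r x * u x)" by (rule gid_times[OF a(1)]) (rule mul[OF that])
      qed
      finally show ?thesis .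
    qed
    show "(\<lambda>x. a x + b x) \<in> J" if "b \<in> J" for b
    proof -
      from that obtain v q' where b: "gid G ?R v" "?R q'" "b = (\<lambda>x. v x + (x i - 1) * q' x)"
        unfolding J_def by (elim CollectE exE conjE)
      have "(\<lambda>x. a x + b x) = (\<lambda>x. (u x + v x) + (x i - 1) * (q x + q' x))"
        by (simp add: a(3) b(3) fun_eq_iff algebra_simps)
      also have "\<dots> \<in> J"
        by (rule JI[OF gid.add[OF a(1) b(1)] galg.add[OF a(2) b(2)]])
      finally show ?thesis .
    qed
  qed
  have "(\<lambda>x. 1) \<in> J"
  proof (rule ccontr)
    assume "(\<lambda>x. 1) \<notin> J"
    then obtain z where z: "\<And>p. p \<in> J \<Longrightarrow> p z = 0"
      using weak_nullstellensatz[OF I(1) idJ] by metis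
    have "g z = 0" if "g \<in> G" for g
      using z[OF JI[OF gid.mult[where H="?R", OF that galg.const[where c=1]] galg.zero]] by simp
    then have "z i = 0" by (rule noz)
    moreover have "z i - 1 = 0" using z[OF JI[OF gid.zero galg.const[where c=1]]] by simp
    ultimately show False by simp
  qed
  then obtain u q where u: "gid G ?R u" "?R q" "(\<lambda>x. 1) = (\<lambda>x. u x + (x i - 1) * q x)"
    unfolding J_def by (elim CollectE exE conjE)
  obtain e where "\<forall>e'\<ge>e. \<exists>U. gid G (form I e') U \<and>
    (\<forall>x. x i \<noteq> 0 \<longrightarrow> x i ^ (e' + m) * u (\<lambda>k. x k / x i) = U x)"
    using ideal_homogenize[OF I(2) G u(1)] by (rule exE)
  from this[rule_format, OF order_refl] obtain U where U: "gid G (form I e) U"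
    "\<forall>x. x i \<noteq> 0 \<longrightarrow> x i ^ (e + m) * u (\<lambda>k. x k / x i) = U x" by (elim exE conjE)
  \<comment> \<open>The homogenised identity is known only for \<open>x i \<noteq> 0\<close>; one
    more factor \<open>x i\<close> makes both sides vanish on the remaining locus, whence
    \<open>Suc e\<close>.\<close>
  have "(\<lambda>x. x i * U x) = (\<lambda>x. x i ^ (Suc e + m))"
  proof
    fix x :: "'a \<Rightarrow> complex"
    show "x i * U x = x i ^ (Suc e + m)"
    proof (cases "x i = 0")
      case False
      have "u (\<lambda>k. x k / x i) = 1" using fun_cong[OF u(3), of "\<lambda>k. x k / x i"] False by simp
      then show ?thesis using U(2) False by force
    qed simp
  qed
  moreover have "gid G (form I (Suc e)) (\<lambda>x. x i * U x)"
    by (rule gid_times[OF U(1)]) (use galg_mult[OF form_var[OF I(2)]] in fastforce)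
  ultimately show ?thesis by (intro exI[of _ "Suc e"]) simp
qed

section \<open>Integrality over algebras without common zeros\<close>

definition mon :: "'i set \<Rightarrow> ('i \<Rightarrow> nat) \<Rightarrow> ('i \<Rightarrow> complex) \<Rightarrow> complex" where
  "mon I \<alpha> x = (\<Prod>i\<in>I. x i ^ \<alpha> i)"

lemma mon_upd:
  assumes "finite I" "k \<in> I"
  shows "mon I (\<alpha>(k := n)) x = x k ^ n * (\<Prod>i\<in>I - {k}. x i ^ \<alpha> i)"
    and "(\<Sum>i\<in>I. (\<alpha>(k := n)) i) = n + (\<Sum>i\<in>I - {k}. \<alpha> i)"
proof -
  have "(\<Prod>i\<in>I - {k}. x i ^ (\<alpha>(k := n)) i) = (\<Prod>i\<in>I - {k}. x i ^ \<alpha> i)"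
    by (rule prod.cong) auto
  then show "mon I (\<alpha>(k := n)) x = x k ^ n * (\<Prod>i\<in>I - {k}. x i ^ \<alpha> i)"
    by (simp add: mon_def prod.remove[OF assms])
  have "(\<Sum>i\<in>I - {k}. (\<alpha>(k := n)) i) = (\<Sum>i\<in>I - {k}. \<alpha> i)"
    by (rule sum.cong) auto
  then show "(\<Sum>i\<in>I. (\<alpha>(k := n)) i) = n + (\<Sum>i\<in>I - {k}. \<alpha> i)"
    by (simp add: sum.remove[OF assms])
qed

lemma mon_split:
  assumes "finite I" "k \<in> I" "n \<le> \<alpha> k"
  shows "mon I \<alpha> x = x k ^ n * mon I (\<alpha>(k := \<alpha> k - n)) x"
    and "(\<Sum>i\<in>I. \<alpha> i) = n + (\<Sum>i\<in>I. (\<alpha>(k := \<alpha> k - n)) i)"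
  using mon_upd[OF assms(1,2), of \<alpha> "\<alpha> k"] mon_upd[OF assms(1,2), of \<alpha> "\<alpha> k - n"] assms(3)
  by (simp_all add: mult.assoc[symmetric] power_add[symmetric])

lemma form_mon:
  "form I (\<Sum>i\<in>I. \<alpha> i) (mon I \<alpha>)"
proof -
  have "form I (\<alpha> i) (\<lambda>x. x i ^ \<alpha> i)" if "i \<in> I" for i
    using galg_power[OF form_var[OF that], of "\<alpha> i"] by simp
  then show ?thesis using galg_prod[of I "coord I" 1 \<alpha> "\<lambda>i x. x i ^ \<alpha> i"] by (simp add: mon_def[abs_def])
qed

text \<open>A form arises by multiplying single coordinates onto smaller forms, whereas arguments
  about exponents need whole monomials. Proving the claim for \<open>mon I \<alpha> x * p x\<close>
  with \<open>\<alpha>\<close> arbitrary lets each coordinate be absorbed into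
  \<open>\<alpha>\<close>, so that only multiples of monomials are left at the leaves.\<close>

lemma form_induct [consumes 2, case_names zero add mon]:
  assumes "finite I" and "form I d p"
    and "\<And>d. P d (\<lambda>x. 0)" and "\<And>d a b. P d a \<Longrightarrow> P d b \<Longrightarrow> P d (\<lambda>x. a x + b x)"
    and "\<And>\<alpha> c. P (\<Sum>i\<in>I. \<alpha> i) (\<lambda>x. c * mon I \<alpha> x)"
  shows "P d p"
proof -
  have "\<forall>\<alpha>. P (d + (\<Sum>i\<in>I. \<alpha> i)) (\<lambda>x. mon I \<alpha> x * p x)"
    using assms(2)
  proof (induction rule: galg.induct)
    case (const c)
    show ?case using assms(5)[of _ c] by (simp add: mult.commute)
  next
    case (zero d)
    show ?case using assms(3) by simp
  next
    case (gen g d b)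
    then obtain k where k: "k \<in> I" "g = (\<lambda>x. x k)" by (auto simp: coord_def)
    show ?case
    proof
      fix \<alpha>
      let ?\<beta> = "\<alpha>(k := Suc (\<alpha> k))"
      have b: "?\<beta>(k := ?\<beta> k - 1) = \<alpha>" by simp
      have "mon I ?\<beta> = (\<lambda>x. x k * mon I \<alpha> x)" "(\<Sum>i\<in>I. ?\<beta> i) = 1 + (\<Sum>i\<in>I. \<alpha> i)"
        using mon_split[OF assms(1) k(1), of 1 ?\<beta>] unfolding b by auto
      then show "P (d + 1 + (\<Sum>i\<in>I. \<alpha> i)) (\<lambda>x. mon I \<alpha> x * (g x * b x))"
        using gen.IH[rule_format, of ?\<beta>] by (simp add: k(2) mult_ac)
    qed
  next
    case (add d a b)
    then show ?case using assms(4) by (simp add: distrib_left)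
  qed
  from this[rule_format, of "\<lambda>_. 0"] show ?thesis by (simp add: mon_def)
qed

section \<open>Modules over the subalgebra generated by \<open>G\<close>, and the determinant
  trick\<close>

definition fg_span :: "('p \<Rightarrow> complex) set \<Rightarrow> 'a set \<Rightarrow> ('a \<Rightarrow> 'p \<Rightarrow> complex) \<Rightarrow> ('p \<Rightarrow> complex) \<Rightarrow> bool" where
  "fg_span G A e p \<longleftrightarrow> (\<exists>b. (\<forall>\<alpha>. galg G 0 0 (b \<alpha>)) \<and> (\<forall>x. p x = (\<Sum>\<alpha>\<in>A. b \<alpha> x * e \<alpha> x)))"

lemma fg_span_zero: "fg_span G A e (\<lambda>x. 0)"
  unfolding fg_span_def by (intro exI[of _ "\<lambda>_ _. 0"]) (simp add: galg.zero)

lemma fg_span_add: 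
  assumes "fg_span G A e p" "fg_span G A e q" shows "fg_span G A e (\<lambda>x. p x + q x)"
proof -
  from assms(1) obtain b where b: "\<forall>\<alpha>. galg G 0 0 (b \<alpha>)" "\<forall>x. p x = (\<Sum>\<alpha>\<in>A. b \<alpha> x * e \<alpha> x)"
    unfolding fg_span_def by (elim exE conjE)
  from assms(2) obtain c where c: "\<forall>\<alpha>. galg G 0 0 (c \<alpha>)" "\<forall>x. q x = (\<Sum>\<alpha>\<in>A. c \<alpha> x * e \<alpha> x)"
    unfolding fg_span_def by (elim exE conjE)
  show ?thesis unfolding fg_span_def
    using b(2) c(2) by (intro exI[of _ "\<lambda>\<alpha> x. b \<alpha> x + c \<alpha> x"] conjI allI galg.add b(1)[rule_format] c(1)[rule_format])
      (simp add: distrib_right sum.distrib)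
qed

lemma fg_span_mult: 
  assumes "fg_span G A e p" "galg G 0 0 q" shows "fg_span G A e (\<lambda>x. q x * p x)"
proof -
  from assms(1) obtain b where b: "\<forall>\<alpha>. galg G 0 0 (b \<alpha>)" "\<forall>x. p x = (\<Sum>\<alpha>\<in>A. b \<alpha> x * e \<alpha> x)"
    unfolding fg_span_def by (elim exE conjE)
  show ?thesis unfolding fg_span_def
    using b(2) by (intro exI[of _ "\<lambda>\<alpha> x. q x * b \<alpha> x"] conjI allI
        galg_mult[where d=0 and e=0, simplified] b(1)[rule_format] assms(2))
      (simp add: sum_distrib_left mult_ac)
qed

lemma fg_span_base:
  assumes "finite A" "\<alpha> \<in> A" shows "fg_span G A e (e \<alpha>)"
  unfolding fg_span_def
proof (intro exI[of _ "\<lambda>\<beta> x. if \<beta> = \<alpha> then 1 else 0"] conjI allI)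
  show "galg G 0 0 (\<lambda>x. if \<beta> = \<alpha> then 1 else 0)" for \<beta> by (rule galg.const)
  show "e \<alpha> x = (\<Sum>\<beta>\<in>A. (if \<beta> = \<alpha> then 1 else 0) * e \<beta> x)" for x
    using assms by (simp add: if_distrib[of "\<lambda>t. t * _"] cong: if_cong)
qed

text \<open>A power \<open>x i ^ (N i + m)\<close> is a combination of elements of \<open>G\<close>
  with cofactors of degree \<open>N i\<close>. A monomial divisible by it is therefore a combination
  of forms of degree smaller by \<open>m\<close>, and induction on the degree ends in the finite box
  of exponents below \<open>N i + m\<close>. The zero exponent is recorded because the monomial 1
  keeps the vector of generators from vanishing anywhere.\<close>

lemma forms_finitely_generated:
  assumes I: "finite I" and m: "m > 0" and G: "\<And>g. g \<in> G \<Longrightarrow> form I m g"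
    and noz: "\<And>x i. (\<And>g. g \<in> G \<Longrightarrow> g x = 0) \<Longrightarrow> i \<in> I \<Longrightarrow> x i = 0"
  obtains A where "finite A" "(\<lambda>i\<in>I. 0) \<in> A" "\<And>d p. form I d p \<Longrightarrow> fg_span G A (mon I) p"
proof -
  have "\<forall>i. \<exists>N. i \<in> I \<longrightarrow> gid G (form I N) (\<lambda>x. x i ^ (N + m))"
  proof
    fix i
    have "\<exists>N. gid G (form I N) (\<lambda>x. x i ^ (N + m))" if "i \<in> I"
    proof (rule projective_nullstellensatz[OF I that])
      show "form I m g" if "g \<in> G" for g by (rule G[OF that])
      show "x i = 0" if "\<And>g. g \<in> G \<Longrightarrow> g x = 0" for x using noz[OF that \<open>i \<in> I\<close>] .
    qed
    then show "\<exists>N. i \<in> I \<longrightarrow> gid G (form I N) (\<lambda>x. x i ^ (N + m))" by simp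
  qed
  from choice[OF this] obtain N where N: "\<forall>i. i \<in> I \<longrightarrow> gid G (form I (N i)) (\<lambda>x. x i ^ (N i + m))"
    by (rule exE)
  define A where "A = (\<Pi>\<^sub>E i\<in>I. {..<N i + m})"
  have finA: "finite A" unfolding A_def using I by (intro finite_PiE) auto
  have "fg_span G A (mon I) p" if "form I d p" for d p
    using that
  proof (induction d arbitrary: p rule: less_induct)
    case (less d)
    \<comment> \<open>The rule \<open>form_induct\<close> varies the degree together with the form,
      so the degree of the outer induction is tied to it by an implication.\<close>
    have "d' = d \<longrightarrow> fg_span G A (mon I) p" if "form I d' p" for d' p
      using I that
    proof (induction rule: form_induct)
      case (zero d')
      show ?case by (simp add: fg_span_zero)
    next
      case (add d' a b)
      then show ?case using fg_span_add by blast
    next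
      case (mon \<alpha> c)
      show ?case
      proof
        assume d: "(\<Sum>i\<in>I. \<alpha> i) = d"
        have "fg_span G A (mon I) (mon I \<alpha>)"
        proof (cases "\<forall>i\<in>I. \<alpha> i < N i + m")
          case True
          have "mon I (restrict \<alpha> I) = mon I \<alpha>" unfolding mon_def by (intro ext prod.cong) auto
          moreover have "restrict \<alpha> I \<in> A" using True by (auto simp: A_def)
          ultimately show ?thesis using fg_span_base[OF finA, of "restrict \<alpha> I" G "mon I"] by simp
        next
          case False
          then obtain i where i: "i \<in> I" "N i + m \<le> \<alpha> i" by (auto simp: not_less)
          define \<beta> where "\<beta> = \<alpha>(i := \<alpha> i - (N i + m))"
          have \<alpha>: "mon I \<alpha> = (\<lambda>x. mon I \<beta> x * x i ^ (N i + m))" "d = N i + m + (\<Sum>i\<in>I. \<beta> i)"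
            using mon_split[OF I i(1), of "N i + m" \<alpha>] i(2) d by (auto simp: \<beta>_def mult.commute)
          have gm: "fg_span G A (mon I) (\<lambda>x. mon I \<beta> x * u x)" if "gid G (form I (N i)) u" for u
            using that
          proof (induction rule: gid.induct)
            case zero
            show ?case by (simp add: fg_span_zero)
          next
            case (add a b)
            from fg_span_add[OF add.IH] show ?case by (simp add: distrib_left)
          next
            case (mult g h)
            have "fg_span G A (mon I) (\<lambda>x. mon I \<beta> x * h x)"
              by (rule less.IH[OF _ galg_mult[OF form_mon mult(2)]]) (use \<alpha>(2) m in simp)
            from fg_span_mult[OF this galg_ungraded[OF galg_generator[OF mult(1), of 0]]]
            show ?case by (simp add: mult_ac)
          qed
          show ?thesis unfolding \<alpha>(1) by (rule gm) (use N i(1) in simp)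
        qed
        from fg_span_mult[OF this galg.const[where c=c]] show "fg_span G A (mon I) (\<lambda>x. c * mon I \<alpha> x)" .
      qed
    qed
    then show ?case using less.prems by blast
  qed
  moreover have "(\<lambda>i\<in>I. 0) \<in> A" using m by (auto simp: A_def)
  ultimately show ?thesis using that finA by blast
qed

lemma fg_span_sum:
  "finite S \<Longrightarrow> (\<And>i. i \<in> S \<Longrightarrow> fg_span G A e (f i)) \<Longrightarrow> fg_span G A e (\<lambda>x. \<Sum>i\<in>S. f i x)"
proof (induction S rule: finite_induct)
  case empty
  show ?case by (simp add: fg_span_zero)
next
  case (insert i S)
  have "fg_span G A e (\<lambda>x. f i x + (\<Sum>i\<in>S. f i x))"
    by (rule fg_span_add) (use insert in auto)
  then show ?case using insert by simp
qed

lemma fg_span_powers_mono: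
  assumes "fg_span G {..<n} (\<lambda>k x. Q x ^ k) f" "n \<le> n'"
  shows "fg_span G {..<n'} (\<lambda>k x. Q x ^ k) f"
proof -
  from assms(1) obtain b where b: "\<forall>k. galg G 0 0 (b k)" "\<forall>x. f x = (\<Sum>k<n. b k x * Q x ^ k)"
    unfolding fg_span_def by (elim exE conjE)
  show ?thesis unfolding fg_span_def
  proof (intro exI[of _ "\<lambda>k x. if k < n then b k x else 0"] conjI allI)
    show "galg G 0 0 (\<lambda>x. if k < n then b k x else 0)" for k
      using b(1) by (cases "k < n") (simp_all add: galg.zero)
    have "(\<Sum>k<n'. (if k < n then b k x else 0) * Q x ^ k) = (\<Sum>k<n. b k x * Q x ^ k)" for x
      using assms(2) by (intro sum.mono_neutral_cong_right) auto
    then show "f x = (\<Sum>k<n'. (if k < n then b k x else 0) * Q x ^ k)" for x using b(2) by simp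
  qed
qed

lemma fg_span_powers_shift:
  assumes "fg_span G {..<n} (\<lambda>k x. Q x ^ k) f"
  shows "fg_span G {..<Suc n} (\<lambda>k x. Q x ^ k) (\<lambda>x. Q x * f x)"
proof -
  from assms(1) obtain b where b: "\<forall>k. galg G 0 0 (b k)" "\<forall>x. f x = (\<Sum>k<n. b k x * Q x ^ k)"
    unfolding fg_span_def by (elim exE conjE)
  show ?thesis unfolding fg_span_def
  proof (intro exI[of _ "\<lambda>k x. case k of 0 \<Rightarrow> 0 | Suc k \<Rightarrow> b k x"] conjI allI)
    show "galg G 0 0 (\<lambda>x. case k of 0 \<Rightarrow> 0 | Suc k \<Rightarrow> b k x)" for k
      using b(1) by (cases k) (simp_all add: galg.zero)
    show "Q x * f x = (\<Sum>k<Suc n. (case k of 0 \<Rightarrow> 0 | Suc k \<Rightarrow> b k x) * Q x ^ k)" for x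
      unfolding sum.lessThan_Suc_shift using b(2) by (simp add: sum_distrib_left mult_ac)
  qed
qed

text \<open>Meant for one term of the Leibniz expansion of a characteristic polynomial:
  \<open>\<delta> i\<close> marks the factors taken from the diagonal. The power
  \<open>card T\<close> of \<open>Q\<close> arises only if every factor is marked; everything else
  is absorbed into \<open>f\<close>, a combination of lower powers.\<close>

lemma prod_expand_powers:
  assumes "finite T" and "\<And>i. i \<in> T \<Longrightarrow> galg G 0 0 (a i)"
  shows "\<exists>f. fg_span G {..<card T} (\<lambda>k x. Q x ^ k) f \<and>
    (\<forall>x. (\<Prod>i\<in>T. a i x - (if \<delta> i then Q x else 0)) =
      (if \<forall>i\<in>T. \<delta> i then (-1) ^ card T * Q x ^ card T else 0) + f x)"
  using assms
proof (induction T rule: finite_induct)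
  case empty
  show ?case by (intro exI[of _ "\<lambda>x. 0"]) (simp add: fg_span_zero)
next
  case (insert i T)
  define n where "n = card T"
  define c :: complex where "c = (if \<forall>i\<in>T. \<delta> i then (-1) ^ n else 0)"
  have "\<exists>f. fg_span G {..<card T} (\<lambda>k x. Q x ^ k) f \<and>
    (\<forall>x. (\<Prod>i\<in>T. a i x - (if \<delta> i then Q x else 0)) =
      (if \<forall>i\<in>T. \<delta> i then (-1) ^ card T * Q x ^ card T else 0) + f x)"
    by (rule insert.IH) (use insert.prems in simp)
  then obtain f where f: "fg_span G {..<n} (\<lambda>k x. Q x ^ k) f"
    "\<forall>x. (\<Prod>i\<in>T. a i x - (if \<delta> i then Q x else 0)) = c * Q x ^ n + f x"
    unfolding n_def c_def by (elim exE conjE) (simp add: if_distrib[of "\<lambda>t. t * _"] cong: if_cong)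
  define d :: complex where "d = (if \<delta> i then 1 else 0)"
  have ai: "galg G 0 0 (a i)" using insert.prems by simp
  define f' where "f' = (\<lambda>x. a i x * (c * Q x ^ n + f x) + (- d) * (Q x * f x))"
  have "fg_span G {..<Suc n} (\<lambda>k x. Q x ^ k) (\<lambda>x. c * Q x ^ n)"
    using fg_span_mult[OF fg_span_base[of "{..<Suc n}" n G "\<lambda>k x. Q x ^ k"] galg.const[where c=c]] by simp
  from fg_span_add[OF fg_span_mult[OF fg_span_add[OF this fg_span_powers_mono[OF f(1), of "Suc n"]] ai]
      fg_span_mult[OF fg_span_powers_shift[OF f(1)] galg.const[where c="- d"]]]
  have f': "fg_span G {..<Suc n} (\<lambda>k x. Q x ^ k) f'" by (simp add: f'_def)
  have prod: "(\<Prod>i\<in>insert i T. a i x - (if \<delta> i then Q x else 0)) =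
      (if \<forall>i\<in>insert i T. \<delta> i then (-1) ^ Suc n * Q x ^ Suc n else 0) + f' x" for x
  proof -
    have "(\<Prod>i\<in>insert i T. a i x - (if \<delta> i then Q x else 0)) = (a i x - d * Q x) * (c * Q x ^ n + f x)"
      using insert.hyps f(2) by (simp add: d_def)
    also have "\<dots> = - (d * c * Q x ^ Suc n) + f' x"
      by (simp add: f'_def algebra_simps)
    also have "- (d * c * Q x ^ Suc n) = (if \<forall>i\<in>insert i T. \<delta> i then (-1) ^ Suc n * Q x ^ Suc n else 0)"
      by (simp add: d_def c_def)
    finally show ?thesis .
  qed
  have card: "card (insert i T) = Suc n" using insert.hyps by (simp add: n_def)
  show ?case unfolding card by (intro exI[of _ f'] conjI allI f' prod)
qed

text \<open>The determinant trick: multiplication by \<open>Q\<close> on a finite set of module generators is a matrix over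
  the subalgebra, and \<open>Q\<close> is a root of its characteristic polynomial.\<close>

lemma integral_ungraded:
  assumes A: "finite A" "\<alpha>0 \<in> A" "\<And>x. e \<alpha>0 x = 1"
    and Q: "\<And>\<alpha>. \<alpha> \<in> A \<Longrightarrow> fg_span G A e (\<lambda>x. Q x * e \<alpha> x)"
  shows "\<exists>s. fg_span G {..<s} (\<lambda>k x. Q x ^ k) (\<lambda>x. Q x ^ s)"
proof -
  define s where "s = card A"
  obtain \<epsilon> where \<epsilon>: "bij_betw \<epsilon> {0..<s} A" using ex_bij_betw_nat_finite[OF A(1)] by (auto simp: s_def)
  have "\<forall>i. \<exists>c. i < s \<longrightarrow> (\<forall>\<alpha>. galg G 0 0 (c \<alpha>)) \<and> (\<forall>x. Q x * e (\<epsilon> i) x = (\<Sum>\<alpha>\<in>A. c \<alpha> x * e \<alpha> x))"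
  proof
    fix i
    show "\<exists>c. i < s \<longrightarrow> (\<forall>\<alpha>. galg G 0 0 (c \<alpha>)) \<and> (\<forall>x. Q x * e (\<epsilon> i) x = (\<Sum>\<alpha>\<in>A. c \<alpha> x * e \<alpha> x))"
    proof (cases "i < s")
      case True
      then have "\<epsilon> i \<in> A" using \<epsilon> by (auto simp: bij_betw_def)
      from Q[OF this] show ?thesis using True by (simp add: fg_span_def)
    qed simp
  qed
  from choice[OF this] obtain c where
    c: "\<forall>i. i < s \<longrightarrow> (\<forall>\<alpha>. galg G 0 0 (c i \<alpha>)) \<and> (\<forall>x. Q x * e (\<epsilon> i) x = (\<Sum>\<alpha>\<in>A. c i \<alpha> x * e \<alpha> x))"
    by (rule exE)
  have det0: "(\<Sum>p | p permutes {0..<s}. signof p *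
    (\<Prod>i\<in>{0..<s}. c i (\<epsilon> (p i)) x - (if i = p i then Q x else 0))) = 0" for x
  proof -
    define B where "B = Matrix.mat s s (\<lambda>(i, j). c i (\<epsilon> j) x)"
    define v where "v = Matrix.vec s (\<lambda>j. e (\<epsilon> j) x)"
    have B: "B \<in> carrier_mat s s" by (simp add: B_def)
    \<comment> \<open>At each point the values of the generators form an eigenvector with eigenvalue
      \<open>Q x\<close>; it is nonzero because the generator \<open>e \<alpha>0\<close> has the
      value 1.\<close>
    have "eigenvector B v (Q x)" unfolding eigenvector_def
    proof (intro conjI)
      show "v \<in> carrier_vec (dim_row B)" by (simp add: B_def v_def)
      obtain j where "j < s" "\<epsilon> j = \<alpha>0" using \<epsilon> A(2) by (auto simp: bij_betw_def)
      then have "vec_index v j = 1" using A(3) by (simp add: v_def)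
      then show "v \<noteq> 0\<^sub>v (dim_row B)" using \<open>j < s\<close> by (auto simp: B_def)
      show "B *\<^sub>v v = Q x \<cdot>\<^sub>v v"
      proof (rule eq_vecI)
        fix i assume "i < dim_vec (Q x \<cdot>\<^sub>v v)"
        then have i: "i < s" by (simp add: v_def)
        have "vec_index (B *\<^sub>v v) i = (\<Sum>j\<in>{0..<s}. c i (\<epsilon> j) x * e (\<epsilon> j) x)"
          using i by (simp add: B_def v_def scalar_prod_def)
        also have "\<dots> = (\<Sum>\<alpha>\<in>A. c i \<alpha> x * e \<alpha> x)" by (rule sum.reindex_bij_betw[OF \<epsilon>])
        also have "\<dots> = Q x * e (\<epsilon> i) x" using c i by simp
        finally show "vec_index (B *\<^sub>v v) i = vec_index (Q x \<cdot>\<^sub>v v) i" using i by (simp add: v_def)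
      qed (simp add: B_def v_def)
    qed
    then have "Determinant.det (char_matrix B (Q x)) = 0"
      using eigenvalue_det[OF B] by (auto simp: eigenvalue_def)
    moreover have "Determinant.det (char_matrix B (Q x)) = (\<Sum>p | p permutes {0..<s}. signof p *
      (\<Prod>i\<in>{0..<s}. c i (\<epsilon> (p i)) x - (if i = p i then Q x else 0)))"
      unfolding det_def'[OF char_matrix_closed[OF B]]
    proof (intro sum.cong refl arg_cong2[of _ _ _ _ "(*)"] prod.cong)
      fix p i assume "p \<in> {p. p permutes {0..<s}}" and i: "i \<in> {0..<s}"
      then have "p i < s" using permutes_in_image[of p "{0..<s}" i] by auto
      then show "char_matrix B (Q x) $$ (i, p i) = c i (\<epsilon> (p i)) x - (if i = p i then Q x else 0)"
        using i by (simp add: char_matrix_def B_def)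
    qed
    ultimately show ?thesis by simp
  qed
  have "\<forall>p. \<exists>f. fg_span G {..<s} (\<lambda>k x. Q x ^ k) f \<and>
    (\<forall>x. (\<Prod>i\<in>{0..<s}. c i (\<epsilon> (p i)) x - (if i = p i then Q x else 0)) =
      (if \<forall>i\<in>{0..<s}. i = p i then (-1) ^ s * Q x ^ s else 0) + f x)"
  proof
    fix p
    have "\<exists>f. fg_span G {..<card {0..<s}} (\<lambda>k x. Q x ^ k) f \<and>
      (\<forall>x. (\<Prod>i\<in>{0..<s}. c i (\<epsilon> (p i)) x - (if i = p i then Q x else 0)) =
      (if \<forall>i\<in>{0..<s}. i = p i then (-1) ^ card {0..<s} * Q x ^ card {0..<s} else 0) + f x)"
      by (rule prod_expand_powers) (use c in auto)
    then show "\<exists>f. fg_span G {..<s} (\<lambda>k x. Q x ^ k) f \<and>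
      (\<forall>x. (\<Prod>i\<in>{0..<s}. c i (\<epsilon> (p i)) x - (if i = p i then Q x else 0)) =
      (if \<forall>i\<in>{0..<s}. i = p i then (-1) ^ s * Q x ^ s else 0) + f x)"
      unfolding card_atLeastLessThan diff_zero .
  qed
  from choice[OF this] obtain f where f: "\<forall>p. fg_span G {..<s} (\<lambda>k x. Q x ^ k) (f p) \<and>
    (\<forall>x. (\<Prod>i\<in>{0..<s}. c i (\<epsilon> (p i)) x - (if i = p i then Q x else 0)) =
      (if \<forall>i\<in>{0..<s}. i = p i then (-1) ^ s * Q x ^ s else 0) + f p x)" by (rule exE)
  let ?P = "{p. p permutes {0..<s}}"
  have finP: "finite ?P" by (rule finite_permutations) simp
  define F where "F = (\<lambda>x. \<Sum>p\<in>?P. signof p * f p x)"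
  have F: "fg_span G {..<s} (\<lambda>k x. Q x ^ k) F" unfolding F_def
    by (intro fg_span_sum finP fg_span_mult[OF _ galg.const]) (use f in simp)
  have "(-1) ^ s * Q x ^ s + F x = 0" for x
  proof -
    \<comment> \<open>The identity alone takes every factor from the diagonal, so no other
      permutation contributes to the power \<open>s\<close> of \<open>Q\<close>.\<close>
    have id: "(\<forall>i\<in>{0..<s}. i = p i) \<longleftrightarrow> p = id" if "p permutes {0..<s}" for p
    proof
      assume *: "\<forall>i\<in>{0..<s}. i = p i"
      show "p = id"
      proof
        show "p i = id i" for i using * permutes_not_in[OF that, of i] by (cases "i \<in> {0..<s}") auto
      qed
    qed simp
    have "0 = (\<Sum>p\<in>?P. signof p * ((if \<forall>i\<in>{0..<s}. i = p i then (-1) ^ s * Q x ^ s else 0) + f p x))"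
      by (rule trans[OF det0[of x, symmetric]], intro sum.cong refl) (use f in \<open>simp only:\<close>)
    also have "\<dots> = (\<Sum>p\<in>?P. if p = id then (-1) ^ s * Q x ^ s else 0) + F x"
      unfolding F_def sum.distrib[symmetric]
      by (intro sum.cong refl) (simp add: id distrib_left)
    also have "(\<Sum>p\<in>?P. if p = id then (-1) ^ s * Q x ^ s else 0) = (-1) ^ s * Q x ^ s"
      using finP by (simp add: permutes_id)
    finally show ?thesis by simp
  qed
  then have "F x = - ((-1) ^ s * Q x ^ s)" for x by (simp add: eq_neg_iff_add_eq_0 add.commute)
  then have eq: "(-1) ^ Suc s * F x = Q x ^ s" for x by simp
  have "fg_span G {..<s} (\<lambda>k x. Q x ^ k) (\<lambda>x. (-1) ^ Suc s * F x)"
    by (rule fg_span_mult[OF F galg.const])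
  then show ?thesis unfolding eq by blast
qed

text \<open>Of each coefficient in an ungraded equation only the component that brings the total
  degree to \<open>r * s\<close> is kept. The resulting degree \<open>r * (s - k)\<close> is what
  later fixes the power of the determinant.\<close>

theorem form_integral:
  assumes I: "finite I" and m: "m > 0" and G: "\<And>g. g \<in> G \<Longrightarrow> form I m g"
    and noz: "\<And>x i. (\<And>g. g \<in> G \<Longrightarrow> g x = 0) \<Longrightarrow> i \<in> I \<Longrightarrow> x i = 0"
    and Q: "form I r Q"
  obtains s b where "\<And>k. k < s \<Longrightarrow> galg G m (r * (s - k)) (b k)"
    and "\<And>x. Q x ^ s = (\<Sum>k<s. b k x * Q x ^ k)"
proof -
  obtain A where A: "finite A" "(\<lambda>i\<in>I. 0) \<in> A" "\<And>d p. form I d p \<Longrightarrow> fg_span G A (mon I) p"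
  proof (rule forms_finitely_generated[OF I m])
    show "form I m g" if "g \<in> G" for g by (rule G[OF that])
    show "x i = 0" if "\<And>g. g \<in> G \<Longrightarrow> g x = 0" "i \<in> I" for x i using noz[OF that] .
  qed (rule that, assumption+)
  have "\<exists>s. fg_span G {..<s} (\<lambda>k x. Q x ^ k) (\<lambda>x. Q x ^ s)"
  proof (rule integral_ungraded[OF A(1,2)])
    show "mon I (\<lambda>i\<in>I. 0) x = 1" for x by (simp add: mon_def)
    show "fg_span G A (mon I) (\<lambda>x. Q x * mon I \<alpha> x)" for \<alpha>
      by (rule A(3)[OF galg_mult[OF Q form_mon]])
  qed
  then obtain s b where b: "\<forall>k. galg G 0 0 (b k)" "\<forall>x. Q x ^ s = (\<Sum>k<s. b k x * Q x ^ k)"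
    unfolding fg_span_def by (elim exE conjE)
  have "\<forall>k. \<exists>Nc. (\<forall>d. galg G m d (snd Nc d)) \<and> (\<forall>x. b k x = (\<Sum>d<fst Nc. snd Nc d x)) \<and>
    (\<forall>d\<ge>fst Nc. snd Nc d = (\<lambda>x. 0))"
  proof
    fix k
    obtain N c where "\<forall>d. galg G m d (c d)" "\<forall>x. b k x = (\<Sum>d<N. c d x)" "\<forall>d\<ge>N. c d = (\<lambda>x. 0)"
      using galg_graded_decomp[OF b(1)[rule_format, of k], of m] by (elim exE conjE)
    then show "\<exists>Nc. (\<forall>d. galg G m d (snd Nc d)) \<and> (\<forall>x. b k x = (\<Sum>d<fst Nc. snd Nc d x)) \<and>
      (\<forall>d\<ge>fst Nc. snd Nc d = (\<lambda>x. 0))" by (intro exI[of _ "(N, c)"]) simp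
  qed
  from choice[OF this] obtain Nc where Nc: "\<forall>k. (\<forall>d. galg G m d (snd (Nc k) d)) \<and>
    (\<forall>x. b k x = (\<Sum>d<fst (Nc k). snd (Nc k) d x)) \<and>
    (\<forall>d\<ge>fst (Nc k). snd (Nc k) d = (\<lambda>x. 0))" by (rule exE)
  define N where "N k = fst (Nc k)" for k
  define c where "c k = snd (Nc k)" for k
  have c: "galg G m d (c k d)" "b k x = (\<Sum>d<N k. c k d x)" "N k \<le> d \<Longrightarrow> c k d x = 0" for k d x
    using Nc by (simp_all add: N_def c_def)
  have chom: "c k d (\<lambda>i. t * x i) = t ^ d * c k d x" for k d x and t :: complex
    by (rule form_homogeneous[OF galg_trans[OF c(1) G]])
  have "Q x ^ s = (\<Sum>k<s. c k (r * (s - k)) x * Q x ^ k)" for x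
  proof -
    \<comment> \<open>Along the line through \<open>x\<close> the ungraded equation is an identity
      of polynomials in the scaling parameter \<open>t\<close>; the graded one compares coefficients
      of \<open>t ^ (r * s)\<close>.\<close>
    define p where "p = (\<Sum>k<s. \<Sum>d<N k. Polynomial.monom (c k d x * Q x ^ k) (d + r * k))"
    have "poly (Polynomial.monom (Q x ^ s) (r * s)) t = poly p t" for t
    proof -
      have Qt: "Q (\<lambda>i. t * x i) = t ^ r * Q x" by (rule form_homogeneous[OF Q])
      have "poly (Polynomial.monom (Q x ^ s) (r * s)) t = (t ^ r * Q x) ^ s"
        by (simp add: poly_monom power_mult power_mult_distrib)
      also have "\<dots> = Q (\<lambda>i. t * x i) ^ s" by (simp only: Qt)
      also have "\<dots> = (\<Sum>k<s. b k (\<lambda>i. t * x i) * Q (\<lambda>i. t * x i) ^ k)" by (rule b(2)[rule_format])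
      also have "\<dots> = (\<Sum>k<s. \<Sum>d<N k. t ^ d * c k d x * (t ^ r * Q x) ^ k)"
      proof (rule sum.cong[OF refl])
        fix k
        have "b k (\<lambda>i. t * x i) = (\<Sum>d<N k. t ^ d * c k d x)"
          by (rule trans[OF c(2)], rule sum.cong[OF refl], rule chom)
        then show "b k (\<lambda>i. t * x i) * Q (\<lambda>i. t * x i) ^ k = (\<Sum>d<N k. t ^ d * c k d x * (t ^ r * Q x) ^ k)"
          by (simp only: Qt sum_distrib_right)
      qed
      also have "\<dots> = poly p t"
        unfolding p_def poly_sum poly_monom
        by (intro sum.cong refl) (simp add: power_mult_distrib power_add power_mult[symmetric] mult_ac)
      finally show ?thesis .
    qed
    then have "Polynomial.monom (Q x ^ s) (r * s) = p"
      by (intro poly_eq_poly_eq_iff[THEN iffD1] ext)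
    then have "Q x ^ s = Polynomial.coeff p (r * s)" using Polynomial.coeff_monom[of "Q x ^ s" "r * s" "r * s"] by simp
    also have "\<dots> = (\<Sum>k<s. \<Sum>d<N k. if d = r * (s - k) then c k d x * Q x ^ k else 0)"
      unfolding p_def Polynomial.coeff_sum Polynomial.coeff_monom
    proof (intro sum.cong refl)
      fix k d assume "k \<in> {..<s}"
      then have "d + r * k = r * s \<longleftrightarrow> d = r * (s - k)"
        by (auto simp: diff_mult_distrib2)
      then show "(if d + r * k = r * s then c k d x * Q x ^ k else 0) =
        (if d = r * (s - k) then c k d x * Q x ^ k else 0)" by simp
    qed
    also have "\<dots> = (\<Sum>k<s. c k (r * (s - k)) x * Q x ^ k)"
    proof (intro sum.cong refl)
      fix k
      \<comment> \<open>If \<open>r * (s - k)\<close> is not below \<open>N k\<close>, no index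
        matches and the component itself is 0.\<close>
      show "(\<Sum>d<N k. if d = r * (s - k) then c k d x * Q x ^ k else 0) = c k (r * (s - k)) x * Q x ^ k"
        using c(3)[of k "r * (s - k)" x] by (cases "r * (s - k) < N k") simp_all
    qed
    finally show ?thesis .
  qed
  then show ?thesis using that[of s "\<lambda>k. c k (r * (s - k))"] c(1) by simp
qed

section \<open>Semi-invariants of matrices\<close>

lemma sum_root_of_unity_powers:
  fixes N n :: nat
  assumes "N > 0"
  defines "\<omega> \<equiv> exp (2 * of_real pi * \<i> / of_nat N) :: complex"
  shows "(\<Sum>j<N. \<omega> ^ (j * n)) = (if N dvd n then of_nat N else 0)"
proof -
  have w: "\<omega> ^ n = exp (2 * of_real pi * \<i> * of_nat n / of_nat N)" for n
    unfolding \<omega>_def exp_of_nat_mult[symmetric] by (simp add: mult_ac)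
  have 1: "\<omega> ^ n = 1 \<longleftrightarrow> N dvd n" for n
    unfolding w using complex_root_unity_eq_1[of N n] assms(1) by simp
  have sum: "(\<Sum>j<N. \<omega> ^ (j * n)) = (\<Sum>j<N. (\<omega> ^ n) ^ j)"
    by (simp add: power_mult[symmetric] mult.commute)
  show ?thesis
  proof (cases "N dvd n")
    case True
    then have "\<omega> ^ n = 1" using 1 by simp
    then show ?thesis unfolding sum using True by simp
  next
    case False
    then have "\<omega> ^ n \<noteq> 1" using 1 by simp
    then have "(\<Sum>j<N. (\<omega> ^ n) ^ j) = ((\<omega> ^ n) ^ N - 1) / (\<omega> ^ n - 1)" by (rule geometric_sum)
    also have "(\<omega> ^ n) ^ N = 1" using 1[of "n * N"] by (simp add: power_mult)
    finally show ?thesis unfolding sum using False by simp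
  qed
qed

text \<open>Discrete Fourier inversion. With \<open>N = m + 1\<close> nodes no two exponents up to
  \<open>m\<close> agree modulo \<open>N\<close>, and the weight \<open>N - k\<close> stands for
  \<open>-k\<close>.\<close>

lemma coefficient_extraction:
  fixes c :: "nat \<Rightarrow> complex" and m k :: nat
  defines "N \<equiv> Suc m"
  defines "\<omega> \<equiv> exp (2 * of_real pi * \<i> / of_nat N) :: complex"
  assumes k: "k \<le> m"
  shows "(\<Sum>j<N. \<omega> ^ (j * (N - k)) * (\<Sum>l\<le>m. c l * (\<omega> ^ j) ^ l)) = of_nat N * c k"
proof -
  have N: "N > 0" by (simp add: N_def)
  have "(\<Sum>j<N. \<omega> ^ (j * (N - k)) * (\<Sum>l\<le>m. c l * (\<omega> ^ j) ^ l)) =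
    (\<Sum>j<N. \<Sum>l\<le>m. c l * \<omega> ^ (j * (l + (N - k))))"
    unfolding sum_distrib_left
    by (intro sum.cong refl) (simp add: power_add power_mult[symmetric] distrib_left mult_ac)
  also have "\<dots> = (\<Sum>l\<le>m. c l * (\<Sum>j<N. \<omega> ^ (j * (l + (N - k)))))"
    unfolding sum_distrib_left by (rule sum.swap)
  also have "\<dots> = (\<Sum>l\<le>m. if l = k then of_nat N * c k else 0)"
  proof (rule sum.cong[OF refl])
    fix l assume "l \<in> {..m}"
    then have l: "l \<le> m" by simp
    have "N dvd l + (N - k) \<longleftrightarrow> l = k"
    proof
      assume "N dvd l + (N - k)"
      then obtain q where q: "l + (N - k) = N * q" by (rule dvdE)
      have "q \<noteq> 0" using q k by (cases q) (simp_all add: N_def)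
      moreover have "q < 2"
      proof (rule ccontr)
        assume "\<not> q < 2"
        then have "N * 2 \<le> N * q" by simp
        then show False using q l by (simp add: N_def)
      qed
      ultimately have "q = 1" by simp
      then show "l = k" using q k by (simp add: N_def)
    qed (use k in \<open>simp add: N_def\<close>)
    then show "c l * (\<Sum>j<N. \<omega> ^ (j * (l + (N - k)))) = (if l = k then of_nat N * c k else 0)"
      using sum_root_of_unity_powers[OF N, of "l + (N - k)"] unfolding \<omega>_def by simp
  qed
  also have "\<dots> = of_nat N * c k" using k by simp
  finally show ?thesis .
qed

text \<open>The right side is \<open>N\<close> times the coefficient of \<open>t\<close> in
  \<open>(a + t * z) ^ (d + 1)\<close>. The degree \<open>d + 1\<close> calls for
  \<open>d + 2\<close> nodes, and the weight \<open>N - 1\<close> selects the exponent 1.\<close>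

lemma polarize_one_variable:
  fixes a z :: complex and d :: nat
  defines "N \<equiv> d + 2"
  defines "\<omega> \<equiv> exp (2 * of_real pi * \<i> / of_nat N) :: complex"
  shows "(\<Sum>j<N. \<omega> ^ (j * (N - 1)) * (a + \<omega> ^ j * z) ^ (d + 1)) = of_nat N * of_nat (d + 1) * (z * a ^ d)"
proof -
  define c where "c l = of_nat (d + 1 choose l) * z ^ l * a ^ (d + 1 - l)" for l
  have "(a + t * z) ^ (d + 1) = (\<Sum>l\<le>d+1. c l * t ^ l)" for t
    unfolding add.commute[of a] binomial_ring c_def
    by (intro sum.cong refl) (simp add: power_mult_distrib mult_ac)
  moreover have "Suc (d + 1) = N" by (simp add: N_def)
  ultimately show ?thesis
    using coefficient_extraction[of 1 "d + 1" c] unfolding \<omega>_def by (simp add: c_def)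
qed

definition lin :: "'i set \<Rightarrow> ('i \<Rightarrow> complex) \<Rightarrow> ('i \<Rightarrow> complex) \<Rightarrow> complex" where
  "lin I y x = (\<Sum>i\<in>I. y i * x i)"

lemma lin_upd: "finite I \<Longrightarrow> k \<in> I \<Longrightarrow> lin I (y(k := y k + c)) x = lin I y x + c * x k"
proof -
  assume I: "finite I" "k \<in> I"
  have "(\<Sum>i\<in>I - {k}. (y(k := y k + c)) i * x i) = (\<Sum>i\<in>I - {k}. y i * x i)" by (rule sum.cong) auto
  then show ?thesis by (simp add: lin_def sum.remove[OF I] algebra_simps)
qed

lemma lin_power_expand:
  assumes "finite I"
  shows "lin I y x ^ d = (\<Sum>f\<in>{..<d} \<rightarrow>\<^sub>E I. (\<Prod>t<d. y (f t)) * (\<Prod>t<d. x (f t)))"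
proof -
  have "lin I y x ^ d = (\<Prod>t<d. \<Sum>i\<in>I. y i * x i)" by (simp add: lin_def)
  also have "\<dots> = (\<Sum>f\<in>{..<d} \<rightarrow>\<^sub>E I. \<Prod>t<d. y (f t) * x (f t))"
    by (rule prod_sum_PiE) (use assms in auto)
  finally show ?thesis by (simp only: prod.distrib)
qed

text \<open>By polarisation, a coordinate times a power of a linear form is a combination of powers,
  one degree higher, of that linear form shifted by roots of unity in the coordinate. In degree 0
  every power is 1, so the zero vector serves for a constant.\<close>

lemma form_sum_of_powers_list:
  assumes I: "finite I" and "form I d p"
  shows "\<exists>xs. \<forall>x. p x = (\<Sum>(e, y)\<leftarrow>xs. e * lin I y x ^ d)"
  using assms(2)
proof (induction rule: galg.induct)
  case (const c)
  show ?case by (rule exI[of _ "[(c, \<lambda>_. 0)]"]) simp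
next
  case (zero d)
  show ?case by (rule exI[of _ "[]"]) simp
next
  case (gen g d b)
  then obtain k where k: "k \<in> I" "g = (\<lambda>x. x k)" by (auto simp: coord_def)
  from gen.IH obtain xs where xs: "\<forall>x. b x = (\<Sum>(e, y)\<leftarrow>xs. e * lin I y x ^ d)" by (rule exE)
  define N where "N = d + 2"
  define \<omega> :: complex where "\<omega> = exp (2 * of_real pi * \<i> / of_nat N)"
  define T where "T = (\<lambda>(e, y). map (\<lambda>j. (e * \<omega> ^ (j * (N - 1)) / (of_nat N * of_nat (d + 1)), y(k := y k + \<omega> ^ j))) [0..<N])"
  have T: "(\<Sum>(e, y)\<leftarrow>T (e, y). e * lin I y x ^ (d + 1)) = x k * (e * lin I y x ^ d)" for e y x
  proof -
    have nz: "of_nat N * of_nat (d + 1) \<noteq> (0::complex)" unfolding N_def by (simp del: of_nat_add of_nat_Suc)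
    have "(\<Sum>(e, y)\<leftarrow>T (e, y). e * lin I y x ^ (d + 1)) =
      (\<Sum>j<N. e * \<omega> ^ (j * (N - 1)) / (of_nat N * of_nat (d + 1)) * (lin I y x + \<omega> ^ j * x k) ^ (d + 1))"
      unfolding T_def by (simp only: prod.case map_map o_def lin_upd[OF I k(1)] interv_sum_list_conv_sum_set_nat set_upt atLeast0LessThan)
    also have "\<dots> = e / (of_nat N * of_nat (d + 1)) * (\<Sum>j<N. \<omega> ^ (j * (N - 1)) * (lin I y x + \<omega> ^ j * x k) ^ (d + 1))"
      unfolding sum_distrib_left by (intro sum.cong refl) (simp only: times_divide_eq_left times_divide_eq_right mult_ac)
    also have "\<dots> = e / (of_nat N * of_nat (d + 1)) * (of_nat N * of_nat (d + 1) * (x k * lin I y x ^ d))"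
      using polarize_one_variable[of d "lin I y x" "x k"] unfolding N_def \<omega>_def by (simp only:)
    also have "\<dots> = x k * (e * lin I y x ^ d)" using nz by (simp only: times_divide_eq_left nonzero_mult_div_cancel_left mult_ac) (simp del: of_nat_add of_nat_Suc)
    finally show ?thesis .
  qed
  have "(\<Sum>(e, y)\<leftarrow>concat (map T ys). e * lin I y x ^ (d + 1)) = x k * (\<Sum>(e, y)\<leftarrow>ys. e * lin I y x ^ d)" for ys x
  proof (induction ys)
    case (Cons a ys)
    obtain e y where a: "a = (e, y)" by (cases a)
    show ?case using Cons T[where e=e and y=y] by (simp add: a distrib_left del: power_Suc)
  qed simp
  then show ?case using xs by (intro exI[of _ "concat (map T xs)"]) (simp add: k(2))
next
  case (add d a b)
  from add.IH(1) obtain xs where "\<forall>x. a x = (\<Sum>(e, y)\<leftarrow>xs. e * lin I y x ^ d)" by (rule exE)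
  moreover from add.IH(2) obtain ys where "\<forall>x. b x = (\<Sum>(e, y)\<leftarrow>ys. e * lin I y x ^ d)" by (rule exE)
  ultimately show ?case by (intro exI[of _ "xs @ ys"]) simp
qed

lemma form_sum_of_powers:
  assumes "finite I" and "form I d p"
  obtains N :: nat and e y where "\<And>x. p x = (\<Sum>l<N. e l * lin I (y l) x ^ d)"
proof -
  obtain xs where xs: "\<forall>x. p x = (\<Sum>(e, y)\<leftarrow>xs. e * lin I y x ^ d)"
    using form_sum_of_powers_list[OF assms] by (rule exE)
  have "p x = (\<Sum>l<length xs. fst (xs ! l) * lin I (snd (xs ! l)) x ^ d)" for x
    unfolding xs[rule_format] by (simp add: sum_list_sum_nth atLeast0LessThan case_prod_unfold)
  then show ?thesis by (rule that)
qed

section \<open>Determinants as forms on the space of matrices, and the pairing with their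
  powers\<close>

definition dt :: "nat \<Rightarrow> (nat \<times> nat \<Rightarrow> complex) \<Rightarrow> complex" where
  "dt r g = Determinant.det (Matrix.mat r r g)"

definition mmul :: "nat \<Rightarrow> (nat \<times> nat \<Rightarrow> complex) \<Rightarrow> (nat \<times> nat \<Rightarrow> complex) \<Rightarrow> nat \<times> nat \<Rightarrow> complex" where
  "mmul r A g = (\<lambda>(i, j). \<Sum>k<r. A (i, k) * g (k, j))"

lemma dt_expand: "dt r g = (\<Sum>p | p permutes {0..<r}. signof p * (\<Prod>i = 0..<r. g (i, p i)))"
proof -
  have "(\<Prod>i = 0..<r. Matrix.mat r r g $$ (i, p i)) = (\<Prod>i = 0..<r. g (i, p i))"
    if "p permutes {0..<r}" for p
  proof (rule prod.cong[OF refl])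
    fix i assume i: "i \<in> {0..<r}"
    then have "p i < r" using permutes_in_image[OF that, of i] by auto
    then show "Matrix.mat r r g $$ (i, p i) = g (i, p i)" using i by simp
  qed
  then show ?thesis unfolding dt_def det_def'[OF mat_carrier] by (intro sum.cong refl) simp
qed

lemma dt_cong: "(\<And>i j. i < r \<Longrightarrow> j < r \<Longrightarrow> g (i, j) = h (i, j)) \<Longrightarrow> dt r g = dt r h"
  unfolding dt_def by (intro arg_cong[of _ _ Determinant.det] eq_matI) auto

lemma dt_mmul: "dt r (mmul r A g) = dt r A * dt r g"
proof -
  have "Matrix.mat r r (mmul r A g) = Matrix.mat r r A * Matrix.mat r r g"
    by (intro eq_matI) (auto simp: mmul_def scalar_prod_def atLeast0LessThan)
  then show ?thesis unfolding dt_def by (simp add: det_mult[of _ r])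
qed

lemma dt_transpose: "dt r (\<lambda>(i, j). A (j, i)) = dt r A"
proof -
  have "Matrix.mat r r (\<lambda>(i, j). A (j, i)) = transpose_mat (Matrix.mat r r A)"
    by (intro eq_matI) auto
  then show ?thesis unfolding dt_def by (simp add: Determinant.det_transpose[OF mat_carrier])
qed

lemma dt_one: "dt r (\<lambda>(i, j). if i = j then 1 else 0) = 1"
  unfolding dt_def one_mat_def[symmetric] by simp

lemma dt_cnj: "dt r (\<lambda>i. cnj (g i)) = cnj (dt r g)"
  unfolding dt_expand cnj_sum by (intro sum.cong refl) (simp add: sign_def)

lemma dt_row_add:
  assumes "j < r"
  shows "dt r (\<lambda>(i, k). if i = j then a k + b k else A (i, k)) =
    dt r (\<lambda>(i, k). if i = j then a k else A (i, k)) + dt r (\<lambda>(i, k). if i = j then b k else A (i, k))"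
proof -
  have j: "j \<in> {0..<r}" "finite {0..<r}" using assms by auto
  have rest: "(\<Prod>i\<in>{0..<r} - {j}. if i = j then c (p i) else A (i, p i)) = (\<Prod>i\<in>{0..<r} - {j}. A (i, p i))"
    for c :: "nat \<Rightarrow> complex" and p by (rule prod.cong) auto
  show ?thesis
    unfolding dt_expand sum.distrib[symmetric] prod.case prod.remove[OF j(2,1)] rest
    by (intro sum.cong refl) (simp add: algebra_simps)
qed

lemma dt_row_scale:
  assumes "j < r"
  shows "dt r (\<lambda>(i, k). if i = j then c * a k else A (i, k)) = c * dt r (\<lambda>(i, k). if i = j then a k else A (i, k))"
proof -
  have j: "j \<in> {0..<r}" "finite {0..<r}" using assms by auto
  have rest: "(\<Prod>i\<in>{0..<r} - {j}. if i = j then c (p i) else A (i, p i)) = (\<Prod>i\<in>{0..<r} - {j}. A (i, p i))"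
    for c :: "nat \<Rightarrow> complex" and p by (rule prod.cong) auto
  show ?thesis
    unfolding dt_expand sum_distrib_left prod.case prod.remove[OF j(2,1)] rest
    by (intro sum.cong refl) (simp add: mult_ac)
qed

lemma dt_equal_rows:
  assumes "i < r" "j < r" "i \<noteq> j" "\<And>k. k < r \<Longrightarrow> A (i, k) = A (j, k)"
  shows "dt r A = 0"
  unfolding dt_def
  by (rule Determinant.det_identical_rows[of _ r i j]) (use assms in \<open>auto intro!: eq_vecI\<close>)

lemma form_dt: "form ({..<r} \<times> {..<r}) r (dt r)"
proof -
  let ?I = "{..<r} \<times> {..<r}"
  have "form ?I r (\<lambda>g. \<Prod>i\<in>{0..<r}. g (i, p i))" if p: "p permutes {0..<r}" for p
  proof -
    have "form ?I (Suc 0) (\<lambda>g. g (i, p i))" if "i \<in> {0..<r}" for i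
      by (rule form_var) (use that permutes_in_image[OF p, of i] in auto)
    then show ?thesis using galg_prod[of "{0..<r}" "coord ?I" 1 "\<lambda>_. Suc 0" "\<lambda>i g. g (i, p i)"] by simp
  qed
  then have "form ?I r (\<lambda>g. \<Sum>p\<in>{p. p permutes {0..<r}}. signof p * (\<Prod>i\<in>{0..<r}. g (i, p i)))"
    by (intro galg_sum galg_scale) simp
  then show ?thesis unfolding dt_expand[abs_def] .
qed

lemma lin_times: "lin (A \<times> B) z g = (\<Sum>i\<in>A. \<Sum>j\<in>B. z (i, j) * g (i, j))"
  unfolding lin_def sum.cartesian_product by (rule sum.cong) auto

text \<open>The transpose is the adjoint of left multiplication for the bilinear pairing of
  matrices; this moves an action on points over to linear forms.\<close>

lemma lin_mmul:
  "lin ({..<r} \<times> {..<r}) z (mmul r A g) = lin ({..<r} \<times> {..<r}) (mmul r (\<lambda>(i, j). A (j, i)) z) g"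
proof -
  have "lin ({..<r} \<times> {..<r}) z (mmul r A g) = (\<Sum>i<r. \<Sum>j<r. \<Sum>k<r. z (i, j) * A (i, k) * g (k, j))"
    by (simp add: lin_times mmul_def sum_distrib_left mult.assoc)
  also have "\<dots> = (\<Sum>i<r. \<Sum>k<r. \<Sum>j<r. z (i, j) * A (i, k) * g (k, j))"
    by (rule sum.cong[OF refl], rule sum.swap)
  also have "\<dots> = (\<Sum>k<r. \<Sum>i<r. \<Sum>j<r. z (i, j) * A (i, k) * g (k, j))"
    by (rule sum.swap)
  also have "\<dots> = (\<Sum>k<r. \<Sum>j<r. \<Sum>i<r. z (i, j) * A (i, k) * g (k, j))"
    by (rule sum.cong[OF refl], rule sum.swap)
  also have "\<dots> = lin ({..<r} \<times> {..<r}) (mmul r (\<lambda>(i, j). A (j, i)) z) g"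
    by (simp add: lin_times mmul_def sum_distrib_left sum_distrib_right mult_ac)
  finally show ?thesis .
qed

text \<open>Pairing with \<open>det\<^sup>n\<close> in the inner product on forms of degree \<open>r n\<close> for which
  \<open>\<langle>\<ell>\<^sub>y\<^sup>d, \<ell>\<^sub>z\<^sup>d\<rangle>\<close> is the \<open>d\<close>-th power of the inner product of \<open>y\<close> and \<open>z\<close>;
  writing \<open>det\<^sup>n\<close> as a sum of powers of linear forms makes it a combination of point evaluations.\<close>

lemma det_power_pairing:
  fixes r n :: nat
  obtains N :: nat and e y where
    "\<And>h A. form ({..<r} \<times> {..<r}) (r * n) h \<Longrightarrow>
      (\<Sum>l<N. e l * h (mmul r A (y l))) = dt r A ^ n * (\<Sum>l<N. e l * h (y l))"
    and "(\<Sum>l<N. e l * dt r (y l) ^ n) \<noteq> 0"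
proof -
  let ?I = "{..<r} \<times> {..<r}"
  define d where "d = r * n"
  have I: "finite ?I" by simp
  have fQ: "form ?I d (\<lambda>x. dt r x ^ n)" unfolding d_def by (rule galg_power[OF form_dt])
  obtain N :: nat and e' y' where Q: "\<And>x. dt r x ^ n = (\<Sum>l<N. e' l * lin ?I (y' l) x ^ d)"
    using form_sum_of_powers[OF I fQ] by metis
  define e where "e l = cnj (e' l)" for l
  define y where "y l = (\<lambda>i. cnj (y' l i))" for l
  \<comment> \<open>Reproducing property: pairing with the power of the linear form of
    \<open>z\<close> evaluates \<open>det^n\<close> at \<open>z\<close>. The conjugates in
    \<open>e\<close> and \<open>y\<close> make the pairing hermitian, and the outer conjugation is
    undone because the determinant has real coefficients.\<close>
  have ev: "(\<Sum>l<N. e l * lin ?I z (y l) ^ d) = dt r z ^ n" for z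
  proof -
    have "lin ?I z (y l) = cnj (lin ?I (y' l) (\<lambda>i. cnj (z i)))" for l
      by (simp add: lin_def y_def mult.commute)
    then have "(\<Sum>l<N. e l * lin ?I z (y l) ^ d) = cnj (\<Sum>l<N. e' l * lin ?I (y' l) (\<lambda>i. cnj (z i)) ^ d)"
      by (simp add: e_def)
    also have "\<dots> = dt r z ^ n" unfolding Q[symmetric] dt_cnj by simp
    finally show ?thesis .
  qed
  \<comment> \<open>If \<open>h\<close> is a combination of powers of the linear forms
    \<open>w k\<close>, its pairing is the same combination of the values of \<open>det^n\<close> at
    the \<open>w k\<close>. Left multiplication by \<open>A\<close> acts on the \<open>w k\<close>
    by the transpose and multiplies every such value by \<open>dt r A ^ n\<close>.\<close>
  have equiv: "(\<Sum>l<N. e l * h (mmul r A (y l))) = dt r A ^ n * (\<Sum>l<N. e l * h (y l))"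
    if h: "form ?I d h" for h A
  proof -
    obtain M :: nat and c w where w: "\<And>x. h x = (\<Sum>k<M. c k * lin ?I (w k) x ^ d)"
      using form_sum_of_powers[OF I h] by metis
    have swap: "(\<Sum>l<N. e l * (\<Sum>k<M. c k * lin ?I (w' k) (y l) ^ d)) = (\<Sum>k<M. c k * dt r (w' k) ^ n)" for w'
    proof -
      have "(\<Sum>l<N. e l * (\<Sum>k<M. c k * lin ?I (w' k) (y l) ^ d)) =
        (\<Sum>l<N. \<Sum>k<M. c k * (e l * lin ?I (w' k) (y l) ^ d))"
        by (simp add: sum_distrib_left mult_ac)
      also have "\<dots> = (\<Sum>k<M. c k * (\<Sum>l<N. e l * lin ?I (w' k) (y l) ^ d))"
        by (subst sum.swap) (simp add: sum_distrib_left)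
      finally show ?thesis unfolding ev .
    qed
    have "(\<Sum>l<N. e l * h (mmul r A (y l))) =
      (\<Sum>k<M. c k * dt r (mmul r (\<lambda>(i, j). A (j, i)) (w k)) ^ n)"
      unfolding w lin_mmul by (rule swap)
    also have "\<dots> = dt r A ^ n * (\<Sum>k<M. c k * dt r (w k) ^ n)"
      unfolding dt_mmul dt_transpose by (simp add: sum_distrib_left power_mult_distrib mult_ac)
    also have "(\<Sum>k<M. c k * dt r (w k) ^ n) = (\<Sum>l<N. e l * h (y l))"
      unfolding w by (rule swap[symmetric])
    finally show ?thesis .
  qed
  have "(\<Sum>l<N. e l * dt r (y l) ^ n) \<noteq> 0"
  proof
    assume zero: "(\<Sum>l<N. e l * dt r (y l) ^ n) = 0"
    let ?F = "{..<d} \<rightarrow>\<^sub>E ?I"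
    \<comment> \<open>\<open>W f\<close> are the coefficients of \<open>det^n\<close> in its
      expansion into words of length \<open>d\<close>. The pairing of \<open>det^n\<close> with
      itself is the sum of their squared moduli, so its vanishing would force \<open>det^n\<close>
      to vanish even at the identity matrix.\<close>
    define W where "W f = (\<Sum>l<N. e' l * (\<Prod>t<d. y' l (f t)))" for f
    have finF: "finite ?F" by (intro finite_PiE) auto
    have Qf: "dt r x ^ n = (\<Sum>f\<in>?F. W f * (\<Prod>t<d. x (f t)))" for x
      unfolding Q lin_power_expand[OF I] W_def sum_distrib_left sum_distrib_right
      by (subst sum.swap) (simp add: mult.assoc)
    have "0 = (\<Sum>l<N. e l * (\<Sum>f\<in>?F. W f * (\<Prod>t<d. y l (f t))))"
      using zero unfolding Qf by simp
    also have "\<dots> = (\<Sum>f\<in>?F. W f * (\<Sum>l<N. e l * (\<Prod>t<d. y l (f t))))"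
      unfolding sum_distrib_left by (subst sum.swap) (simp add: mult_ac)
    also have "\<dots> = (\<Sum>f\<in>?F. of_real ((cmod (W f))\<^sup>2))"
    proof (rule sum.cong[OF refl])
      fix f
      have "(\<Sum>l<N. e l * (\<Prod>t<d. y l (f t))) = cnj (W f)" by (simp add: e_def y_def W_def)
      then show "W f * (\<Sum>l<N. e l * (\<Prod>t<d. y l (f t))) = of_real ((cmod (W f))\<^sup>2)"
        by (simp only: complex_norm_square)
    qed
    also have "\<dots> = of_real (\<Sum>f\<in>?F. (cmod (W f))\<^sup>2)" by simp
    finally have "complex_of_real (\<Sum>f\<in>?F. (cmod (W f))\<^sup>2) = 0" by (rule sym)
    then have "(\<Sum>f\<in>?F. (cmod (W f))\<^sup>2) = 0" by (simp only: of_real_eq_0_iff)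
    then have "\<forall>f\<in>?F. W f = 0" using finF by (simp add: sum_nonneg_eq_0_iff)
    then have "dt r (\<lambda>(i, j). if i = j then 1 else 0) ^ n = 0" unfolding Qf by simp
    then show False unfolding dt_one by simp
  qed
  then show ?thesis
    by (rule that[rotated]) (rule equiv[unfolded d_def])
qed

text \<open>Pairing turns the left side of the integral equation of \<open>dt r\<close> into a
  nonzero number, so some summand on the right is nonzero too. Its power of the determinant is below
  \<open>n\<close>; the returned \<open>k\<close> is the complementary exponent and hence
  positive.\<close>

theorem semi_invariant_exists:
  assumes m: "m > 0" and G: "\<And>g. g \<in> G \<Longrightarrow> form ({..<r} \<times> {..<r}) m g"
    and noz: "\<And>x i. (\<And>g. g \<in> G \<Longrightarrow> g x = 0) \<Longrightarrow> i \<in> {..<r} \<times> {..<r} \<Longrightarrow> x i = 0"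
  obtains k n b and N :: nat and e y where "0 < k" "k \<le> n" "galg G m (r * k) b"
    and "\<And>h A. form ({..<r} \<times> {..<r}) (r * n) h \<Longrightarrow>
      (\<Sum>l<N. e l * h (mmul r A (y l))) = dt r A ^ n * (\<Sum>l<N. e l * h (y l))"
    and "(\<Sum>l<N. e l * (b (y l) * dt r (y l) ^ (n - k))) \<noteq> 0"
proof -
  obtain n b where b: "\<And>k. k < n \<Longrightarrow> galg G m (r * (n - k)) (b k)"
    "\<And>x. dt r x ^ n = (\<Sum>k<n. b k x * dt r x ^ k)"
  proof (rule form_integral[OF _ m _ _ form_dt])
    show "form ({..<r} \<times> {..<r}) m g" if "g \<in> G" for g by (rule G[OF that])
    show "x i = 0" if "\<And>g. g \<in> G \<Longrightarrow> g x = 0" "i \<in> {..<r} \<times> {..<r}" for x i using noz[OF that] .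
  qed (simp, rule that, assumption+)
  obtain N :: nat and e y where ey:
    "\<And>h A. form ({..<r} \<times> {..<r}) (r * n) h \<Longrightarrow>
      (\<Sum>l<N. e l * h (mmul r A (y l))) = dt r A ^ n * (\<Sum>l<N. e l * h (y l))"
    "(\<Sum>l<N. e l * dt r (y l) ^ n) \<noteq> 0"
    by (rule det_power_pairing[where r=r and n=n], rule that, assumption+)
  have "(\<Sum>l<N. e l * dt r (y l) ^ n) = (\<Sum>k<n. \<Sum>l<N. e l * (b k (y l) * dt r (y l) ^ k))"
    unfolding b(2) sum_distrib_left by (rule sum.swap)
  with ey(2) have "(\<Sum>k<n. \<Sum>l<N. e l * (b k (y l) * dt r (y l) ^ k)) \<noteq> 0" by (simp only: not_False_eq_True)
  then obtain k where "k \<in> {..<n}" and k': "(\<Sum>l<N. e l * (b k (y l) * dt r (y l) ^ k)) \<noteq> 0"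
    by (rule sum.not_neutral_contains_not_neutral)
  then have k: "k < n" by simp
  show ?thesis
  proof (rule that[where k="n - k" and n=n and b="b k" and N=N and e=e and y=y])
    show "0 < n - k" "n - k \<le> n" using k by simp_all
    show "galg G m (r * (n - k)) (b k)" by (rule b(1)[OF k])
    have "n - (n - k) = k" using k by simp
    then show "(\<Sum>l<N. e l * (b k (y l) * dt r (y l) ^ (n - (n - k)))) \<noteq> 0" using k' by (simp only: not_False_eq_True)
  qed (rule ey(1))
qed

section \<open>Hyperplanes and the tautological quotient\<close>

definition kern :: "('x, 'e) vbundle \<Rightarrow> 'x \<Rightarrow> ('e \<Rightarrow> complex) \<Rightarrow> 'e set" where
  "kern E x l = {u \<in> fibre E x. l u = 0}"

definition covec :: "('x, 'e) vbundle \<Rightarrow> ('e \<Rightarrow> nat \<Rightarrow> complex) \<Rightarrow> 'x \<Rightarrow> (nat \<Rightarrow> complex) \<Rightarrow> 'e \<Rightarrow> complex" where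
  "covec E \<phi> x \<xi> = (\<lambda>e\<in>fibre E x. \<Sum>i<vrank E. \<xi> i * \<phi> e i)"

lemma dual_add: "l \<in> dual E x \<Longrightarrow> u \<in> fibre E x \<Longrightarrow> v \<in> fibre E x \<Longrightarrow> l (vadd E u v) = l u + l v"
  and dual_smul: "l \<in> dual E x \<Longrightarrow> u \<in> fibre E x \<Longrightarrow> l (smul E c u) = c * l u"
  and dual_ext: "l \<in> dual E x \<Longrightarrow> l \<in> extensional (fibre E x)"
  by (simp_all add: dual_def)

text \<open>What a vector bundle provides at one point. Injectivity of the trivialisation on the
  fibre reduces every identity between vectors to one between coordinates, through
  \<open>eqI\<close>.\<close>

locale triv_fibre =
  fixes E :: "('x, 'e) vbundle" and \<phi> :: "'e \<Rightarrow> nat \<Rightarrow> complex" and x :: 'x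
  assumes bij: "bij_betw \<phi> (fibre E x) (cspace (vrank E))"
    and add_closed: "\<And>u v. u \<in> fibre E x \<Longrightarrow> v \<in> fibre E x \<Longrightarrow> vadd E u v \<in> fibre E x"
    and smul_closed: "\<And>u c. u \<in> fibre E x \<Longrightarrow> smul E c u \<in> fibre E x"
    and \<phi>_add: "\<And>u v. u \<in> fibre E x \<Longrightarrow> v \<in> fibre E x \<Longrightarrow> \<phi> (vadd E u v) = (\<lambda>i. \<phi> u i + \<phi> v i)"
    and \<phi>_smul: "\<And>u c. u \<in> fibre E x \<Longrightarrow> \<phi> (smul E c u) = (\<lambda>i. c * \<phi> u i)"
begin

abbreviation "F \<equiv> fibre E x"
abbreviation "r \<equiv> vrank E"

lemma eqI: "u \<in> F \<Longrightarrow> v \<in> F \<Longrightarrow> \<phi> u = \<phi> v \<Longrightarrow> u = v"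
  using bij by (auto simp: bij_betw_def inj_on_def)

lemma \<phi>_outside: "u \<in> F \<Longrightarrow> r \<le> i \<Longrightarrow> \<phi> u i = 0"
  using bij_betwE[OF bij] by (auto simp: cspace_def)

lemma frame:
  assumes "a < r"
  shows "frame E \<phi> x a \<in> F" and "\<phi> (frame E \<phi> x a) = (\<lambda>i. if i = a then 1 else 0)"
proof -
  have "(\<lambda>i. if i = a then 1 else 0) \<in> \<phi> ` F"
    using bij assms by (auto simp: bij_betw_def cspace_def)
  then show "frame E \<phi> x a \<in> F" "\<phi> (frame E \<phi> x a) = (\<lambda>i. if i = a then 1 else 0)"
    unfolding frame_def by (rule inv_into_into, rule f_inv_into_f)
qed

lemma covec_dual: "covec E \<phi> x \<xi> \<in> dual E x"
  by (simp add: dual_def covec_def add_closed smul_closed \<phi>_add \<phi>_smul distrib_left sum.distrib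
      sum_distrib_left mult.left_commute)

lemma covec_frame: "a < r \<Longrightarrow> covec E \<phi> x \<xi> (frame E \<phi> x a) = \<xi> a"
  by (simp add: covec_def frame if_distrib[of "\<lambda>t. _ * t"] cong: if_cong)

text \<open>A fibre comes with binary addition only, so \<open>u\<close> is not written as a sum
  over the frame. Its coordinates are cleared one at a time from the top instead, \<open>k\<close>
  being a bound on the support.\<close>

lemma dual_expand:
  assumes l: "l \<in> dual E x" and "u \<in> F"
  shows "l u = (\<Sum>i<r. l (frame E \<phi> x i) * \<phi> u i)"
proof -
  have "l u = (\<Sum>i<k. l (frame E \<phi> x i) * \<phi> u i)" if "k \<le> r" "u \<in> F" "\<forall>i\<ge>k. \<phi> u i = 0" for k u
    using that
  proof (induction k arbitrary: u)
    case 0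
    have "smul E 0 u = u" by (rule eqI) (use 0 in \<open>auto simp: smul_closed \<phi>_smul\<close>)
    then show ?case using dual_smul[OF l 0(2), of 0] by simp
  next
    case (Suc k)
    have k: "k < r" using Suc.prems by simp
    note fr = frame[OF k]
    let ?f = "smul E (- \<phi> u k) (frame E \<phi> x k)"
    define u' where "u' = vadd E u ?f"
    have f: "?f \<in> F" "\<phi> ?f = (\<lambda>i. if i = k then - \<phi> u k else 0)"
      using fr by (auto simp: smul_closed \<phi>_smul)
    have u': "u' \<in> F" "\<phi> u' = (\<lambda>i. if i = k then 0 else \<phi> u i)"
      using f Suc.prems(2) by (auto simp: u'_def add_closed \<phi>_add)
    have "l u' = (\<Sum>i<k. l (frame E \<phi> x i) * \<phi> u' i)"
    proof (rule Suc.IH)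
      show "\<forall>i\<ge>k. \<phi> u' i = 0" using Suc.prems(3) by (auto simp: u'(2) le_Suc_eq not_less_eq_eq)
    qed (use Suc.prems u' in auto)
    also have "\<dots> = (\<Sum>i<k. l (frame E \<phi> x i) * \<phi> u i)" by (rule sum.cong) (auto simp: u'(2))
    also have "l u' = l u - l (frame E \<phi> x k) * \<phi> u k"
      unfolding u'_def using dual_add[OF l Suc.prems(2) f(1)] dual_smul[OF l fr(1), of "- \<phi> u k"] by simp
    finally show ?case by (simp add: algebra_simps)
  qed
  from this[of r u] show ?thesis using assms(2) \<phi>_outside by auto
qed

lemma covec_cong: "(\<And>i. i < r \<Longrightarrow> \<xi> i = \<eta> i) \<Longrightarrow> covec E \<phi> x \<xi> = covec E \<phi> x \<eta>"
  unfolding covec_def by (intro restrict_ext sum.cong) auto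

text \<open>Cosets of the kernel become level sets of \<open>l\<close>, which is the form in which
  all later computations in the quotient are done.\<close>

lemma coset_kern:
  assumes l: "l \<in> dual E x" and u: "u \<in> F"
  shows "coset E (kern E x l) u = {w \<in> F. l w = l u}"
proof (intro Set.set_eqI iffI)
  fix w assume "w \<in> coset E (kern E x l) u"
  then show "w \<in> {w \<in> F. l w = l u}"
    using u l by (auto simp: coset_def kern_def add_closed dual_add)
next
  fix w assume w: "w \<in> {w \<in> F. l w = l u}"
  let ?h = "vadd E w (smul E (-1) u)"
  have h: "?h \<in> F" using w u by (simp add: add_closed smul_closed)
  have "l ?h = 0" using w u l by (simp add: dual_add dual_smul smul_closed)
  then have "?h \<in> kern E x l" using h by (simp add: kern_def)
  moreover have "w = vadd E u ?h"
    by (rule eqI) (use w u h in \<open>auto simp: add_closed smul_closed \<phi>_add \<phi>_smul\<close>)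
  ultimately show "w \<in> coset E (kern E x l) u" unfolding coset_def by (rule rev_image_eqI)
qed

lemma hyperplane_kern:
  assumes l: "l \<in> dual E x" and v: "v \<in> F" "l v \<noteq> 0"
  shows "hyperplane E x (kern E x l)"
  unfolding hyperplane_def
proof (intro conjI)
  show "kern E x l \<subseteq> F" by (auto simp: kern_def)
  have "smul E 0 v \<in> kern E x l" using v l by (simp add: kern_def smul_closed dual_smul)
  then show "kern E x l \<noteq> {}" by blast
  show "\<forall>u\<in>kern E x l. \<forall>v\<in>kern E x l. vadd E u v \<in> kern E x l"
    using l by (simp add: kern_def add_closed dual_add)
  show "\<forall>u\<in>kern E x l. \<forall>c. smul E c u \<in> kern E x l"
    using l by (simp add: kern_def smul_closed dual_smul)
  show "\<exists>v\<in>F - kern E x l. \<forall>u\<in>F. \<exists>c. u \<in> coset E (kern E x l) (smul E c v)"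
  proof (intro bexI ballI)
    show "v \<in> F - kern E x l" using v by (simp add: kern_def)
    fix u assume "u \<in> F"
    then have "u \<in> coset E (kern E x l) (smul E (l u / l v) v)"
      using v l by (simp add: coset_kern smul_closed dual_smul)
    then show "\<exists>c. u \<in> coset E (kern E x l) (smul E c v)" by blast
  qed
qed

text \<open>For a vector \<open>v\<close> that spans the quotient, every \<open>u\<close> is
  \<open>c v + h\<close> with \<open>h\<close> in \<open>H\<close>, and the functional reads off
  \<open>c\<close>. It is normalised by \<open>l v = 1\<close>.\<close>

lemma hyperplane_is_kern:
  assumes "hyperplane E x H"
  obtains l v where "l \<in> dual E x" "H = kern E x l" "v \<in> F" "l v \<noteq> 0"
proof -
  from assms have HF: "H \<subseteq> F" and Hadd: "\<And>u v. u \<in> H \<Longrightarrow> v \<in> H \<Longrightarrow> vadd E u v \<in> H"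
    and Hsmul: "\<And>u c. u \<in> H \<Longrightarrow> smul E c u \<in> H"
    unfolding hyperplane_def by auto
  from assms have "\<exists>v\<in>F - H. \<forall>u\<in>F. \<exists>c. u \<in> coset E H (smul E c v)"
    unfolding hyperplane_def by simp
  then obtain v where v': "v \<in> F - H" "\<forall>u\<in>F. \<exists>c. u \<in> coset E H (smul E c v)" by (rule bexE)
  then have v: "v \<in> F" "v \<notin> H" "\<And>u. u \<in> F \<Longrightarrow> \<exists>c. u \<in> coset E H (smul E c v)" by simp_all
  define P where "P u c \<longleftrightarrow> (\<exists>h\<in>H. u = vadd E (smul E c v) h)" for u c
  have ex: "\<exists>c. P u c" if "u \<in> F" for u using v(3)[OF that] by (auto simp: coset_def P_def)
  have cv: "smul E c v \<in> F" for c using v(1) by (rule smul_closed)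
  have uniq: "c = c'" if P: "P u c" "P u c'" for u c c'
  proof (rule ccontr)
    assume ne: "c \<noteq> c'"
    obtain h where h: "h \<in> H" "u = vadd E (smul E c v) h" using P(1) by (auto simp: P_def)
    obtain h' where h': "h' \<in> H" "u = vadd E (smul E c' v) h'" using P(2) by (auto simp: P_def)
    have hF: "h \<in> F" "h' \<in> F" using h(1) h'(1) HF by auto
    have eq: "c * \<phi> v i + \<phi> h i = c' * \<phi> v i + \<phi> h' i" for i
    proof -
      have "\<phi> (vadd E (smul E c v) h) i = \<phi> (vadd E (smul E c' v) h') i" using h(2) h'(2) by simp
      then show ?thesis using hF v(1) cv by (simp add: \<phi>_add \<phi>_smul)
    qed
    \<comment> \<open>Solving \<open>c v + h = c' v + h'\<close> for \<open>v\<close> would place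
      \<open>v\<close> in \<open>H\<close>.\<close>
    let ?w = "smul E (1 / (c - c')) (vadd E h' (smul E (-1) h))"
    have "?w \<in> H" by (intro Hsmul Hadd h h')
    moreover have "v = ?w"
    proof (rule eqI)
      show "v \<in> F" by (rule v(1))
      show "?w \<in> F" using hF by (intro smul_closed add_closed)
      show "\<phi> v = \<phi> ?w"
      proof
        fix i
        have "(c - c') * \<phi> v i = \<phi> h' i - \<phi> h i" using eq[of i] by (simp add: algebra_simps)
        then have "\<phi> v i = (\<phi> h' i - \<phi> h i) / (c - c')" using ne by (simp add: field_simps)
        then show "\<phi> v i = \<phi> ?w i" using hF by (simp add: \<phi>_smul \<phi>_add smul_closed add_closed)
      qed
    qed
    ultimately show False using v(2) by simp
  qed
  define l where "l = (\<lambda>u\<in>F. SOME c. P u c)"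
  have lP: "P u (l u)" if "u \<in> F" for u using someI_ex[OF ex[OF that]] that by (simp add: l_def)
  have leq: "l u = c" if "u \<in> F" "P u c" for u c using uniq[OF lP[OF that(1)] that(2)] .
  have "l \<in> dual E x" unfolding dual_def
  proof (intro CollectI conjI ballI allI)
    show "l \<in> extensional F" by (simp add: l_def)
    fix u assume u: "u \<in> F"
    obtain h where h: "h \<in> H" "u = vadd E (smul E (l u) v) h" using lP[OF u] by (auto simp: P_def)
    have hF: "h \<in> F" using h(1) HF by auto
    have \<phi>u: "\<phi> u i = l u * \<phi> v i + \<phi> h i" for i
    proof -
      have "\<phi> u = \<phi> (vadd E (smul E (l u) v) h)" using h(2) by simp
      then show ?thesis using hF v(1) cv by (simp add: \<phi>_add \<phi>_smul)
    qed
    show "l (smul E c u) = c * l u" for c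
    proof (rule leq)
      show "smul E c u \<in> F" using u by (rule smul_closed)
      have "smul E c u = vadd E (smul E (c * l u) v) (smul E c h)"
        by (rule eqI) (use u hF v(1) in \<open>auto simp: smul_closed add_closed \<phi>_smul \<phi>_add \<phi>u algebra_simps\<close>)
      then show "P (smul E c u) (c * l u)" unfolding P_def by (rule bexI[OF _ Hsmul[OF h(1)]])
    qed
    fix w assume w: "w \<in> F"
    obtain h' where h': "h' \<in> H" "w = vadd E (smul E (l w) v) h'" using lP[OF w] by (auto simp: P_def)
    have hF': "h' \<in> F" using h'(1) HF by auto
    have \<phi>w: "\<phi> w i = l w * \<phi> v i + \<phi> h' i" for i
    proof -
      have "\<phi> w = \<phi> (vadd E (smul E (l w) v) h')" using h'(2) by simp
      then show ?thesis using hF' v(1) cv by (simp add: \<phi>_add \<phi>_smul)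
    qed
    show "l (vadd E u w) = l u + l w"
    proof (rule leq)
      show "vadd E u w \<in> F" using u w by (rule add_closed)
      have "vadd E u w = vadd E (smul E (l u + l w) v) (vadd E h h')"
        by (rule eqI) (use u w hF hF' v(1) in \<open>auto simp: smul_closed add_closed \<phi>_smul \<phi>_add \<phi>u \<phi>w algebra_simps\<close>)
      then show "P (vadd E u w) (l u + l w)" unfolding P_def by (rule bexI[OF _ Hadd[OF h(1) h'(1)]])
    qed
  qed
  moreover have "H = kern E x l"
  proof (intro Set.set_eqI iffI)
    fix u assume u: "u \<in> H"
    have "u = vadd E (smul E 0 v) u"
      by (rule eqI) (use u HF v(1) in \<open>auto simp: smul_closed add_closed \<phi>_smul \<phi>_add\<close>)
    then have "P u 0" unfolding P_def using u by (rule bexI)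
    then show "u \<in> kern E x l" using leq[of u 0] u HF by (auto simp: kern_def)
  next
    fix u assume "u \<in> kern E x l"
    then have u: "u \<in> F" "l u = 0" by (auto simp: kern_def)
    then obtain h where h: "h \<in> H" "u = vadd E (smul E 0 v) h" using lP[OF u(1)] by (auto simp: P_def)
    have "vadd E (smul E 0 v) h = h"
      by (rule eqI) (use h HF v(1) in \<open>auto simp: smul_closed add_closed \<phi>_smul \<phi>_add\<close>)
    then show "u \<in> H" using h by simp
  qed
  moreover have "l v = 1"
  proof (rule leq[OF v(1)])
    obtain u where "u \<in> H" using assms unfolding hyperplane_def by auto
    then have h: "smul E 0 u \<in> H" "smul E 0 u \<in> F" "u \<in> F" using Hsmul HF by auto
    have "v = vadd E (smul E 1 v) (smul E 0 u)"
      by (rule eqI) (use h v(1) in \<open>auto simp: smul_closed add_closed \<phi>_smul \<phi>_add\<close>)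
    then show "P v 1" unfolding P_def using h(1) by (rule bexI)
  qed
  ultimately show ?thesis using that[of l v] v(1) by simp
qed

text \<open>The quotient line is generated by the class of the \<open>a\<close>-th frame vector, on
  which the covector takes the value \<open>\<xi> a\<close>; hence the denominator.\<close>

lemma coset_coord_kern:
  assumes a: "a < r" "\<xi> a \<noteq> 0" and u: "u \<in> F"
  shows "coset_coord E \<phi> x a (coset E (kern E x (covec E \<phi> x \<xi>)) u) = covec E \<phi> x \<xi> u / \<xi> a"
  unfolding coset_coord_def coset_kern[OF covec_dual u]
proof (rule the_equality)
  note fr = frame[OF a(1)]
  have l: "covec E \<phi> x \<xi> (smul E c (frame E \<phi> x a)) = c * \<xi> a" for c
    using dual_smul[OF covec_dual fr(1)] covec_frame[OF a(1)] by simp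
  show "smul E (covec E \<phi> x \<xi> u / \<xi> a) (frame E \<phi> x a) \<in> {w \<in> F. covec E \<phi> x \<xi> w = covec E \<phi> x \<xi> u}"
    using a(2) smul_closed[OF fr(1)] by (simp add: l)
  show "c = covec E \<phi> x \<xi> u / \<xi> a"
    if "smul E c (frame E \<phi> x a) \<in> {w \<in> F. covec E \<phi> x \<xi> w = covec E \<phi> x \<xi> u}" for c
    using that a(2) by (auto simp: l eq_divide_eq)
qed

end

section \<open>Tensors evaluated on multiples of one functional; the numbering of affine
  coordinates\<close>

lemma tensors_linear:
  assumes t: "t \<in> tensors L k p" and w: "w \<in> {..<k} \<rightarrow>\<^sub>E dual L p" "j < k" "l \<in> dual L p"
  shows "t (w(j := \<lambda>e\<in>fibre L p. w j e + l e)) = t w + t (w(j := l))"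
    and "t (w(j := \<lambda>e\<in>fibre L p. c * l e)) = c * t (w(j := l))"
proof -
  from t have "\<forall>w \<in> {..<k} \<rightarrow>\<^sub>E dual L p. \<forall>j<k. \<forall>l\<in>dual L p.
     t (w(j := \<lambda>e\<in>fibre L p. w j e + l e)) = t w + t (w(j := l)) \<and>
     (\<forall>c. t (w(j := \<lambda>e\<in>fibre L p. c * l e)) = c * t (w(j := l)))"
    unfolding tensors_def mem_Collect_eq by (rule conjunct2)
  from bspec[OF this w(1), rule_format, OF w(2,3)]
  show "t (w(j := \<lambda>e\<in>fibre L p. w j e + l e)) = t w + t (w(j := l))"
    and "t (w(j := \<lambda>e\<in>fibre L p. c * l e)) = c * t (w(j := l))" by (rule conjunct1, rule conjunct2[THEN spec])
qed

text \<open>On a line all functionals are multiples of one, so this reduces a tensor to its value at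
  \<open>(q, ..., q)\<close>. Arguments are exchanged one by one: \<open>v i\<close> agrees with
  \<open>w\<close> in the first \<open>i\<close> places and with \<open>q\<close> in the
  others.\<close>

lemma tensors_multilinear:
  assumes t: "t \<in> tensors L k p" and q: "q \<in> dual L p"
    and w: "w \<in> {..<k} \<rightarrow>\<^sub>E dual L p"
    and wc: "\<And>j. j < k \<Longrightarrow> w j = (\<lambda>e\<in>fibre L p. c j * q e)"
  shows "t w = (\<Prod>j<k. c j) * t (\<lambda>j\<in>{..<k}. q)"
proof -
  define v where "v i = (\<lambda>j\<in>{..<k}. if j < i then w j else q)" for i
  have vP: "v i \<in> {..<k} \<rightarrow>\<^sub>E dual L p" for i
  proof (rule PiE_I)
    show "v i j \<in> dual L p" if "j \<in> {..<k}" for j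
      using PiE_mem[OF w that] q that by (simp add: v_def)
    show "v i j = undefined" if "j \<notin> {..<k}" for j using that by (simp add: v_def)
  qed
  have "t (v i) = (\<Prod>j<i. c j) * t (\<lambda>j\<in>{..<k}. q)" if "i \<le> k" for i
    using that
  proof (induction i)
    case 0
    have "v 0 = (\<lambda>j\<in>{..<k}. q)" by (simp add: v_def)
    then show ?case by (simp only: lessThan_0 prod.empty mult_1_left)
  next
    case (Suc i)
    then have i: "i < k" by simp
    have "v (Suc i) = (v i)(i := w i)"
      by (rule ext) (use i in \<open>simp add: v_def less_Suc_eq\<close>)
    then have "v (Suc i) = (v i)(i := \<lambda>e\<in>fibre L p. c i * q e)" using wc[OF i] by (simp only:)
    then have "t (v (Suc i)) = c i * t ((v i)(i := q))" using tensors_linear(2)[OF t vP i q] by (simp only:)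
    also have "(v i)(i := q) = v i" by (rule ext) (use i in \<open>simp add: v_def\<close>)
    also have "t (v i) = (\<Prod>j<i. c j) * t (\<lambda>j\<in>{..<k}. q)" by (rule Suc.IH) (use Suc.prems in simp)
    finally show ?case by (simp only: prod.lessThan_Suc mult_ac)
  qed
  from this[of k] have "t (v k) = (\<Prod>j<k. c j) * t (\<lambda>j\<in>{..<k}. q)" by simp
  moreover have "v k = w"
  proof
    show "v k j = w j" for j using PiE_arb[OF w, of j] by (simp add: v_def)
  qed
  ultimately show ?thesis by simp
qed

text \<open>Increasing enumeration of the indices other than \<open>a\<close>, in the order in which
  \<open>proj_chart\<close> lists the affine coordinates.\<close>

definition skip :: "nat \<Rightarrow> nat \<Rightarrow> nat" where
  "skip a j = (if j < a then j else Suc j)"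

lemma skip_less: "a < r \<Longrightarrow> j < r - 1 \<Longrightarrow> skip a j < r"
  and skip_neq: "skip a j \<noteq> a"
  by (auto simp: skip_def)

lemma skip_surj:
  assumes "b < r" "b \<noteq> a" "a < r"
  shows "(if b < a then b else b - 1) < r - 1" "skip a (if b < a then b else b - 1) = b"
  using assms by (auto simp: skip_def)

lemma skip_inj: "skip a j = skip a j' \<longleftrightarrow> j = j'"
  by (auto simp: skip_def)

text \<open>The coordinates of the hyperplane \<open>\<xi> = 0\<close>, \<open>\<xi> a = 1\<close>, over a point with coordinates \<open>z\<close> in the chart
  \<^const>\<open>proj_chart\<close>.\<close>

definition cmb :: "nat \<Rightarrow> nat \<Rightarrow> nat \<Rightarrow> (nat \<Rightarrow> complex) \<Rightarrow> (nat \<Rightarrow> complex) \<Rightarrow> nat \<Rightarrow> complex" where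
  "cmb n r a z \<xi> = (\<lambda>i. if i < n then z i else if i < n + (r - 1) then \<xi> (skip a (i - n)) else 0)"

section \<open>Points, fibres and charts of the projective bundle\<close>

locale holo_bundle =
  fixes X :: "'x cmfd" and E :: "('x, 'e) vbundle"
  assumes mf: "complex_manifold X" and vb: "holomorphic_vector_bundle X E"
begin

abbreviation "PB \<equiv> proj_bundle X E"
abbreviation "TB \<equiv> taut_bundle X E"
abbreviation "r \<equiv> vrank E"
abbreviation "n \<equiv> cdim X"

lemma triv_open: "(W, \<phi>) \<in> trivs E \<Longrightarrow> openin (topo X) W"
  using vb unfolding holomorphic_vector_bundle_def by fast

lemma triv_subset: "(W, \<phi>) \<in> trivs E \<Longrightarrow> x \<in> W \<Longrightarrow> x \<in> topspace (topo X)"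
  using openin_subset[OF triv_open] by blast

lemma triv_ex: "x \<in> topspace (topo X) \<Longrightarrow> \<exists>W \<phi>. (W, \<phi>) \<in> trivs E \<and> x \<in> W"
  using vb unfolding holomorphic_vector_bundle_def by auto

lemma triv_fibre:
  assumes "(W, \<phi>) \<in> trivs E" "x \<in> W" shows "triv_fibre E \<phi> x"
proof -
  have *: "\<forall>(U, \<phi>)\<in>trivs E. openin (topo X) U \<and>
        (\<forall>x\<in>U. bij_betw \<phi> (fibre E x) (cspace (vrank E)) \<and>
           (\<forall>u\<in>fibre E x. \<forall>v\<in>fibre E x. \<phi> (vadd E u v) = (\<lambda>i. \<phi> u i + \<phi> v i)) \<and>
           (\<forall>u\<in>fibre E x. \<forall>c. \<phi> (smul E c u) = (\<lambda>i. c * \<phi> u i)))"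
    using vb unfolding holomorphic_vector_bundle_def by (elim conjE)
  have **: "\<forall>x\<in>topspace (topo X). \<forall>u\<in>fibre E x.
        (\<forall>v\<in>fibre E x. vadd E u v \<in> fibre E x) \<and> (\<forall>c. smul E c u \<in> fibre E x)"
    using vb unfolding holomorphic_vector_bundle_def by (elim conjE)
  show ?thesis
    using bspec[OF * assms(1)] bspec[OF ** triv_subset[OF assms]] assms(2)
    by unfold_locales simp_all
qed

lemma transition:
  assumes "(U, \<phi>) \<in> trivs E" "(V, \<theta>) \<in> trivs E" "x \<in> U" "x \<in> V"
  obtains g where "\<And>e i. e \<in> fibre E x \<Longrightarrow> i < r \<Longrightarrow> \<theta> e i = (\<Sum>j<r. g (i, j) * \<phi> e j)"
proof -
  have *: "\<forall>(U, \<phi>)\<in>trivs E. \<forall>(V, \<theta>)\<in>trivs E.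
        \<exists>g :: 'x \<Rightarrow> nat \<Rightarrow> nat \<Rightarrow> complex.
          (\<forall>i<vrank E. \<forall>j<vrank E. holo_fun X (U \<inter> V) (\<lambda>x. g x i j)) \<and>
          (\<forall>x\<in>U \<inter> V. \<forall>e\<in>fibre E x. \<forall>i<vrank E.
             \<theta> e i = (\<Sum>j<vrank E. g x i j * \<phi> e j))"
    using vb unfolding holomorphic_vector_bundle_def by (elim conjE)
  from bspec[OF bspec[OF * assms(1), unfolded prod.case] assms(2), unfolded prod.case]
  obtain g where "\<forall>x\<in>U \<inter> V. \<forall>e\<in>fibre E x. \<forall>i<vrank E.
             \<theta> e i = (\<Sum>j<vrank E. g x i j * \<phi> e j)" by (elim exE conjE)
  then have "\<theta> e i = (\<Sum>j<r. (\<lambda>(i, j). g x i j) (i, j) * \<phi> e j)" if "e \<in> fibre E x" "i < r" for e i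
    using that assms(3,4) by simp
  then show ?thesis by (rule that)
qed

lemma chart_props:
  assumes "(U, \<psi>) \<in> charts X"
  shows "openin (topo X) U"
    and "openin (top_of_set (cspace n)) (\<psi> ` U)"
    and "homeomorphic_map (subtopology (topo X) U) (top_of_set (\<psi> ` U)) \<psi>"
    and "inj_on \<psi> U"
    and "\<And>x i. x \<in> U \<Longrightarrow> n \<le> i \<Longrightarrow> \<psi> x i = 0"
proof -
  have *: "\<forall>(U, \<psi>)\<in>charts X.
        openin (topo X) U \<and>
        openin (top_of_set (cspace (cdim X))) (\<psi> ` U) \<and>
        homeomorphic_map (subtopology (topo X) U) (top_of_set (\<psi> ` U)) \<psi>"
    using mf unfolding complex_manifold_def by (elim conjE)
  from bspec[OF * assms] show 1: "openin (topo X) U"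
    and 2: "openin (top_of_set (cspace n)) (\<psi> ` U)"
    and 3: "homeomorphic_map (subtopology (topo X) U) (top_of_set (\<psi> ` U)) \<psi>"
    by simp_all
  have "topspace (subtopology (topo X) U) = U" using openin_subset[OF 1] by auto
  then show "inj_on \<psi> U" using homeomorphic_imp_injective_map[OF 3] by simp
  have "\<psi> ` U \<subseteq> cspace n" using openin_subset[OF 2] by simp
  then show "\<And>x i. x \<in> U \<Longrightarrow> n \<le> i \<Longrightarrow> \<psi> x i = 0" by (auto simp: cspace_def)
qed

lemma chart_ex: "x \<in> topspace (topo X) \<Longrightarrow> \<exists>U \<psi>. (U, \<psi>) \<in> charts X \<and> x \<in> U"
  using mf unfolding complex_manifold_def by auto

text \<open>The functional that \<open>l\<close> induces on the quotient by its own kernel. The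
  representative picked by \<open>SOME\<close> is immaterial, as \<open>l\<close> is constant on
  cosets of the kernel; see \<open>quot_apply\<close>.\<close>

definition quot :: "'x \<Rightarrow> ('e \<Rightarrow> complex) \<Rightarrow> ('x \<times> 'e set) \<times> 'e set \<Rightarrow> complex" where
  "quot x l = (\<lambda>q\<in>fibre TB (x, kern E x l). l (SOME u. u \<in> snd q))"

lemma fibre_taut:
  assumes "(x, H) \<in> proj_points X E"
  shows "fibre TB (x, H) = (\<lambda>u. ((x, H), coset E H u)) ` fibre E x"
  using assms by (auto simp: fibre_def taut_bundle_def)

lemma std_open_iff:
  "(x, H) \<in> std_open X E W \<phi> a \<longleftrightarrow> (x, H) \<in> proj_points X E \<and> x \<in> W \<and> frame E \<phi> x a \<notin> H"
  by (simp add: std_open_def)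

context
  fixes W \<phi> x assumes W: "(W, \<phi>) \<in> trivs E" and x: "x \<in> W"
begin

interpretation tf: triv_fibre E \<phi> x by (rule triv_fibre[OF W x])

lemma kern_proj_point:
  assumes "l \<in> dual E x" "v \<in> fibre E x" "l v \<noteq> 0"
  shows "(x, kern E x l) \<in> proj_points X E"
  using tf.hyperplane_kern[OF assms] triv_subset[OF W x] by (simp add: proj_points_def)

lemma quot_apply:
  assumes l: "l \<in> dual E x" "v \<in> fibre E x" "l v \<noteq> 0" and u: "u \<in> fibre E x"
  shows "quot x l ((x, kern E x l), coset E (kern E x l) u) = l u"
proof -
  have "u \<in> coset E (kern E x l) u" using tf.coset_kern[OF l(1) u] u by simp
  then have "(SOME w. w \<in> coset E (kern E x l) u) \<in> coset E (kern E x l) u" by (rule someI)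
  then have "l (SOME w. w \<in> coset E (kern E x l) u) = l u" using tf.coset_kern[OF l(1) u] by simp
  then show ?thesis using u by (simp add: quot_def fibre_taut[OF kern_proj_point[OF l]])
qed

lemma taut_vadd:
  assumes l: "l \<in> dual E x" and u: "u \<in> fibre E x" "w \<in> fibre E x"
  shows "vadd TB ((x, kern E x l), coset E (kern E x l) u) ((x, kern E x l), coset E (kern E x l) w)
    = ((x, kern E x l), coset E (kern E x l) (vadd E u w))"
proof -
  have "{vadd E c d | c d. c \<in> {v \<in> fibre E x. l v = l u} \<and> d \<in> {v \<in> fibre E x. l v = l w}}
    = {v \<in> fibre E x. l v = l (vadd E u w)}" (is "?L = ?R")
  proof (intro Set.set_eqI iffI)
    fix v assume "v \<in> ?L"
    then show "v \<in> ?R" using l u by (auto simp: tf.add_closed dual_add)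
  next
    fix v assume v: "v \<in> ?R"
    let ?d = "vadd E v (smul E (-1) u)"
    have "v = vadd E u ?d"
      by (rule tf.eqI) (use v u in \<open>auto simp: tf.add_closed tf.smul_closed tf.\<phi>_add tf.\<phi>_smul\<close>)
    moreover have "?d \<in> {v \<in> fibre E x. l v = l w}"
      using v u l by (simp add: tf.add_closed tf.smul_closed dual_add dual_smul)
    ultimately show "v \<in> ?L" using u by blast
  qed
  then show ?thesis using tf.coset_kern[OF l] u tf.add_closed[OF u] by (simp add: taut_bundle_def)
qed

lemma taut_smul:
  assumes l: "l \<in> dual E x" and u: "u \<in> fibre E x"
  shows "smul TB z ((x, kern E x l), coset E (kern E x l) u)
    = ((x, kern E x l), coset E (kern E x l) (smul E z u))"
proof -
  have "{vadd E (smul E z c) h | c h. c \<in> {v \<in> fibre E x. l v = l u} \<and> h \<in> kern E x l}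
    = {v \<in> fibre E x. l v = l (smul E z u)}" (is "?L = ?R")
  proof (intro Set.set_eqI iffI)
    fix v assume "v \<in> ?L"
    then show "v \<in> ?R" using l u by (auto simp: tf.add_closed tf.smul_closed dual_add dual_smul kern_def)
  next
    fix v assume v: "v \<in> ?R"
    let ?d = "vadd E v (smul E (-z) u)"
    have "v = vadd E (smul E z u) ?d"
      by (rule tf.eqI) (use v u in \<open>auto simp: tf.add_closed tf.smul_closed tf.\<phi>_add tf.\<phi>_smul\<close>)
    moreover have "?d \<in> kern E x l"
      using v u l by (simp add: tf.add_closed tf.smul_closed dual_add dual_smul kern_def)
    ultimately show "v \<in> ?L" using u by blast
  qed
  then show ?thesis using tf.coset_kern[OF l] u tf.smul_closed[OF u] by (simp add: taut_bundle_def)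
qed

lemma quot_dual:
  assumes l: "l \<in> dual E x" "v \<in> fibre E x" "l v \<noteq> 0"
  shows "quot x l \<in> dual TB (x, kern E x l)"
  unfolding dual_def[of TB] fibre_taut[OF kern_proj_point[OF l]]
proof (intro CollectI conjI ballI allI)
  show "quot x l \<in> extensional ((\<lambda>u. ((x, kern E x l), coset E (kern E x l) u)) ` fibre E x)"
    by (simp add: quot_def fibre_taut[OF kern_proj_point[OF l]])
  fix q assume "q \<in> (\<lambda>u. ((x, kern E x l), coset E (kern E x l) u)) ` fibre E x"
  then obtain u where u: "u \<in> fibre E x" "q = ((x, kern E x l), coset E (kern E x l) u)" by auto
  show "quot x l (smul TB c q) = c * quot x l q" for c
    using u l by (simp add: taut_smul quot_apply tf.smul_closed dual_smul)
  fix q' assume "q' \<in> (\<lambda>u. ((x, kern E x l), coset E (kern E x l) u)) ` fibre E x"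
  then obtain w where w: "w \<in> fibre E x" "q' = ((x, kern E x l), coset E (kern E x l) w)" by auto
  show "quot x l (vadd TB q q') = quot x l q + quot x l q'"
    using u w l by (simp add: taut_vadd quot_apply tf.add_closed dual_add)
qed

text \<open>The tautological fibre is a line spanned by the class of \<open>v\<close>, since
  \<open>u\<close> and \<open>(l u / l v) v\<close> lie in the same coset.\<close>

lemma dual_taut_multiple:
  assumes l: "l \<in> dual E x" "v \<in> fibre E x" "l v \<noteq> 0" and k: "k \<in> dual TB (x, kern E x l)"
  obtains c where "k = (\<lambda>q\<in>fibre TB (x, kern E x l). c * quot x l q)"
proof
  let ?p = "(x, kern E x l)"
  let ?q = "\<lambda>u. (?p, coset E (kern E x l) u)"
  note fib = fibre_taut[OF kern_proj_point[OF l]]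
  show "k = (\<lambda>q\<in>fibre TB ?p. k (?q v) / l v * quot x l q)"
  proof (rule extensionalityI[of _ "fibre TB ?p"])
    show "k \<in> extensional (fibre TB ?p)" by (rule dual_ext[OF k])
    fix q assume q: "q \<in> fibre TB ?p"
    then obtain u where u: "u \<in> fibre E x" "q = ?q u" by (auto simp: fib)
    have sv: "smul E (l u / l v) v \<in> fibre E x" by (rule tf.smul_closed[OF l(2)])
    have "?q u = ?q (smul E (l u / l v) v)"
      using l sv u(1) by (simp add: tf.coset_kern dual_smul)
    also have "\<dots> = smul TB (l u / l v) (?q v)" by (rule taut_smul[OF l(1,2), symmetric])
    finally have "k q = l u / l v * k (?q v)"
      using dual_smul[OF k, of "?q v"] l(2) u(2) by (simp add: fib)
    then show "k q = (\<lambda>q\<in>fibre TB ?p. k (?q v) / l v * quot x l q) q"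
      using q u quot_apply[OF l u(1)] by simp
  qed simp
qed

end

end

lemma cmb_tail:
  assumes "j < r - 1" shows "cmb n r a z \<xi> (n + j) = \<xi> (skip a j)"
proof -
  have "\<not> n + j < n" "n + j < n + (r - 1)" "n + j - n = j" using assms by linarith+
  then show ?thesis by (simp only: cmb_def if_False if_True)
qed

context holo_bundle
begin

text \<open>The form on the dual fibre defined by a section of the \<open>m\<close>-th power of the tautological quotient: its value
  at \<open>(x, ker l)\<close> is evaluated on the functional that \<open>l\<close> induces on the quotient.\<close>

definition sev :: "nat \<Rightarrow> ('x \<times> 'e set \<Rightarrow> ('x \<times> 'e set) \<times> ((nat \<Rightarrow> ('x \<times> 'e set) \<times> 'e set \<Rightarrow> complex) \<Rightarrow> complex))
    \<Rightarrow> 'x \<Rightarrow> ('e \<Rightarrow> complex) \<Rightarrow> complex" where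
  "sev m s x l = (if \<exists>v\<in>fibre E x. l v \<noteq> 0 then snd (s (x, kern E x l)) (\<lambda>j\<in>{..<m}. quot x l) else 0)"

text \<open>A functional with kernel \<open>H\<close> is nonzero on the \<open>a\<close>-th frame
  vector, which lies outside \<open>H\<close>, and may be divided by its value there.\<close>

lemma std_open_normalise:
  assumes W: "(W, \<phi>) \<in> trivs E" "x \<in> W" and a: "a < r"
    and H: "(x, H) \<in> proj_points X E" "frame E \<phi> x a \<notin> H"
  obtains \<xi> where "\<xi> a = 1" "H = kern E x (covec E \<phi> x \<xi>)"
proof -
  interpret tf: triv_fibre E \<phi> x by (rule triv_fibre[OF W])
  have "hyperplane E x H" using H(1) by (simp add: proj_points_def)
  then obtain l v where l: "l \<in> dual E x" "H = kern E x l" "v \<in> fibre E x" "l v \<noteq> 0"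
    by (rule tf.hyperplane_is_kern)
  define la where "la = l (frame E \<phi> x a)"
  have la: "la \<noteq> 0" using H(2) tf.frame(1)[OF a] by (simp add: l(2) kern_def la_def)
  define \<xi> where "\<xi> i = l (frame E \<phi> x i) / la" for i
  have "covec E \<phi> x \<xi> u = l u / la" if "u \<in> fibre E x" for u
    using tf.dual_expand[OF l(1) that] that by (simp add: covec_def \<xi>_def sum_divide_distrib)
  then have "H = kern E x (covec E \<phi> x \<xi>)" using la unfolding l(2) kern_def by auto
  moreover have "\<xi> a = 1" using la by (simp add: \<xi>_def la_def)
  ultimately show ?thesis using that by blast
qed

lemma proj_point_covec:
  assumes W: "(W, \<phi>) \<in> trivs E" "x \<in> W" and a: "a < r" "\<xi> a \<noteq> 0"
  shows "(x, kern E x (covec E \<phi> x \<xi>)) \<in> std_open X E W \<phi> a"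
    and "\<exists>v\<in>fibre E x. covec E \<phi> x \<xi> v \<noteq> 0"
proof -
  interpret tf: triv_fibre E \<phi> x by (rule triv_fibre[OF W])
  have fr: "frame E \<phi> x a \<in> fibre E x" "covec E \<phi> x \<xi> (frame E \<phi> x a) \<noteq> 0"
    using tf.frame(1) tf.covec_frame a by auto
  then show "\<exists>v\<in>fibre E x. covec E \<phi> x \<xi> v \<noteq> 0" by blast
  show "(x, kern E x (covec E \<phi> x \<xi>)) \<in> std_open X E W \<phi> a"
    using kern_proj_point[OF W tf.covec_dual fr] W(2) fr by (simp add: std_open_iff kern_def)
qed

lemma proj_chart_covec:
  assumes W: "(W, \<phi>) \<in> trivs E" "x \<in> W" and a: "a < r" "\<xi> a = 1"
  shows "proj_chart X E \<psi> \<phi> a (x, kern E x (covec E \<phi> x \<xi>)) = cmb n r a (\<psi> x) \<xi>"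
proof
  interpret tf: triv_fibre E \<phi> x by (rule triv_fibre[OF W])
  fix i
  show "proj_chart X E \<psi> \<phi> a (x, kern E x (covec E \<phi> x \<xi>)) i = cmb n r a (\<psi> x) \<xi> i"
  proof (cases "i < n \<or> n + (r - 1) \<le> i")
    case True
    then show ?thesis by (auto simp: proj_chart_def cmb_def)
  next
    case False
    then have "i - n < r - 1" by linarith
    then have b: "skip a (i - n) < r" by (rule skip_less[OF a(1)])
    have "coset_coord E \<phi> x a (coset E (kern E x (covec E \<phi> x \<xi>)) (frame E \<phi> x (skip a (i - n)))) = \<xi> (skip a (i - n))"
      using tf.coset_coord_kern[of a \<xi>, OF a(1) _ tf.frame(1)[OF b]] tf.covec_frame[OF b] a(2) by simp
    then show ?thesis using False by (simp add: proj_chart_def cmb_def skip_def Let_def)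
  qed
qed

text \<open>Holomorphy on a manifold is phrased with \<open>inv_into\<close>, so injectivity is what
  allows a section to be evaluated at a point prescribed by its coordinates.\<close>

lemma proj_chart_inj:
  assumes U: "(U, \<psi>) \<in> charts X" and W: "(W, \<phi>) \<in> trivs E" and a: "a < r"
  shows "inj_on (proj_chart X E \<psi> \<phi> a) (std_open X E (U \<inter> W) \<phi> a)"
proof (rule inj_onI)
  fix p p' assume p: "p \<in> std_open X E (U \<inter> W) \<phi> a" and p': "p' \<in> std_open X E (U \<inter> W) \<phi> a"
    and eq: "proj_chart X E \<psi> \<phi> a p = proj_chart X E \<psi> \<phi> a p'"
  obtain x H where pH: "p = (x, H)" by (cases p)
  obtain x' H' where pH': "p' = (x', H')" by (cases p')
  have x: "x \<in> U" "x \<in> W" "(x, H) \<in> proj_points X E" "frame E \<phi> x a \<notin> H"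
    using p by (auto simp: pH std_open_iff)
  have x': "x' \<in> U" "x' \<in> W" "(x', H') \<in> proj_points X E" "frame E \<phi> x' a \<notin> H'"
    using p' by (auto simp: pH' std_open_iff)
  obtain \<xi> where \<xi>: "\<xi> a = 1" "H = kern E x (covec E \<phi> x \<xi>)"
    using std_open_normalise[OF W x(2) a x(3,4)] .
  obtain \<eta> where \<eta>: "\<eta> a = 1" "H' = kern E x' (covec E \<phi> x' \<eta>)"
    using std_open_normalise[OF W x'(2) a x'(3,4)] .
  have e: "cmb n r a (\<psi> x) \<xi> = cmb n r a (\<psi> x') \<eta>"
    using eq proj_chart_covec[where a=a and \<xi>=\<xi> and \<psi>=\<psi>, OF W x(2) a \<xi>(1)] proj_chart_covec[where a=a and \<xi>=\<eta> and \<psi>=\<psi>, OF W x'(2) a \<eta>(1)]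
    by (simp add: pH pH' \<xi>(2) \<eta>(2))
  have "\<psi> x = \<psi> x'"
  proof
    fix i
    show "\<psi> x i = \<psi> x' i"
      using fun_cong[OF e, of i] chart_props(5)[OF U x(1), of i] chart_props(5)[OF U x'(1), of i]
      by (cases "i < n") (simp_all add: cmb_def)
  qed
  then have xx: "x = x'" using inj_onD[OF chart_props(4)[OF U] _ x(1) x'(1)] by simp
  interpret tf: triv_fibre E \<phi> x by (rule triv_fibre[OF W x(2)])
  have "\<xi> b = \<eta> b" if b: "b < r" for b
  proof (cases "b = a")
    case False
    obtain j where j: "j < r - 1" "skip a j = b" using skip_surj[OF b False a] by blast
    show ?thesis using fun_cong[OF e, of "n + j"] unfolding cmb_tail[OF j(1)] j(2) .
  qed (simp add: \<xi>(1) \<eta>(1))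
  then have "covec E \<phi> x \<xi> = covec E \<phi> x \<eta>" by (rule tf.covec_cong)
  then show "p = p'" by (simp add: pH pH' \<xi>(2) \<eta>(2) xx)
qed

lemma proj_chartsI:
  assumes "(U, \<psi>) \<in> charts X" "(W, \<phi>) \<in> trivs E" "a < r"
  shows "(std_open X E (U \<inter> W) \<phi> a, proj_chart X E \<psi> \<phi> a) \<in> proj_charts X E"
  unfolding proj_charts_def by (intro CollectI exI conjI) (rule refl, fact+)

text \<open>Some frame vector lies outside the hyperplane, which puts the point into a chart domain;
  the whole domain is one of the generating open sets, with \<open>V\<close> all of affine space.
  Sections and base point freeness say something only over the topological space, hence the need for
  this.\<close>

lemma proj_points_topspace:
  assumes "p \<in> proj_points X E" shows "p \<in> topspace (topo PB)"
proof -
  obtain x H where p: "p = (x, H)" by (cases p)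
  have "x \<in> topspace (topo X)" using assms by (simp add: p proj_points_def)
  then obtain W \<phi> U \<psi> where W: "(W, \<phi>) \<in> trivs E" "x \<in> W" and U: "(U, \<psi>) \<in> charts X" "x \<in> U"
    using triv_ex chart_ex by metis
  interpret tf: triv_fibre E \<phi> x by (rule triv_fibre[OF W])
  have "hyperplane E x H" using assms by (simp add: p proj_points_def)
  then obtain l v where l: "l \<in> dual E x" "H = kern E x l" "v \<in> fibre E x" "l v \<noteq> 0"
    by (rule tf.hyperplane_is_kern)
  obtain a where a: "a < r" "l (frame E \<phi> x a) \<noteq> 0"
  proof (rule ccontr)
    assume "\<not> thesis"
    then have "l (frame E \<phi> x i) = 0" if "i < r" for i using that \<open>\<And>a. a < r \<Longrightarrow> l (frame E \<phi> x a) \<noteq> 0 \<Longrightarrow> thesis\<close> by blast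
    then have "l v = 0" using tf.dual_expand[OF l(1,3)] by simp
    then show False using l(4) by simp
  qed
  have pD: "p \<in> std_open X E (U \<inter> W) \<phi> a"
    using assms W U a by (simp add: p std_open_iff l(2) kern_def)
  have V: "openin (top_of_set (cspace (n + (r - 1)))) (cspace (n + (r - 1)))"
    using openin_topspace[of "top_of_set (cspace (n + (r - 1)))"] by simp
  have \<kappa>: "proj_chart X E \<psi> \<phi> a p \<in> cspace (n + (r - 1))"
    by (simp add: proj_chart_def cspace_def p)
  have ch: "(std_open X E (U \<inter> W) \<phi> a, proj_chart X E \<psi> \<phi> a) \<in> proj_charts X E"
    by (rule proj_chartsI[OF U(1) W(1) a(1)])
  define S where "S = {{p \<in> D. \<kappa> p \<in> V} | D \<kappa> V. (D, \<kappa>) \<in> proj_charts X E \<and>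
         openin (top_of_set (cspace (n + (r - 1)))) V}"
  have "{p \<in> std_open X E (U \<inter> W) \<phi> a. proj_chart X E \<psi> \<phi> a p \<in> cspace (n + (r - 1))} \<in> S"
    unfolding S_def
    by (intro CollectI exI[of _ "std_open X E (U \<inter> W) \<phi> a"] exI[of _ "proj_chart X E \<psi> \<phi> a"]
        exI[of _ "cspace (n + (r - 1))"] conjI refl ch V)
  then have "p \<in> \<Union>S" by (rule UnionI) (simp only: mem_Collect_eq pD \<kappa> simp_thms)
  moreover have "topspace (topo PB) = \<Union>S"
    by (simp only: S_def proj_bundle_def cmfd.select_convs topology_generated_by_topspace)
  ultimately show ?thesis by (simp only:)
qed

lemma section_tensor:
  assumes hs: "holomorphic_section PB (line_power PB TB m) s" and p: "p \<in> proj_points X E"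
  shows "s p = (p, snd (s p))" "snd (s p) \<in> tensors TB m p"
proof -
  have "s p \<in> fibre (line_power PB TB m) p"
    using hs proj_points_topspace[OF p] by (simp add: holomorphic_section_def)
  then have "s p \<in> {(x, t). x \<in> topspace (topo PB) \<and> t \<in> tensors TB m x} \<and> fst (s p) = p"
    by (simp add: fibre_def line_power_def)
  then show "s p = (p, snd (s p))" "snd (s p) \<in> tensors TB m p" by auto
qed

text \<open>A nonzero multiple of \<open>l\<close> has the same kernel, hence gives the same point
  of the projective bundle, and induces \<open>c\<close> times the functional on the quotient. For
  \<open>c = 0\<close> or \<open>l = 0\<close> both sides vanish, because \<open>m > 0\<close> and
  \<open>sev\<close> is 0 at the zero functional.\<close>

lemma sev_scale:
  assumes hs: "holomorphic_section PB (line_power PB TB m) s" and m: "m > 0"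
    and W: "(W, \<phi>) \<in> trivs E" "x \<in> W" and l: "l \<in> dual E x"
  shows "sev m s x (\<lambda>e\<in>fibre E x. c * l e) = c ^ m * sev m s x l"
proof (cases "c \<noteq> 0 \<and> (\<exists>v\<in>fibre E x. l v \<noteq> 0)")
  case False
  then show ?thesis using m by (auto simp: sev_def)
next
  case True
  then obtain v where v: "v \<in> fibre E x" "l v \<noteq> 0" and c: "c \<noteq> 0" by blast
  interpret tf: triv_fibre E \<phi> x by (rule triv_fibre[OF W])
  define k where "k = (\<lambda>e\<in>fibre E x. c * l e)"
  have k: "k \<in> dual E x" unfolding dual_def k_def
    using l by (simp add: tf.add_closed tf.smul_closed dual_add dual_smul distrib_left)
  have kv: "k v \<noteq> 0" using v c by (simp add: k_def)
  have kern: "kern E x k = kern E x l" using c by (auto simp: kern_def k_def)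
  let ?p = "(x, kern E x l)"
  note pp = kern_proj_point[OF W l v]
  have q: "quot x k = (\<lambda>e\<in>fibre TB ?p. c * quot x l e)"
  proof (rule extensionalityI[of _ "fibre TB ?p"])
    show "quot x k \<in> extensional (fibre TB ?p)" by (simp add: quot_def kern)
    fix e assume e: "e \<in> fibre TB ?p"
    then obtain u where u: "u \<in> fibre E x" "e = (?p, coset E (kern E x l) u)"
      by (auto simp: fibre_taut[OF pp])
    have "quot x k e = k u" using quot_apply[OF W k v(1) kv u(1)] by (simp add: kern u(2))
    moreover have "quot x l e = l u" using quot_apply[OF W l v u(1)] by (simp add: u(2))
    ultimately show "quot x k e = (\<lambda>e\<in>fibre TB ?p. c * quot x l e) e" using u(1) e by (simp add: k_def)
  qed simp
  have "snd (s ?p) (\<lambda>j\<in>{..<m}. quot x k) = (\<Prod>j<m. c) * snd (s ?p) (\<lambda>j\<in>{..<m}. quot x l)"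
  proof (rule tensors_multilinear[OF section_tensor(2)[OF hs pp] quot_dual[OF W l v]])
    show "(\<lambda>j\<in>{..<m}. quot x k) \<in> {..<m} \<rightarrow>\<^sub>E dual TB ?p"
      using quot_dual[OF W k v(1) kv] by (intro restrict_PiE_iff[THEN iffD2] ballI) (simp only: kern)
    show "(\<lambda>j\<in>{..<m}. quot x k) j = (\<lambda>e\<in>fibre TB ?p. c * quot x l e)" if "j < m" for j
      using that by (simp only: q lessThan_iff restrict_apply if_True)
  qed
  moreover have "sev m s x k = snd (s ?p) (\<lambda>j\<in>{..<m}. quot x k)"
    using v(1) kv by (auto simp: sev_def kern)
  moreover have "sev m s x l = snd (s ?p) (\<lambda>j\<in>{..<m}. quot x l)"
    using v by (auto simp: sev_def)
  ultimately show ?thesis by (simp add: k_def)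
qed

text \<open>A nonzero tensor on a line is nonzero on some tuple of functionals; all of these are
  multiples of \<open>quot x l\<close>, so it is nonzero at \<open>quot x l\<close>
  repeated.\<close>

lemma sev_nonzero:
  assumes bpf: "base_point_free PB (line_power PB TB m)"
    and W: "(W, \<phi>) \<in> trivs E" "x \<in> W" and l: "l \<in> dual E x" and v: "v \<in> fibre E x" "l v \<noteq> 0"
  obtains s where "holomorphic_section PB (line_power PB TB m) s" "sev m s x l \<noteq> 0"
proof -
  let ?p = "(x, kern E x l)"
  note pp = kern_proj_point[OF W l v]
  obtain s where hs: "holomorphic_section PB (line_power PB TB m) s"
    and nz: "s ?p \<noteq> smul (line_power PB TB m) 0 (s ?p)"
    using bpf proj_points_topspace[OF pp] unfolding base_point_free_def by blast
  note st = section_tensor[OF hs pp]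
  define t where "t = snd (s ?p)"
  have sp: "s ?p = (?p, t)" and t: "t \<in> tensors TB m ?p" using st by (simp_all add: t_def)
  have "smul (line_power PB TB m) 0 (s ?p) = (?p, \<lambda>w\<in>{..<m} \<rightarrow>\<^sub>E dual TB ?p. 0)"
    by (simp add: line_power_def tensor_smul_def sp)
  then have tn: "t \<noteq> (\<lambda>w\<in>{..<m} \<rightarrow>\<^sub>E dual TB ?p. 0)" using nz sp by simp
  have tE: "t \<in> extensional ({..<m} \<rightarrow>\<^sub>E dual TB ?p)" using t unfolding tensors_def by blast
  have "\<exists>w\<in>{..<m} \<rightarrow>\<^sub>E dual TB ?p. t w \<noteq> 0"
  proof (rule ccontr)
    assume *: "\<not> (\<exists>w\<in>{..<m} \<rightarrow>\<^sub>E dual TB ?p. t w \<noteq> 0)"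
    have "t = (\<lambda>w\<in>{..<m} \<rightarrow>\<^sub>E dual TB ?p. 0)"
      by (rule extensionalityI[OF tE]) (use * in \<open>simp_all\<close>)
    then show False using tn by simp
  qed
  then obtain w where w: "w \<in> {..<m} \<rightarrow>\<^sub>E dual TB ?p" "t w \<noteq> 0" by (rule bexE)
  have "\<forall>j. \<exists>c. j < m \<longrightarrow> w j = (\<lambda>q\<in>fibre TB ?p. c * quot x l q)"
  proof
    fix j
    show "\<exists>c. j < m \<longrightarrow> w j = (\<lambda>q\<in>fibre TB ?p. c * quot x l q)"
    proof (cases "j < m")
      case True
      then have "w j \<in> dual TB ?p" using PiE_mem[OF w(1), of j] by simp
      then obtain c where "w j = (\<lambda>q\<in>fibre TB ?p. c * quot x l q)" by (rule dual_taut_multiple[OF W l v])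
      then show ?thesis by (intro exI impI)
    qed simp
  qed
  from choice[OF this] obtain c where c: "\<forall>j. j < m \<longrightarrow> w j = (\<lambda>q\<in>fibre TB ?p. c j * quot x l q)"
    by (rule exE)
  have "t w = (\<Prod>j<m. c j) * t (\<lambda>j\<in>{..<m}. quot x l)"
    by (rule tensors_multilinear[OF t quot_dual[OF W l v] w(1)]) (rule c[rule_format])
  then have "t (\<lambda>j\<in>{..<m}. quot x l) \<noteq> 0" using w(2) by (metis mult_zero_right)
  moreover have "sev m s x l = t (\<lambda>j\<in>{..<m}. quot x l)"
    unfolding sev_def t_def using v by (intro if_P) (rule bexI)
  ultimately have "sev m s x l \<noteq> 0" by (simp only: not_False_eq_True)
  then show ?thesis by (rule that[OF hs])
qed

text \<open>The link between \<open>sev\<close> and the holomorphy of a section. Under the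
  normalisation \<open>\<xi> a = 1\<close> the local frame of the tautological dual is exactly
  \<open>quot x\<close> of the covector, so the local coordinate of the section is
  \<open>sev\<close> without any correcting factor.\<close>

lemma section_in_chart:
  assumes hs: "holomorphic_section PB (line_power PB TB m) s"
    and U: "(U, \<psi>) \<in> charts X" and W: "(W, \<phi>) \<in> trivs E" and a: "a < r"
  obtains Z \<sigma> where "holo_on (n + (r - 1)) Z \<sigma>"
    and "\<And>x \<xi>. x \<in> U \<Longrightarrow> x \<in> W \<Longrightarrow> \<xi> a = 1 \<Longrightarrow> cmb n r a (\<psi> x) \<xi> \<in> Z"
    and "\<And>x \<xi>. x \<in> U \<Longrightarrow> x \<in> W \<Longrightarrow> \<xi> a = 1 \<Longrightarrow>
      \<sigma> (cmb n r a (\<psi> x) \<xi>) = sev m s x (covec E \<phi> x \<xi>)"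
proof -
  define D where "D = std_open X E (U \<inter> W) \<phi> a"
  define \<kappa> where "\<kappa> = proj_chart X E \<psi> \<phi> a"
  define \<Phi> :: "('x \<times> 'e set) \<times> 'e set \<Rightarrow> nat \<Rightarrow> complex" where "\<Phi> = (\<lambda>((x, H), C) i::nat. if i = 0 then coset_coord E \<phi> x a C else 0)"
  define \<Theta> :: "('x \<times> 'e set) \<times> ((nat \<Rightarrow> ('x \<times> 'e set) \<times> 'e set \<Rightarrow> complex) \<Rightarrow> complex) \<Rightarrow> nat \<Rightarrow> complex"
    where "\<Theta> = (\<lambda>(p, t) i. if i = 0 then t (\<lambda>j\<in>{..<m}. coord_form TB \<Phi> p 0) else 0)"
  have tT: "(std_open X E W \<phi> a, \<Phi>) \<in> trivs TB"
    unfolding taut_bundle_def \<Phi>_def vbundle.select_convs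
    by (intro CollectI exI conjI) (rule refl, fact+)
  then have tL: "(std_open X E W \<phi> a, \<Theta>) \<in> trivs (line_power PB TB m)"
    unfolding line_power_def \<Theta>_def vbundle.select_convs by (rule rev_image_eqI) (simp only: prod.case)
  have cP: "(D, \<kappa>) \<in> charts PB"
    using proj_chartsI[OF U W a] by (simp add: proj_bundle_def D_def \<kappa>_def)
  have "\<forall>(U, \<phi>)\<in>trivs (line_power PB TB m). \<forall>i<vrank (line_power PB TB m).
      holo_fun PB U (\<lambda>x. \<phi> (s x) i)"
    using hs unfolding holomorphic_section_def by (elim conjE)
  from bspec[OF this tL, unfolded prod.case, rule_format, of 0]
  have "holo_fun PB (std_open X E W \<phi> a) (\<lambda>p. \<Theta> (s p) 0)" by (simp add: line_power_def)
  then have "\<forall>(V, \<theta>)\<in>charts PB. holo_on (cdim PB) (\<theta> ` (V \<inter> std_open X E W \<phi> a))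
      (\<lambda>z. \<Theta> (s (inv_into V \<theta> z)) 0)" unfolding holo_fun_def .
  from bspec[OF this cP, unfolded prod.case]
  have h: "holo_on (n + (r - 1)) (\<kappa> ` (D \<inter> std_open X E W \<phi> a)) (\<lambda>z. \<Theta> (s (inv_into D \<kappa> z)) 0)"
    by (simp add: proj_bundle_def)
  show ?thesis
  proof (rule that[OF h])
    fix x and \<xi> :: "nat \<Rightarrow> complex" assume x: "x \<in> U" "x \<in> W" and \<xi>: "\<xi> a = 1"
    let ?l = "covec E \<phi> x \<xi>"
    let ?p = "(x, kern E x ?l)"
    interpret tf: triv_fibre E \<phi> x by (rule triv_fibre[OF W x(2)])
    have nz: "\<xi> a \<noteq> 0" using \<xi> by simp
    note pp = proj_point_covec[where a=a and \<xi>=\<xi>, OF W x(2) a nz]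
    have fr: "frame E \<phi> x a \<in> fibre E x" by (rule tf.frame(1)[OF a])
    have lfr: "?l (frame E \<phi> x a) \<noteq> 0" unfolding tf.covec_frame[OF a] by (rule nz)
    have pD2: "?p \<in> std_open X E W \<phi> a" by (rule pp(1))
    have ppt: "?p \<in> proj_points X E" using pD2 unfolding std_open_iff by (elim conjE)
    have frk: "frame E \<phi> x a \<notin> kern E x ?l" using pD2 unfolding std_open_iff by (elim conjE)
    have pD: "?p \<in> D" unfolding D_def std_open_iff using x ppt frk by (intro conjI IntI)
    have \<kappa>p: "\<kappa> ?p = cmb n r a (\<psi> x) \<xi>" unfolding \<kappa>_def by (rule proj_chart_covec[where a=a and \<xi>=\<xi>, OF W x(2) a \<xi>])
    then show "cmb n r a (\<psi> x) \<xi> \<in> \<kappa> ` (D \<inter> std_open X E W \<phi> a)" using imageI[OF IntI[OF pD pD2], of \<kappa>] by (simp only:)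
    have inv: "inv_into D \<kappa> (cmb n r a (\<psi> x) \<xi>) = ?p"
      unfolding \<kappa>p[symmetric] using inv_into_f_f[OF proj_chart_inj[OF U W a] pD[unfolded D_def]] by (simp only: D_def \<kappa>_def)
    \<comment> \<open>Both functionals send the class of \<open>u\<close> to the value of the
      covector at \<open>u\<close>; the denominator \<open>\<xi> a\<close> of
      \<open>coset_coord_kern\<close> is 1.\<close>
    have cf: "coord_form TB \<Phi> ?p 0 = quot x ?l"
    proof (rule extensionalityI[of _ "fibre TB ?p"])
      show "coord_form TB \<Phi> ?p 0 \<in> extensional (fibre TB ?p)" by (simp add: coord_form_def)
      show "quot x ?l \<in> extensional (fibre TB ?p)" by (simp add: quot_def)
      fix e assume e: "e \<in> fibre TB ?p"
      then obtain u where u: "u \<in> fibre E x" "e = (?p, coset E (kern E x ?l) u)"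
        by (auto simp: fibre_taut[OF ppt])
      have "coord_form TB \<Phi> ?p 0 e = ?l u"
        using e tf.coset_coord_kern[of a \<xi>, OF a nz u(1)] by (simp add: coord_form_def \<Phi>_def u(2) \<xi>)
      then show "coord_form TB \<Phi> ?p 0 e = quot x ?l e"
        using quot_apply[OF W x(2) tf.covec_dual fr lfr u(1)] by (simp add: u(2))
    qed
    have "\<Theta> (s ?p) 0 = snd (s ?p) (\<lambda>j\<in>{..<m}. quot x ?l)"
      unfolding \<Theta>_def cf[symmetric] by (subst section_tensor(1)[OF hs ppt]) (simp only: prod.case if_True simp_thms)
    also have "\<dots> = sev m s x ?l" unfolding sev_def using pp(2) by (simp only: if_True)
    finally show "\<Theta> (s (inv_into D \<kappa> (cmb n r a (\<psi> x) \<xi>))) 0 = sev m s x ?l" unfolding inv .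
  qed
qed

end

section \<open>Sections as forms on the dual fibres\<close>

text \<open>Interpolation at nodes that do not depend on \<open>f\<close>: for a function of several
  variables, the values at the nodes still depend on the other variables, and can be treated in
  turn.\<close>

lemma polynomial_root_of_unity_interpolation:
  fixes c :: "nat \<Rightarrow> complex" and m :: nat
  defines "N \<equiv> Suc m"
  defines "\<omega> \<equiv> exp (2 * of_real pi * \<i> / of_nat N) :: complex"
  assumes f: "\<And>t. f t = (\<Sum>k\<le>m. c k * t ^ k)"
  shows "f t = (\<Sum>j<N. (\<Sum>k\<le>m. \<omega> ^ (j * (N - k)) / of_nat N * t ^ k) * f (\<omega> ^ j))"
proof -
  have N: "N > 0" by (simp add: N_def)
  have c: "(\<Sum>j<N. \<omega> ^ (j * (N - k)) * f (\<omega> ^ j)) = of_nat N * c k" if "k \<le> m" for k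
    unfolding f N_def \<omega>_def by (rule coefficient_extraction[OF that])
  have "(\<Sum>j<N. (\<Sum>k\<le>m. \<omega> ^ (j * (N - k)) / of_nat N * t ^ k) * f (\<omega> ^ j)) =
    (\<Sum>j<N. \<Sum>k\<le>m. t ^ k / of_nat N * (\<omega> ^ (j * (N - k)) * f (\<omega> ^ j)))"
    unfolding sum_distrib_right by (intro sum.cong refl) (simp add: mult_ac)
  also have "\<dots> = (\<Sum>k\<le>m. t ^ k / of_nat N * (\<Sum>j<N. \<omega> ^ (j * (N - k)) * f (\<omega> ^ j)))"
    unfolding sum_distrib_left by (rule sum.swap)
  also have "\<dots> = (\<Sum>k\<le>m. c k * t ^ k)"
    by (intro sum.cong refl) (use N in \<open>simp add: c\<close>)
  finally show ?thesis unfolding f by simp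
qed

text \<open>Interpolation expresses the dependence on one variable by fixed polynomials and by the
  values where that variable is a root of unity. Releasing the variables one at a time from frozen
  values \<open>\<eta>\<close> gives a polynomial; the uniform degree bound \<open>m\<close> makes
  the same nodes work throughout.\<close>

lemma separately_polynomial:
  fixes F :: "(nat \<Rightarrow> complex) \<Rightarrow> complex"
  assumes dep: "\<And>\<xi> \<eta>. (\<And>i. i < r \<Longrightarrow> \<xi> i = \<eta> i) \<Longrightarrow> F \<xi> = F \<eta>"
    and pol: "\<And>i \<xi>. i < r \<Longrightarrow> \<exists>c. \<forall>t. F (\<xi>(i := t)) = (\<Sum>k\<le>m. c k * t ^ k)"
  shows "galg (coord {..<r}) 0 0 F"
proof -
  define N where "N = Suc m"
  define \<omega> :: complex where "\<omega> = exp (2 * of_real pi * \<i> / of_nat N)"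
  define K where "K j t = (\<Sum>k\<le>m. \<omega> ^ (j * (N - k)) / of_nat N * t ^ k)" for j and t :: complex
  have K: "galg (coord {..<r}) 0 0 (\<lambda>\<xi>. K j (\<xi> i))" if "i < r" for i j
  proof -
    have "galg (coord {..<r}) 0 0 (\<lambda>\<xi>. \<xi> i ^ k)" for k
      using galg_power[OF galg_coord[of i "{..<r}" 0], of k] that by simp
    then show ?thesis unfolding K_def by (intro galg_sum galg_scale)
  qed
  have "galg (coord {..<r}) 0 0 (\<lambda>\<xi>. F (\<lambda>i. if i < j then \<xi> i else \<eta> i))" if "j \<le> r" for j \<eta>
    using that
  proof (induction j arbitrary: \<eta>)
    case 0
    show ?case by (simp add: galg.const)
  next
    case (Suc j)
    have "F (\<lambda>i. if i < Suc j then \<xi> i else \<eta> i) =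
      (\<Sum>l<N. K l (\<xi> j) * F (\<lambda>i. if i < j then \<xi> i else (\<eta>(j := \<omega> ^ l)) i))" for \<xi>
    proof -
      define \<zeta> where "\<zeta> = (\<lambda>i. if i < j then \<xi> i else \<eta> i)"
      obtain c where c: "\<forall>t. F (\<zeta>(j := t)) = (\<Sum>k\<le>m. c k * t ^ k)" using pol[of j \<zeta>] Suc.prems by auto
      have "F (\<zeta>(j := \<xi> j)) = (\<Sum>l<N. K l (\<xi> j) * F (\<zeta>(j := \<omega> ^ l)))"
        unfolding K_def N_def \<omega>_def
        by (rule polynomial_root_of_unity_interpolation[of "\<lambda>t. F (\<zeta>(j := t))"]) (rule c[rule_format])
      moreover have "\<zeta>(j := \<xi> j) = (\<lambda>i. if i < Suc j then \<xi> i else \<eta> i)"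
        by (rule ext) (simp add: \<zeta>_def less_Suc_eq)
      moreover have "\<zeta>(j := t) = (\<lambda>i. if i < j then \<xi> i else (\<eta>(j := t)) i)" for t
        by (rule ext) (simp add: \<zeta>_def)
      ultimately show ?thesis by (simp only:)
    qed
    moreover have "galg (coord {..<r}) 0 0 (\<lambda>\<xi>. \<Sum>l<N. K l (\<xi> j) * F (\<lambda>i. if i < j then \<xi> i else (\<eta>(j := \<omega> ^ l)) i))"
    proof (rule galg_sum)
      fix l
      have "galg (coord {..<r}) 0 0 (\<lambda>\<xi>. F (\<lambda>i. if i < j then \<xi> i else (\<eta>(j := \<omega> ^ l)) i))"
        by (rule Suc.IH) (use Suc.prems in simp)
      then show "galg (coord {..<r}) 0 0 (\<lambda>\<xi>. K l (\<xi> j) * F (\<lambda>i. if i < j then \<xi> i else (\<eta>(j := \<omega> ^ l)) i))"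
        using galg_mult[OF K[of j l], of 0] Suc.prems by simp
    qed
    ultimately show ?case by (simp only:)
  qed
  from this[of r "\<lambda>_. 0"] have "galg (coord {..<r}) 0 0 (\<lambda>\<xi>. F (\<lambda>i. if i < r then \<xi> i else 0))" by simp
  moreover have "F (\<lambda>i. if i < r then \<xi> i else 0) = F \<xi>" for \<xi> by (rule dep) simp
  ultimately show ?thesis by (simp only:)
qed

text \<open>Scaling the argument by \<open>t\<close> and comparing coefficients of
  \<open>t ^ m\<close> leaves only the component of degree \<open>m\<close>.\<close>

lemma homogeneous_polynomial_form:
  assumes "galg (coord I) 0 0 F" and hom: "\<And>c \<xi>. F (\<lambda>i. c * \<xi> i) = c ^ m * F \<xi>"
  shows "form I m F"
proof -
  obtain N c where c: "\<forall>d. form I d (c d)" "\<forall>x. F x = (\<Sum>d<N. c d x)" "\<forall>d\<ge>N. c d = (\<lambda>x. 0)"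
    using galg_graded_decomp[OF assms(1), of 1] by (elim exE conjE)
  have "F \<xi> = c m \<xi>" for \<xi>
  proof -
    define p where "p = (\<Sum>d<N. Polynomial.monom (c d \<xi>) d)"
    have "poly (Polynomial.monom (F \<xi>) m) t = poly p t" for t
    proof -
      have "poly (Polynomial.monom (F \<xi>) m) t = F (\<lambda>i. t * \<xi> i)" by (simp add: hom poly_monom)
      also have "\<dots> = (\<Sum>d<N. t ^ d * c d \<xi>)"
      proof (rule trans[OF c(2)[rule_format]], rule sum.cong[OF refl])
        show "c d (\<lambda>i. t * \<xi> i) = t ^ d * c d \<xi>" for d by (rule form_homogeneous[OF c(1)[rule_format]])
      qed
      also have "\<dots> = poly p t" unfolding p_def poly_sum poly_monom by (simp add: mult.commute)
      finally show ?thesis .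
    qed
    then have eq: "Polynomial.monom (F \<xi>) m = p" by (intro poly_eq_poly_eq_iff[THEN iffD1] ext)
    have "F \<xi> = Polynomial.coeff p m" unfolding eq[symmetric] by simp
    also have "\<dots> = (\<Sum>d<N. if d = m then c m \<xi> else 0)"
      unfolding p_def Polynomial.coeff_sum Polynomial.coeff_monom by (rule sum.cong) auto
    also have "\<dots> = c m \<xi>" using c(3) by (cases "m < N") simp_all
    finally show ?thesis .
  qed
  then have "F = c m" by (rule ext)
  then show ?thesis using c(1) by simp
qed

text \<open>A homogeneous function which is holomorphic in each coordinate grows polynomially in
  each coordinate by homogeneity, so that Liouville's theorem applies.\<close>

lemma form_of_separately_holomorphic:
  fixes F :: "(nat \<Rightarrow> complex) \<Rightarrow> complex"
  assumes dep: "\<And>\<xi> \<eta>. (\<And>i. i < r \<Longrightarrow> \<xi> i = \<eta> i) \<Longrightarrow> F \<xi> = F \<eta>"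
    and hom: "\<And>c \<xi>. F (\<lambda>i. c * \<xi> i) = c ^ m * F \<xi>"
    and diff: "\<And>i \<xi> a t. i < r \<Longrightarrow> a < r \<Longrightarrow> a \<noteq> i \<Longrightarrow> \<xi> a \<noteq> 0 \<Longrightarrow>
      (\<lambda>t. F (\<xi>(i := t))) field_differentiable (at t)"
    and cont: "\<And>i \<xi>. i < r \<Longrightarrow> continuous_on UNIV (\<lambda>t. F ((\<lambda>j. t * \<xi> j)(i := 1)))"
  shows "form {..<r} m F"
proof (rule homogeneous_polynomial_form[OF separately_polynomial[where m=m] hom])
  show "F \<xi> = F \<eta>" if "\<And>i. i < r \<Longrightarrow> \<xi> i = \<eta> i" for \<xi> \<eta> by (rule dep[OF that])
  fix i \<xi> assume i: "i < r"
  define f where "f t = F (\<xi>(i := t))" for t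
  define g where "g u = F ((\<lambda>j. u * \<xi> j)(i := 1))" for u
  \<comment> \<open>Homogeneity trades large \<open>t\<close> for \<open>1 / t\<close> near 0, where
    the coordinate \<open>i\<close> is normalised to 1 and \<open>g\<close> is continuous.\<close>
  have fg: "f t = t ^ m * g (1 / t)" if "t \<noteq> 0" for t
  proof -
    have "\<xi>(i := t) = (\<lambda>j. t * ((\<lambda>j. 1 / t * \<xi> j)(i := 1)) j)" using that by (simp add: fun_eq_iff)
    then show ?thesis unfolding f_def g_def by (simp only: hom)
  qed
  \<comment> \<open>A nonzero coordinate other than \<open>i\<close> provides differentiability in
    \<open>t\<close>, also at \<open>t = 0\<close>. If there is none, \<open>f\<close> is a constant
    times \<open>t ^ m\<close> by homogeneity.\<close>
  have hol: "f holomorphic_on UNIV"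
  proof (cases "\<exists>a<r. a \<noteq> i \<and> \<xi> a \<noteq> 0")
    case True
    then obtain a where "a < r" "a \<noteq> i" "\<xi> a \<noteq> 0" by blast
    then have "f field_differentiable (at t)" for t unfolding f_def using diff[OF i, of a \<xi> t] by simp
    then show ?thesis by (auto simp: holomorphic_on_def field_differentiable_at_within)
  next
    case False
    have "f t = t ^ m * F (\<lambda>j. if j = i then 1 else 0)" for t
    proof -
      have "f t = F (\<lambda>j. t * (if j = i then 1 else 0))" unfolding f_def by (rule dep) (use False in auto)
      then show ?thesis by (simp only: hom)
    qed
    then have "f = (\<lambda>t. t ^ m * F (\<lambda>j. if j = i then 1 else 0))" by (rule ext)
    then show ?thesis by (auto intro!: holomorphic_intros)
  qed
  have "\<exists>A B. \<forall>t. A \<le> norm t \<longrightarrow> norm (f t) \<le> B * norm t ^ m"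
  proof -
    have "isCont g 0" using cont[OF i, of \<xi>] unfolding g_def
      by (simp add: continuous_on_eq_continuous_at)
    then have "0 < (1::real) \<longrightarrow> (\<exists>d>0. \<forall>u. dist u 0 < d \<longrightarrow> dist (g u) (g 0) < 1)"
      unfolding continuous_at_eps_delta by (rule spec)
    moreover have "0 < (1::real)" by simp
    ultimately have "\<exists>d>0. \<forall>u. dist u 0 < d \<longrightarrow> dist (g u) (g 0) < 1" by (rule mp)
    then obtain d where d: "d > 0" "\<forall>u. dist u 0 < d \<longrightarrow> dist (g u) (g 0) < 1" by (elim exE conjE)
    \<comment> \<open>The radius \<open>2 / d\<close> forces
      \<open>norm (1 / t) \<le> d / 2\<close>, strictly inside the disc where \<open>g\<close> stays
      within distance 1 of \<open>g 0\<close>.\<close>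
    have "norm (f t) \<le> (norm (g 0) + 1) * norm t ^ m" if "2 / d \<le> norm t" for t
    proof -
      have "0 < 2 / d" using d(1) by simp
      then have t: "t \<noteq> 0" "norm t > 0" using that by auto
      have "1 / norm t \<le> d / 2" using that d(1) t(2) by (simp add: field_simps)
      then have "norm (1 / t) < d" using d(1) by (simp add: norm_divide)
      then have "norm (g (1 / t) - g 0) < 1" using d(2)[rule_format, of "1 / t"] by (simp only: dist_norm diff_zero)
      then have "norm (g (1 / t)) \<le> norm (g 0) + 1" using norm_triangle_sub[of "g (1 / t)" "g 0"] by linarith
      then have "norm t ^ m * norm (g (1 / t)) \<le> norm t ^ m * (norm (g 0) + 1)" by (intro mult_left_mono) auto
      then show ?thesis using fg[OF t(1)] by (simp add: norm_mult norm_power mult.commute)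
    qed
    then show ?thesis by (intro exI allI impI)
  qed
  then obtain A B where AB: "\<forall>t. A \<le> norm t \<longrightarrow> norm (f t) \<le> B * norm t ^ m" by (elim exE)
  have "f t = (\<Sum>k\<le>m. (deriv ^^ k) f 0 / fact k * t ^ k)" for t
    by (rule Liouville_polynomial[OF hol AB[rule_format]])
  then show "\<exists>c. \<forall>t. F (\<xi>(i := t)) = (\<Sum>k\<le>m. c k * t ^ k)"
    unfolding f_def by (intro exI[of _ "\<lambda>k. (deriv ^^ k) (\<lambda>t. F (\<xi>(i := t))) 0 / fact k"] allI)
qed

lemma cmb_upd_tail:
  assumes "j < r - 1" shows "cmb n r a z (\<xi>(skip a j := t)) = (cmb n r a z \<xi>)(n + j := t)"
proof
  fix i
  show "cmb n r a z (\<xi>(skip a j := t)) i = ((cmb n r a z \<xi>)(n + j := t)) i"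
  proof (cases "i < n \<or> n + (r - 1) \<le> i")
    case True
    then show ?thesis using assms by (auto simp: cmb_def)
  next
    case False
    define l where "l = i - n"
    have i: "i = n + l" "l < r - 1" using False unfolding l_def by linarith+
    show ?thesis unfolding i(1) using cmb_tail[OF i(2)] by (simp add: skip_inj)
  qed
qed

lemma cmb_upd_head: "i < n \<Longrightarrow> cmb n r a (z(i := w)) \<xi> = (cmb n r a z \<xi>)(i := w)"
  by (rule ext) (simp add: cmb_def)

text \<open>Differentiability looks at a whole neighbourhood on a coordinate line, while the
  functions agree on \<open>S\<close> only; openness of \<open>S\<close> in n-space makes its trace
  on each such line open.\<close>

lemma holo_on_transform:
  assumes So: "openin (top_of_set (cspace n)) S" and k: "holo_on n S k" and hk: "\<And>z. z \<in> S \<Longrightarrow> h z = k z"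
  shows "holo_on n S h"
  unfolding holo_on_def
proof (intro conjI ballI allI impI)
  have "continuous_on S k" using k by (simp add: holo_on_def)
  then show "continuous_on S h" using hk by (simp cong: continuous_on_cong)
  fix z i assume z: "z \<in> S" and i: "i < n"
  have kd: "(\<lambda>w. k (z(i := w))) field_differentiable at (z i)"
    using k z i unfolding holo_on_def by metis
  have zc: "z \<in> cspace n" using openin_subset[OF So] z by auto
  have co: "continuous_on UNIV (\<lambda>w. z(i := w))"
  proof (rule continuous_on_coordinatewise_then_product)
    show "continuous_on UNIV (\<lambda>w. (z(i := w)) j)" for j
      by (cases "j = i") (simp_all add: continuous_on_id continuous_on_const)
  qed
  have "(\<lambda>w. z(i := w)) \<in> UNIV \<rightarrow> cspace n" using zc i by (auto simp: cspace_def)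
  then have "openin (top_of_set UNIV) (UNIV \<inter> (\<lambda>w. z(i := w)) -` S)"
    by (rule continuous_openin_preimage[OF co _ So])
  then have op: "open ((\<lambda>w. z(i := w)) -` S)" by simp
  obtain D where "((\<lambda>w. k (z(i := w))) has_field_derivative D) (at (z i))"
    using kd unfolding field_differentiable_def by (rule exE)
  then have "((\<lambda>w. h (z(i := w))) has_field_derivative D) (at (z i))"
  proof (rule has_field_derivative_transform_within_open[OF _ op])
    show "z i \<in> (\<lambda>w. z(i := w)) -` S" using z by simp
    show "k (z(i := w)) = h (z(i := w))" if "w \<in> (\<lambda>w. z(i := w)) -` S" for w
      using hk[of "z(i := w)"] that by simp
  qed
  then show "(\<lambda>w. h (z(i := w))) field_differentiable at (z i)"
    unfolding field_differentiable_def by (rule exI)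
qed

section \<open>The form attached to a section and its dependence on the base point\<close>

context holo_bundle
begin

lemma chart_image_open:
  assumes U: "(U, \<psi>) \<in> charts X" and W: "openin (topo X) W"
  shows "openin (top_of_set (cspace n)) (\<psi> ` (U \<inter> W))"
proof -
  note c = chart_props[OF U]
  have t: "topspace (subtopology (topo X) U) = U" using openin_subset[OF c(1)] by auto
  have "openin (subtopology (topo X) U) (U \<inter> W)" using W by (auto simp: openin_subtopology)
  moreover have "U \<inter> W \<subseteq> topspace (subtopology (topo X) U)" unfolding t by blast
  ultimately have "openin (top_of_set (\<psi> ` U)) (\<psi> ` (U \<inter> W))"
    using homeomorphic_map_openness[OF c(3), of "U \<inter> W"] by blast
  then show ?thesis using c(2) by (rule openin_trans)
qed

context
  fixes m s assumes m: "m > 0" and hs: "holomorphic_section PB (line_power PB TB m) s"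
begin

lemma sev_covec_scale:
  assumes W: "(W, \<phi>) \<in> trivs E" "x \<in> W"
  shows "sev m s x (covec E \<phi> x (\<lambda>i. c * \<xi> i)) = c ^ m * sev m s x (covec E \<phi> x \<xi>)"
proof -
  interpret tf: triv_fibre E \<phi> x by (rule triv_fibre[OF W])
  have "covec E \<phi> x (\<lambda>i. c * \<xi> i) = (\<lambda>e\<in>fibre E x. c * covec E \<phi> x \<xi> e)"
    unfolding covec_def by (rule restrict_ext) (simp add: sum_distrib_left mult.assoc)
  then show ?thesis using sev_scale[OF hs m W tf.covec_dual[of \<xi>], of c] by (simp only:)
qed

text \<open>Two charts of the fibre are used: the one with index \<open>a\<close>, where
  \<open>\<xi> a \<noteq> 0\<close>, for holomorphy in another coordinate, and the one with index
  \<open>i\<close> for continuity where the coordinate \<open>i\<close> dominates.\<close>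

lemma sev_form:
  assumes W: "(W, \<phi>) \<in> trivs E" and x: "x \<in> W"
  shows "form {..<r} m (\<lambda>\<xi>. sev m s x (covec E \<phi> x \<xi>))"
proof -
  interpret tf: triv_fibre E \<phi> x by (rule triv_fibre[OF W x])
  obtain U \<psi> where U: "(U, \<psi>) \<in> charts X" "x \<in> U" using chart_ex[OF triv_subset[OF W x]] by (elim exE conjE)
  define f where "f \<xi> = sev m s x (covec E \<phi> x \<xi>)" for \<xi>
  have hom: "f (\<lambda>i. c * \<xi> i) = c ^ m * f \<xi>" for c \<xi>
    unfolding f_def by (rule sev_covec_scale[OF W x])
  have "form {..<r} m f"
  proof (rule form_of_separately_holomorphic)
    show "f \<xi> = f \<eta>" if "\<And>i. i < r \<Longrightarrow> \<xi> i = \<eta> i" for \<xi> \<eta>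
      unfolding f_def by (rule arg_cong[OF tf.covec_cong[OF that]])
    show "f (\<lambda>i. c * \<xi> i) = c ^ m * f \<xi>" for c \<xi> by (rule hom)
  next
    fix i a t0 and \<xi> :: "nat \<Rightarrow> complex" assume i: "i < r" and a: "a < r" and ai: "a \<noteq> i" and \<xi>: "\<xi> a \<noteq> 0"
    obtain Z \<sigma> where Z: "holo_on (n + (r - 1)) Z \<sigma>"
      "\<And>x \<xi>. x \<in> U \<Longrightarrow> x \<in> W \<Longrightarrow> \<xi> a = 1 \<Longrightarrow> cmb n r a (\<psi> x) \<xi> \<in> Z"
      "\<And>x \<xi>. x \<in> U \<Longrightarrow> x \<in> W \<Longrightarrow> \<xi> a = 1 \<Longrightarrow>
        \<sigma> (cmb n r a (\<psi> x) \<xi>) = sev m s x (covec E \<phi> x \<xi>)"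
      by (rule section_in_chart[OF hs U(1) W a], rule that, assumption+)
    obtain j where j: "j < r - 1" "skip a j = i" using skip_surj[OF i ai[symmetric] a] by blast
    \<comment> \<open>Dividing by \<open>\<xi> a\<close> moves the covector into the chart with
      index \<open>a\<close>; the variable \<open>t\<close> then appears as the single affine
      coordinate \<open>t / \<xi> a\<close>, and homogeneity restores the factor
      \<open>\<xi> a ^ m\<close>.\<close>
    define \<eta> where "\<eta> = (\<lambda>k. \<xi> k / \<xi> a)"
    define z where "z = cmb n r a (\<psi> x) (\<eta>(i := t0 / \<xi> a))"
    have \<eta>a: "(\<eta>(i := t)) a = 1" for t using \<xi> ai by (simp add: \<eta>_def)
    have zZ: "z \<in> Z" unfolding z_def by (rule Z(2)[where \<xi>="\<eta>(i := t0 / \<xi> a)", OF U(2) x \<eta>a])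
    have fe: "f (\<xi>(i := t)) = \<xi> a ^ m * \<sigma> (z(n + j := t / \<xi> a))" for t
    proof -
      have "\<xi>(i := t) = (\<lambda>k. \<xi> a * (\<eta>(i := t / \<xi> a)) k)" using \<xi> by (simp add: fun_eq_iff \<eta>_def)
      then have "f (\<xi>(i := t)) = \<xi> a ^ m * f (\<eta>(i := t / \<xi> a))" by (simp only: hom)
      also have "f (\<eta>(i := t / \<xi> a)) = \<sigma> (cmb n r a (\<psi> x) (\<eta>(i := t / \<xi> a)))"
        unfolding f_def by (rule Z(3)[where \<xi>="\<eta>(i := t / \<xi> a)", OF U(2) x \<eta>a, symmetric])
      also have "cmb n r a (\<psi> x) (\<eta>(i := t / \<xi> a)) = z(n + j := t / \<xi> a)"
        unfolding z_def j(2)[symmetric] cmb_upd_tail[OF j(1)] by simp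
      finally show ?thesis .
    qed
    have zj: "z (n + j) = t0 / \<xi> a" unfolding z_def cmb_tail[OF j(1)] j(2) by simp
    have "n + j < n + (r - 1)" using j(1) by simp
    then have "(\<lambda>w. \<sigma> (z(n + j := w))) field_differentiable at (t0 / \<xi> a)"
      using Z(1) zZ zj unfolding holo_on_def by metis
    moreover have "(\<lambda>t. t / \<xi> a) field_differentiable at t0"
      by (intro derivative_intros field_differentiable_ident field_differentiable_const) (use \<xi> in simp)
    ultimately have "(\<lambda>t. \<sigma> (z(n + j := t / \<xi> a))) field_differentiable at t0"
      using field_differentiable_compose[of "\<lambda>t. t / \<xi> a" t0 "\<lambda>w. \<sigma> (z(n + j := w))"] by (simp add: o_def)
    then show "(\<lambda>t. f (\<xi>(i := t))) field_differentiable at t0"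
      unfolding fe by (intro field_differentiable_mult field_differentiable_const)
  next
    fix i and \<xi> :: "nat \<Rightarrow> complex" assume i: "i < r"
    obtain Z \<sigma> where Z: "holo_on (n + (r - 1)) Z \<sigma>"
      "\<And>x \<xi>. x \<in> U \<Longrightarrow> x \<in> W \<Longrightarrow> \<xi> i = 1 \<Longrightarrow> cmb n r i (\<psi> x) \<xi> \<in> Z"
      "\<And>x \<xi>. x \<in> U \<Longrightarrow> x \<in> W \<Longrightarrow> \<xi> i = 1 \<Longrightarrow>
        \<sigma> (cmb n r i (\<psi> x) \<xi>) = sev m s x (covec E \<phi> x \<xi>)"
      by (rule section_in_chart[OF hs U(1) W i], rule that, assumption+)
    define h where "h t = cmb n r i (\<psi> x) ((\<lambda>j. t * \<xi> j)(i := 1))" for t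
    have one: "((\<lambda>j. t * \<xi> j)(i := 1)) i = 1" for t by simp
    have fe: "f ((\<lambda>j. t * \<xi> j)(i := 1)) = \<sigma> (h t)" for t
      unfolding f_def h_def by (rule Z(3)[where \<xi>="(\<lambda>j. t * \<xi> j)(i := 1)", OF U(2) x one, symmetric])
    have ch: "continuous_on UNIV h"
    proof (rule continuous_on_coordinatewise_then_product)
      fix k
      have "continuous_on UNIV (\<lambda>t. if P then A else if Q then if R then 1 else t * b else 0)"
        for P Q R and A b :: complex
        by (cases P; cases Q; cases R) (simp_all add: continuous_intros)
      then show "continuous_on UNIV (\<lambda>t. h t k)" unfolding h_def cmb_def fun_upd_def .
    qed
    have cs: "continuous_on Z \<sigma>" using Z(1) by (simp add: holo_on_def)
    have "h t \<in> Z" for t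
      unfolding h_def by (rule Z(2)[where \<xi>="(\<lambda>j. t * \<xi> j)(i := 1)", OF U(2) x one])
    then have "h ` UNIV \<subseteq> Z" by blast
    then have "continuous_on UNIV (\<lambda>t. \<sigma> (h t))" by (rule continuous_on_compose2[OF cs ch])
    then show "continuous_on UNIV (\<lambda>t. f ((\<lambda>j. t * \<xi> j)(i := 1)))" unfolding fe .
  qed
  then show ?thesis unfolding f_def .
qed

text \<open>For fixed \<open>\<xi>\<close> with \<open>\<xi> a \<noteq> 0\<close> the points over
  \<open>W\<close> have constant affine coordinates in the chart with index \<open>a\<close>, so
  only the first \<open>n\<close> coordinates vary. If \<open>\<xi>\<close> vanishes below
  \<open>r\<close>, the function is 0 by the default value of \<open>sev\<close>.\<close>

lemma sev_holo:
  assumes W: "(W, \<phi>) \<in> trivs E"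
  shows "holo_fun X W (\<lambda>x. sev m s x (covec E \<phi> x \<xi>))"
proof (cases "\<exists>a<r. \<xi> a \<noteq> 0")
  case False
  have "sev m s x (covec E \<phi> x \<xi>) = 0" for x
  proof -
    have "covec E \<phi> x \<xi> v = 0" if "v \<in> fibre E x" for v using False that by (simp add: covec_def)
    then show ?thesis by (simp add: sev_def)
  qed
  then show ?thesis by (simp add: holo_fun_def holo_on_def)
next
  case True
  then obtain a where a: "a < r" "\<xi> a \<noteq> 0" by blast
  show ?thesis unfolding holo_fun_def
  proof (rule ballI, clarify)
    fix U \<psi> assume U: "(U, \<psi>) \<in> charts X"
    obtain Z \<sigma> where Z: "holo_on (n + (r - 1)) Z \<sigma>"
      "\<And>x \<xi>. x \<in> U \<Longrightarrow> x \<in> W \<Longrightarrow> \<xi> a = 1 \<Longrightarrow> cmb n r a (\<psi> x) \<xi> \<in> Z"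
      "\<And>x \<xi>. x \<in> U \<Longrightarrow> x \<in> W \<Longrightarrow> \<xi> a = 1 \<Longrightarrow>
        \<sigma> (cmb n r a (\<psi> x) \<xi>) = sev m s x (covec E \<phi> x \<xi>)"
      by (rule section_in_chart[OF hs U W a(1)], rule that, assumption+)
    define S where "S = \<psi> ` (U \<inter> W)"
    define \<eta> where "\<eta> = (\<lambda>k. \<xi> k / \<xi> a)"
    define h where "h z = sev m s (inv_into U \<psi> z) (covec E \<phi> (inv_into U \<psi> z) \<xi>)" for z
    define k where "k z = \<xi> a ^ m * \<sigma> (cmb n r a z \<eta>)" for z
    have \<eta>a: "\<eta> a = 1" using a by (simp add: \<eta>_def)
    have hk: "h z = k z" "cmb n r a z \<eta> \<in> Z" if "z \<in> S" for z
    proof -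
      from that obtain x where x: "x \<in> U" "x \<in> W" "z = \<psi> x" by (auto simp: S_def)
      have inv: "inv_into U \<psi> z = x" unfolding x(3) using chart_props(4)[OF U] x(1) by (rule inv_into_f_f)
      have "\<xi> = (\<lambda>i. \<xi> a * \<eta> i)" using a by (simp add: \<eta>_def fun_eq_iff)
      then have "h z = sev m s x (covec E \<phi> x (\<lambda>i. \<xi> a * \<eta> i))" unfolding h_def inv by (simp only:)
      also have "\<dots> = \<xi> a ^ m * sev m s x (covec E \<phi> x \<eta>)" by (rule sev_covec_scale[OF W x(2)])
      also have "sev m s x (covec E \<phi> x \<eta>) = \<sigma> (cmb n r a z \<eta>)"
        unfolding x(3) by (rule Z(3)[where \<xi>=\<eta>, OF x(1,2) \<eta>a, symmetric])
      finally show "h z = k z" unfolding k_def .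
      show "cmb n r a z \<eta> \<in> Z" unfolding x(3) by (rule Z(2)[where \<xi>=\<eta>, OF x(1,2) \<eta>a])
    qed
    have So: "openin (top_of_set (cspace n)) S"
      unfolding S_def by (rule chart_image_open[OF U triv_open[OF W]])
    have "continuous_on S k"
    proof -
      have ch: "continuous_on S (\<lambda>z. cmb n r a z \<eta>)"
      proof (rule continuous_on_coordinatewise_then_product)
        fix i
        have "continuous_on S (\<lambda>z. z i)"
          by (rule continuous_on_product_then_coordinatewise[OF continuous_on_id[unfolded id_def]])
        then have "continuous_on S (\<lambda>z. if P then z i else A)" for P and A :: complex
          by (cases P) (simp_all add: continuous_on_const)
        then show "continuous_on S (\<lambda>z. cmb n r a z \<eta> i)" unfolding cmb_def .
      qed
      have cs: "continuous_on Z \<sigma>" using Z(1) by (simp add: holo_on_def)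
      have "(\<lambda>z. cmb n r a z \<eta>) ` S \<subseteq> Z" using hk(2) by blast
      then have "continuous_on S (\<lambda>z. \<sigma> (cmb n r a z \<eta>))"
        by (rule continuous_on_compose2[OF cs ch])
      then show ?thesis unfolding k_def by (intro continuous_on_mult continuous_on_const)
    qed
    moreover have "(\<lambda>w. k (z(i := w))) field_differentiable at (z i)" if z: "z \<in> S" and i: "i < n" for z i
    proof -
      have "i < n + (r - 1)" using i by simp
      moreover have "cmb n r a z \<eta> i = z i" using i by (simp add: cmb_def)
      ultimately have "(\<lambda>w. \<sigma> ((cmb n r a z \<eta>)(i := w))) field_differentiable at (z i)"
        using Z(1) hk(2)[OF z] unfolding holo_on_def by metis
      then show ?thesis
        unfolding k_def cmb_upd_head[OF i] by (intro field_differentiable_mult field_differentiable_const)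
    qed
    ultimately have "holo_on n S k" unfolding holo_on_def by (intro conjI ballI allI impI)
    from holo_on_transform[OF So this hk(1)]
    show "holo_on n (\<psi> ` (U \<inter> W)) (\<lambda>z. sev m s (inv_into U \<psi> z) (covec E \<phi> (inv_into U \<psi> z) \<xi>))"
      unfolding S_def h_def .
  qed
qed

end
end

section \<open>Sections of powers of the determinant\<close>

text \<open>Copies the derivation of an element in the algebra of restricted functions. An
  expression found on one fibre, embedded by \<open>h\<close>, thereby becomes an expression in the
  unrestricted generators, which can be evaluated on other fibres.\<close>

lemma galg_lift:
  assumes "galg ((\<lambda>\<tau> g. \<tau> (h g)) ` T) m d b"
  shows "\<exists>\<beta>. galg T m d \<beta> \<and> (\<forall>g. b g = \<beta> (h g))"
  using assms
proof (induction rule: galg.induct)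
  case (const c)
  show ?case by (rule exI[of _ "\<lambda>_. c"]) (simp add: galg.const)
next
  case (zero d)
  show ?case by (rule exI[of _ "\<lambda>_. 0"]) (simp add: galg.zero)
next
  case (gen g d b)
  obtain \<tau> where \<tau>: "\<tau> \<in> T" "g = (\<lambda>g. \<tau> (h g))" using gen.hyps(1) by (rule imageE)
  obtain \<beta> where \<beta>: "galg T m d \<beta>" "\<forall>g. b g = \<beta> (h g)" using gen.IH by (elim exE conjE)
  show ?case
    by (rule exI[of _ "\<lambda>q. \<tau> q * \<beta> q"]) (use galg.gen[OF \<tau>(1) \<beta>(1)] \<beta>(2) in \<open>simp add: \<tau>(2)\<close>)
next
  case (add d a b)
  obtain \<alpha> where \<alpha>: "galg T m d \<alpha>" "\<forall>g. a g = \<alpha> (h g)" using add.IH(1) by (elim exE conjE)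
  obtain \<beta> where \<beta>: "galg T m d \<beta>" "\<forall>g. b g = \<beta> (h g)" using add.IH(2) by (elim exE conjE)
  show ?case
    by (rule exI[of _ "\<lambda>q. \<alpha> q + \<beta> q"]) (use galg.add[OF \<alpha>(1) \<beta>(1)] \<alpha>(2) \<beta>(2) in simp)
qed

lemma form_substitute:
  assumes "form I d p" and "\<And>i. i \<in> I \<Longrightarrow> f i \<in> I'"
  shows "form I' d (\<lambda>g. p (\<lambda>i. g (f i)))"
  using assms(1)
proof (induction rule: galg.induct)
  case (gen g d b)
  then obtain k where k: "k \<in> I" "g = (\<lambda>x. x k)" by (auto simp: coord_def)
  have "(\<lambda>g. g (f k)) \<in> coord I'" using assms(2)[OF k(1)] by (auto simp: coord_def)
  from galg.gen[OF this gen.IH] show ?case by (simp add: k(2))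
qed (auto intro: galg.const galg.zero galg.add)

lemma holo_on_const: "holo_on n V (\<lambda>z. c)"
  by (simp add: holo_on_def)

lemma holo_on_add: "holo_on n V f \<Longrightarrow> holo_on n V g \<Longrightarrow> holo_on n V (\<lambda>z. f z + g z)"
  unfolding holo_on_def by (intro conjI ballI allI impI continuous_on_add field_differentiable_add) simp_all

lemma holo_on_mult: "holo_on n V f \<Longrightarrow> holo_on n V g \<Longrightarrow> holo_on n V (\<lambda>z. f z * g z)"
  unfolding holo_on_def by (intro conjI ballI allI impI continuous_on_mult field_differentiable_mult) simp_all

lemma holo_fun_const: "holo_fun M W (\<lambda>x. c)"
  unfolding holo_fun_def by (clarify, rule holo_on_const)

lemma holo_fun_add: "holo_fun M W f \<Longrightarrow> holo_fun M W g \<Longrightarrow> holo_fun M W (\<lambda>x. f x + g x)"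
  unfolding holo_fun_def by (clarify, rule holo_on_add) auto

lemma holo_fun_mult: "holo_fun M W f \<Longrightarrow> holo_fun M W g \<Longrightarrow> holo_fun M W (\<lambda>x. f x * g x)"
  unfolding holo_fun_def by (clarify, rule holo_on_mult) auto

lemma holo_fun_sum: "(\<And>i. i \<in> S \<Longrightarrow> holo_fun M W (f i)) \<Longrightarrow> holo_fun M W (\<lambda>x. \<Sum>i\<in>S. f i x)"
proof (induction S rule: infinite_finite_induct)
  case (insert i S)
  have "holo_fun M W (\<lambda>x. f i x + (\<Sum>i\<in>S. f i x))"
    by (rule holo_fun_add) (use insert in auto)
  then show ?case using insert by simp
qed (simp_all add: holo_fun_const)

lemma holo_fun_power: "holo_fun M W f \<Longrightarrow> holo_fun M W (\<lambda>x. f x ^ k)"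
  by (induction k) (simp_all add: holo_fun_const holo_fun_mult)

section \<open>Transition matrices and families that transform like a power of the
  determinant\<close>

context holo_bundle
begin

definition cocycle :: "('e \<Rightarrow> nat \<Rightarrow> complex) \<Rightarrow> ('e \<Rightarrow> nat \<Rightarrow> complex) \<Rightarrow> 'x \<Rightarrow> (nat \<times> nat \<Rightarrow> complex) \<Rightarrow> bool" where
  "cocycle \<phi> \<phi>' x T \<longleftrightarrow> (\<forall>e\<in>fibre E x. \<forall>i<r. \<phi>' e i = (\<Sum>j<r. T (i, j) * \<phi> e j))"

lemma cocycle_ex:
  assumes "(W, \<phi>) \<in> trivs E" "(W', \<phi>') \<in> trivs E" "x \<in> W" "x \<in> W'"
  shows "\<exists>T. cocycle \<phi> \<phi>' x T"
proof -
  obtain T where "\<And>e i. e \<in> fibre E x \<Longrightarrow> i < r \<Longrightarrow> \<phi>' e i = (\<Sum>j<r. T (i, j) * \<phi> e j)"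
    by (rule transition[OF assms], rule that, assumption+)
  then have "cocycle \<phi> \<phi>' x T" unfolding cocycle_def by simp
  then show ?thesis by (rule exI[where x=T])
qed

lemma cocycle_frame:
  assumes "(W, \<phi>) \<in> trivs E" "x \<in> W" and T: "cocycle \<phi> \<phi>' x T" and "i < r" "j < r"
  shows "\<phi>' (frame E \<phi> x j) i = T (i, j)"
proof -
  interpret tf: triv_fibre E \<phi> x by (rule triv_fibre[OF assms(1,2)])
  have "\<phi>' (frame E \<phi> x j) i = (\<Sum>k<r. T (i, k) * \<phi> (frame E \<phi> x j) k)"
    using T tf.frame(1)[OF assms(5)] assms(4) unfolding cocycle_def by blast
  also have "\<dots> = T (i, j)"
    using assms(5) by (simp add: tf.frame(2) if_distrib[of "\<lambda>t. _ * t"] cong: if_cong)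
  finally show ?thesis .
qed

text \<open>The transition matrix in the opposite direction is an inverse, checked on the frame
  vectors.\<close>

lemma cocycle_dt_nonzero:
  assumes W: "(W, \<phi>) \<in> trivs E" "x \<in> W" and W': "(W', \<phi>') \<in> trivs E" "x \<in> W'"
    and T: "cocycle \<phi> \<phi>' x T"
  shows "dt r T \<noteq> 0"
proof -
  interpret tf: triv_fibre E \<phi>' x by (rule triv_fibre[OF W'])
  obtain T' where T': "cocycle \<phi>' \<phi> x T'" using cocycle_ex[OF W'(1) W(1) W'(2) W(2)] by (rule exE)
  have "mmul r T T' (i, j) = (if i = j then 1 else 0)" if ij: "i < r" "j < r" for i j
  proof -
    have "(if i = j then 1 else 0) = \<phi>' (frame E \<phi>' x j) i" using ij by (simp add: tf.frame(2))
    also have "\<dots> = (\<Sum>k<r. T (i, k) * \<phi> (frame E \<phi>' x j) k)"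
      using T tf.frame(1)[OF ij(2)] ij(1) unfolding cocycle_def by blast
    also have "\<dots> = (\<Sum>k<r. T (i, k) * T' (k, j))"
      by (intro sum.cong refl) (use cocycle_frame[OF W' T' _ ij(2)] in simp)
    finally show ?thesis by (simp add: mmul_def)
  qed
  then have "dt r (mmul r T T') = dt r (\<lambda>(i, j). if i = j then 1 else 0)" by (intro dt_cong) simp
  then have "dt r T * dt r T' = 1" unfolding dt_mmul dt_one .
  then show ?thesis by auto
qed

text \<open>The columns of \<open>g\<close> are covectors, whose coordinates change by the
  transpose; a change of trivialisation thus acts on matrices by left multiplication, the action for
  which the pairing with \<open>det^n\<close> is semi-invariant.\<close>

lemma covec_cocycle:
  assumes T: "cocycle \<phi> \<phi>' x T"
  shows "covec E \<phi>' x (\<lambda>i. g (i, j)) = covec E \<phi> x (\<lambda>i. mmul r (\<lambda>(i, j). T (j, i)) g (i, j))"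
  unfolding covec_def
proof (rule restrict_ext)
  fix e assume e: "e \<in> fibre E x"
  have "(\<Sum>i<r. g (i, j) * \<phi>' e i) = (\<Sum>i<r. \<Sum>k<r. T (i, k) * g (i, j) * \<phi> e k)"
    using T e by (simp add: cocycle_def sum_distrib_left mult_ac)
  also have "\<dots> = (\<Sum>k<r. \<Sum>i<r. T (i, k) * g (i, j) * \<phi> e k)" by (rule sum.swap)
  also have "\<dots> = (\<Sum>k<r. mmul r (\<lambda>(i, j). T (j, i)) g (k, j) * \<phi> e k)"
    by (simp add: mmul_def sum_distrib_right)
  finally show "(\<Sum>i<r. g (i, j) * \<phi>' e i) = (\<Sum>k<r. mmul r (\<lambda>(i, j). T (j, i)) g (k, j) * \<phi> e k)" .
qed

text \<open>A family \<open>R\<close> of coordinate functions, one for each trivialisation of \<open>E\<close>, which transform like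
  those of a holomorphic section of the \<open>q\<close>-th power of the determinant bundle.\<close>

definition det_section :: "nat \<Rightarrow> (('e \<Rightarrow> nat \<Rightarrow> complex) \<Rightarrow> 'x \<Rightarrow> complex) \<Rightarrow> bool" where
  "det_section q R \<longleftrightarrow> (\<forall>W \<phi>. (W, \<phi>) \<in> trivs E \<longrightarrow> holo_fun X W (R \<phi>)) \<and>
    (\<forall>W \<phi> W' \<phi>' x T. (W, \<phi>) \<in> trivs E \<longrightarrow> (W', \<phi>') \<in> trivs E \<longrightarrow> x \<in> W \<longrightarrow> x \<in> W' \<longrightarrow>
      cocycle \<phi> \<phi>' x T \<longrightarrow> R \<phi>' x = dt r T ^ q * R \<phi> x)"

lemma det_section_power: "det_section q R \<Longrightarrow> det_section (q * k) (\<lambda>\<phi> x. R \<phi> x ^ k)"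
  unfolding det_section_def
  by (intro conjI allI impI holo_fun_power) (simp_all add: power_mult_distrib power_mult)

text \<open>The integral equation is formed over the single point \<open>x0\<close>, and its
  coefficient is then read as an expression in sections valid over all of \<open>X\<close>. Only the
  nonvanishing comes from the fibre at \<open>x0\<close>; holomorphy and the transformation law hold
  everywhere.\<close>

lemma local_det_section:
  assumes m: "m > 0" and bpf: "base_point_free PB (line_power PB TB m)"
    and W0: "(W0, \<phi>0) \<in> trivs E" "x0 \<in> W0"
  shows "\<exists>q R. q > 0 \<and> det_section q R \<and> R \<phi>0 x0 \<noteq> 0"
proof -
  let ?I = "{..<r} \<times> {..<r}"
  \<comment> \<open>Trivialisation and base point are arguments of the generators, so that an
    algebraic expression in them keeps its meaning when the point moves; \<open>j\<close> selects
    the column on which the section is evaluated.\<close>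
  define \<tau> where "\<tau> s j = (\<lambda>(\<phi>, x, g). sev m s x (covec E \<phi> x (\<lambda>i. g (i, j))))"
    for s and j :: nat
  define T where "T = {\<tau> s j | s j. holomorphic_section PB (line_power PB TB m) s \<and> j < r}"
  have TE: "\<exists>s j. t = \<tau> s j \<and> holomorphic_section PB (line_power PB TB m) s \<and> j < r" if "t \<in> T" for t
    using that unfolding T_def by (rule CollectD)
  have TI: "\<tau> s j \<in> T" if "holomorphic_section PB (line_power PB TB m) s" "j < r" for s j
    unfolding T_def using that by (intro CollectI exI[of _ s] exI[of _ j]) simp
  have Tform: "form ?I m (\<lambda>g. t (\<phi>, x, g))" if tT: "t \<in> T" and W: "(W, \<phi>) \<in> trivs E" "x \<in> W" for t W \<phi> x
  proof -
    obtain s j where t: "t = \<tau> s j" "holomorphic_section PB (line_power PB TB m) s" "j < r"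
      using TE[OF tT] by (elim exE conjE)
    show ?thesis unfolding t(1) \<tau>_def prod.case
      by (rule form_substitute[OF sev_form[OF m t(2) W], of "\<lambda>i. (i, j)"]) (use t(3) in simp)
  qed
  have form: "form ?I d (\<lambda>g. \<beta> (\<phi>, x, g))"
    if "galg T m d \<beta>" "(W, \<phi>) \<in> trivs E" "x \<in> W" for d \<beta> W \<phi> x
    using that(1)
  proof (induction rule: galg.induct)
    case (gen g d b)
    from galg_mult[OF Tform[OF gen.hyps(1) that(2,3)] gen.IH] show ?case by (simp add: add.commute)
  qed (rule galg.const galg.zero galg.add; assumption)+
  have holo: "holo_fun X W (\<lambda>x. \<beta> (\<phi>, x, g))"
    if "galg T m d \<beta>" "(W, \<phi>) \<in> trivs E" for d \<beta> W \<phi> g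
    using that(1)
  proof (induction rule: galg.induct)
    case (gen t d b)
    obtain s j where t: "t = \<tau> s j" "holomorphic_section PB (line_power PB TB m) s" "j < r"
      using TE[OF gen.hyps(1)] by (elim exE conjE)
    have "holo_fun X W (\<lambda>x. t (\<phi>, x, g))" unfolding t(1) \<tau>_def prod.case
      by (rule sev_holo[OF m t(2) that(2)])
    then show ?case using gen.IH by (rule holo_fun_mult)
  qed (rule holo_fun_const holo_fun_add; assumption)+
  have trans: "\<beta> (\<phi>', x, g) = \<beta> (\<phi>, x, mmul r (\<lambda>(i, j). A (j, i)) g)"
    if "galg T m d \<beta>" "cocycle \<phi> \<phi>' x A" for d \<beta> \<phi> \<phi>' x A g
    using that(1)
  proof (induction rule: galg.induct)
    case (gen t d b)
    obtain s j where t: "t = \<tau> s j" using TE[OF gen.hyps(1)] by (elim exE conjE)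
    have "t (\<phi>', x, g) = t (\<phi>, x, mmul r (\<lambda>(i, j). A (j, i)) g)"
      unfolding t \<tau>_def prod.case by (simp only: covec_cocycle[OF that(2)])
    then show ?case using gen.IH by (simp only:)
  qed simp_all
  define G where "G = (\<lambda>t g. t (\<phi>0, x0, g)) ` T"
  obtain q n' b and N :: nat and e y where q: "0 < q" "q \<le> n'" and b: "galg G m (r * q) b"
    and pair: "\<And>h A. form ?I (r * n') h \<Longrightarrow>
      (\<Sum>l<N. e l * h (mmul r A (y l))) = dt r A ^ n' * (\<Sum>l<N. e l * h (y l))"
    and nz: "(\<Sum>l<N. e l * (b (y l) * dt r (y l) ^ (n' - q))) \<noteq> 0"
  proof (rule semi_invariant_exists[OF m])
    show "form ?I m g" if "g \<in> G" for g
    proof -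
      obtain t where t: "t \<in> T" "g = (\<lambda>g. t (\<phi>0, x0, g))" using \<open>g \<in> G\<close> unfolding G_def by (elim imageE)
      show ?thesis unfolding t(2) by (rule Tform[OF t(1) W0])
    qed
    \<comment> \<open>A nonzero entry in column \<open>j\<close> makes that column a nonzero
      covector, at which some section does not vanish.\<close>
    show "g p = 0" if z: "\<And>t. t \<in> G \<Longrightarrow> t g = 0" and p: "p \<in> ?I" for g p
    proof (rule ccontr)
      assume gp: "g p \<noteq> 0"
      obtain i j where ij: "p = (i, j)" "i < r" "j < r" using p by auto
      interpret tf: triv_fibre E \<phi>0 x0 by (rule triv_fibre[OF W0])
      let ?l = "covec E \<phi>0 x0 (\<lambda>i. g (i, j))"
      have "?l (frame E \<phi>0 x0 i) \<noteq> 0" unfolding tf.covec_frame[OF ij(2)] using gp ij(1) by simp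
      then obtain s where s: "holomorphic_section PB (line_power PB TB m) s" "sev m s x0 ?l \<noteq> 0"
        by (rule sev_nonzero[OF bpf W0 tf.covec_dual tf.frame(1)[OF ij(2)]])
      have "(\<lambda>g. \<tau> s j (\<phi>0, x0, g)) \<in> G" unfolding G_def using TI[OF s(1) ij(3)] by (rule imageI)
      from z[OF this] show False using s(2) unfolding \<tau>_def prod.case by (rule notE[rotated])
    qed
  qed (rule that, assumption+)
  have "\<exists>\<beta>. galg T m (r * q) \<beta> \<and> (\<forall>g. b g = \<beta> (\<phi>0, x0, g))"
    using b unfolding G_def by (rule galg_lift)
  then obtain \<beta> where \<beta>: "galg T m (r * q) \<beta>" "\<forall>g. b g = \<beta> (\<phi>0, x0, g)" by (elim exE conjE)
  \<comment> \<open>The weights \<open>e\<close>, the matrices \<open>y\<close> and the exponents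
    are constants obtained at \<open>x0\<close>; trivialisation and point enter only through
    \<open>\<beta>\<close>.\<close>
  define R where "R \<phi> x = (\<Sum>l<N. e l * (\<beta> (\<phi>, x, y l) * dt r (y l) ^ (n' - q)))" for \<phi> x
  have "R \<phi>0 x0 \<noteq> 0" unfolding R_def \<beta>(2)[rule_format, symmetric] by (rule nz)
  moreover have "det_section q R" unfolding det_section_def
  proof (intro conjI allI impI)
    show "holo_fun X W (R \<phi>)" if "(W, \<phi>) \<in> trivs E" for W \<phi>
      unfolding R_def by (intro holo_fun_sum holo_fun_mult holo_fun_const holo[OF \<beta>(1) that])
    fix W \<phi> W' \<phi>' x A
    assume W: "(W, \<phi>) \<in> trivs E" and W': "(W', \<phi>') \<in> trivs E" and x: "x \<in> W" "x \<in> W'"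
      and A: "cocycle \<phi> \<phi>' x A"
    let ?A = "\<lambda>(i, j). A (j, i)"
    \<comment> \<open>At the transformed matrices, \<open>h\<close> is built from the values of
      \<open>\<beta>\<close> in the trivialisation \<open>\<phi>'\<close>, up to the factor
      \<open>dt r A ^ (n' - q)\<close>.\<close>
    define h where "h g = \<beta> (\<phi>, x, g) * dt r g ^ (n' - q)" for g
    have "form ?I (r * q + r * (n' - q)) h"
      unfolding h_def by (rule galg_mult[OF form[OF \<beta>(1) W x(1)] galg_power[OF form_dt]])
    moreover have "r * q + r * (n' - q) = r * n'" using q(2) by (simp add: distrib_left[symmetric])
    ultimately have fh: "form ?I (r * n') h" by (simp only:)
    have dA: "dt r ?A = dt r A" by (rule dt_transpose)
    have "dt r A ^ (n' - q) * R \<phi>' x = (\<Sum>l<N. e l * h (mmul r ?A (y l)))"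
      unfolding R_def h_def dt_mmul dA trans[OF \<beta>(1) A] sum_distrib_left
      by (intro sum.cong refl) (simp add: power_mult_distrib mult_ac)
    also have "\<dots> = dt r ?A ^ n' * (\<Sum>l<N. e l * h (y l))" by (rule pair[OF fh])
    also have "\<dots> = dt r A ^ n' * R \<phi> x" by (simp only: dA R_def h_def)
    also have "dt r A ^ n' = dt r A ^ (n' - q) * dt r A ^ q" using q(2) by (simp add: power_add[symmetric])
    \<comment> \<open>Cancelling \<open>dt r A ^ (n' - q)\<close>, which is nonzero for an
      invertible transition matrix, leaves the weight \<open>q\<close>.\<close>
    finally show "R \<phi>' x = dt r A ^ q * R \<phi> x"
      using cocycle_dt_nonzero[OF W x(1) W' x(2) A] by simp
  qed
  ultimately show ?thesis using q(1) by (intro exI conjI)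
qed

lemma holo_fun_cong:
  assumes W: "openin (topo X) W" and f: "holo_fun X W f" and eq: "\<And>x. x \<in> W \<Longrightarrow> g x = f x"
  shows "holo_fun X W g"
  unfolding holo_fun_def
proof (rule ballI, clarify)
  fix U \<psi> assume U: "(U, \<psi>) \<in> charts X"
  show "holo_on n (\<psi> ` (U \<inter> W)) (\<lambda>z. g (inv_into U \<psi> z))"
  proof (rule holo_on_transform[OF chart_image_open[OF U W]])
    show "holo_on n (\<psi> ` (U \<inter> W)) (\<lambda>z. f (inv_into U \<psi> z))"
      using bspec[OF f[unfolded holo_fun_def] U] by simp
    show "g (inv_into U \<psi> z) = f (inv_into U \<psi> z)" if "z \<in> \<psi> ` (U \<inter> W)" for z
    proof -
      from that obtain x where x: "x \<in> U" "x \<in> W" "z = \<psi> x" by auto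
      have "inv_into U \<psi> z = x" unfolding x(3) using chart_props(4)[OF U] x(1) by (rule inv_into_f_f)
      then show ?thesis using eq[OF x(2)] by simp
    qed
  qed
qed

lemma nonvanishing_open:
  assumes W: "openin (topo X) W" and f: "holo_fun X W f" and x: "x \<in> W" "f x \<noteq> 0"
  obtains N where "openin (topo X) N" "x \<in> N" "N \<subseteq> W" "\<And>y. y \<in> N \<Longrightarrow> f y \<noteq> 0"
proof -
  have "x \<in> topspace (topo X)" using openin_subset[OF W] x(1) by auto
  from chart_ex[OF this] obtain U \<psi> where U: "(U, \<psi>) \<in> charts X" "x \<in> U" by (elim exE conjE)
  note c = chart_props[OF U(1)]
  define S where "S = \<psi> ` (U \<inter> W)"
  define h where "h z = f (inv_into U \<psi> z)" for z
  define N where "N = {y \<in> U \<inter> W. f y \<noteq> 0}"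
  have h: "h (\<psi> y) = f y" if "y \<in> U" for y unfolding h_def using inv_into_f_f[OF c(4) that] by simp
  have "holo_on n S h" using bspec[OF f[unfolded holo_fun_def] U(1)] unfolding S_def h_def by simp
  then have "continuous_on S h" by (simp add: holo_on_def)
  moreover have "open (- {0 :: complex})" by auto
  ultimately have "openin (top_of_set S) (S \<inter> h -` (- {0}))"
    using continuous_on_open_vimage continuous_openin_preimage_gen by blast
  moreover have "S \<inter> h -` (- {0}) = \<psi> ` N"
  proof (intro Set.set_eqI iffI)
    fix z assume z: "z \<in> S \<inter> h -` (- {0})"
    then obtain y where y: "y \<in> U" "y \<in> W" "z = \<psi> y" by (auto simp: S_def)
    then have "y \<in> N" using z h[OF y(1)] by (simp add: N_def)
    then show "z \<in> \<psi> ` N" using y(3) by blast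
  next
    fix z assume "z \<in> \<psi> ` N"
    then obtain y where y: "y \<in> U" "y \<in> W" "f y \<noteq> 0" "z = \<psi> y" by (auto simp: N_def)
    then show "z \<in> S \<inter> h -` (- {0})" using h[OF y(1)] by (simp add: S_def)
  qed
  moreover have t: "topspace (subtopology (topo X) U) = U" using openin_subset[OF c(1)] by auto
  moreover have UW: "openin (subtopology (topo X) U) (U \<inter> W)" using W by (auto simp: openin_subtopology)
  moreover have "U \<inter> W \<subseteq> topspace (subtopology (topo X) U)" unfolding t by blast
  ultimately have "openin (top_of_set S) (\<psi> ` N)" and "openin (top_of_set (\<psi> ` U)) S"
    using homeomorphic_map_openness[OF c(3), of "U \<inter> W"] unfolding S_def by simp_all
  then have "openin (top_of_set (\<psi> ` U)) (\<psi> ` N)" by (rule openin_trans)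
  moreover have "N \<subseteq> topspace (subtopology (topo X) U)" unfolding t by (auto simp: N_def)
  ultimately have "openin (subtopology (topo X) U) N"
    using homeomorphic_map_openness[OF c(3), of N] by blast
  then have "openin (topo X) N" using c(1) by (rule openin_trans_full)
  moreover have "x \<in> N" using x U(2) by (simp add: N_def)
  ultimately show ?thesis by (rule that) (auto simp: N_def)
qed

text \<open>A section nonvanishing at a point stays so nearby, and its powers have no further zeros;
  hence any common multiple of the finitely many exponents of a subcover serves all points.\<close>

lemma uniform_det_section:
  assumes comp: "compact_space (topo X)"
    and m: "m > 0" and bpf: "base_point_free PB (line_power PB TB m)"
  obtains K where "K > 0"
    and "\<And>x. x \<in> topspace (topo X) \<Longrightarrow>
      \<exists>R W \<phi>. det_section K R \<and> (W, \<phi>) \<in> trivs E \<and> x \<in> W \<and> R \<phi> x \<noteq> 0"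
proof -
  define P where "P q x \<longleftrightarrow> (\<exists>R W \<phi>. det_section q R \<and> (W, \<phi>) \<in> trivs E \<and> x \<in> W \<and> R \<phi> x \<noteq> 0)" for q x
  have PI: "P q x" if "det_section q R" "(W, \<phi>) \<in> trivs E" "x \<in> W" "R \<phi> x \<noteq> 0" for q x R W \<phi>
    unfolding P_def using that by (intro exI[of _ R] exI[of _ W] exI[of _ \<phi>] conjI)
  have Pmult: "P (q * k) x" if "P q x" for q k x
  proof -
    obtain R W \<phi> where R: "det_section q R" "(W, \<phi>) \<in> trivs E" "x \<in> W" "R \<phi> x \<noteq> 0"
      using \<open>P q x\<close> unfolding P_def by (elim exE conjE)
    show ?thesis by (rule PI[OF det_section_power[OF R(1)] R(2,3)]) (use R(4) in simp)
  qed
  define C where "C = {N. openin (topo X) N \<and> (\<exists>q>0. \<forall>y\<in>N. P q y)}"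
  have cov: "topspace (topo X) \<subseteq> \<Union>C"
  proof
    fix x assume "x \<in> topspace (topo X)"
    from triv_ex[OF this] obtain W \<phi> where W: "(W, \<phi>) \<in> trivs E" "x \<in> W" by (elim exE conjE)
    obtain q R where qR: "q > 0" "det_section q R" "R \<phi> x \<noteq> 0"
      using local_det_section[OF m bpf W] by (elim exE conjE)
    have hol: "holo_fun X W (R \<phi>)" by (rule qR(2)[unfolded det_section_def, THEN conjunct1, rule_format, OF W(1)])
    obtain N where N: "openin (topo X) N" "x \<in> N" "N \<subseteq> W" "\<And>y. y \<in> N \<Longrightarrow> R \<phi> y \<noteq> 0"
      by (rule nonvanishing_open[OF triv_open[OF W(1)] hol W(2) qR(3)], rule that, assumption+)
    have "P q y" if "y \<in> N" for y by (rule PI[OF qR(2) W(1) subsetD[OF N(3) that] N(4)[OF that]])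
    then have "N \<in> C" unfolding C_def using N(1) qR(1) by (intro CollectI conjI exI[of _ q] ballI)
    then show "x \<in> \<Union>C" using N(2) by (rule UnionI)
  qed
  have op: "\<forall>N\<in>C. openin (topo X) N" by (simp add: C_def)
  obtain D where D: "finite D" "D \<subseteq> C" "topspace (topo X) \<subseteq> \<Union>D"
    using comp[unfolded compact_space_alt, THEN spec[where x=C], THEN mp, OF conjI[OF op cov]] by (elim exE conjE)
  have "\<exists>q. q > 0 \<and> (\<forall>y\<in>N. P q y)" if "N \<in> D" for N
    using subsetD[OF D(2) that] unfolding C_def by simp
  then have "\<forall>N\<in>D. \<exists>q. q > 0 \<and> (\<forall>y\<in>N. P q y)" by (rule ballI)
  then obtain q where q: "\<forall>N\<in>D. q N > 0 \<and> (\<forall>y\<in>N. P (q N) y)" by (rule bchoice[THEN exE])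
  \<comment> \<open>The product is a convenient common multiple of the exponents.\<close>
  define K where "K = (\<Prod>N\<in>D. q N)"
  show ?thesis
  proof (rule that[of K])
    show "K > 0" unfolding K_def using q by (intro prod_pos) simp
    fix x assume "x \<in> topspace (topo X)"
    then obtain N where N: "N \<in> D" "x \<in> N" using D(3) by auto
    have "K = q N * (\<Prod>N\<in>D - {N}. q N)" unfolding K_def by (rule prod.remove[OF D(1) N(1)])
    moreover have "P (q N) x" using q N by blast
    ultimately have "P K x" using Pmult by simp
    then show "\<exists>R W \<phi>. det_section K R \<and> (W, \<phi>) \<in> trivs E \<and> x \<in> W \<and> R \<phi> x \<noteq> 0" unfolding P_def .
  qed
qed

end

section \<open>The determinant bundle and the section assembled from its coordinate
  functions\<close>

lemma PiE_upd:
  assumes "w \<in> {..<k} \<rightarrow>\<^sub>E D" "j < k" "u \<in> D" shows "w(j := u) \<in> {..<k} \<rightarrow>\<^sub>E D"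
proof (rule PiE_I)
  show "(w(j := u)) i \<in> D" if "i \<in> {..<k}" for i using PiE_mem[OF assms(1) that] assms(3) by simp
  show "(w(j := u)) i = undefined" if "i \<notin> {..<k}" for i
    using PiE_arb[OF assms(1) that] that assms(2) by auto
qed

lemma dual_closed:
  assumes add: "\<And>u v. u \<in> fibre L x \<Longrightarrow> v \<in> fibre L x \<Longrightarrow> vadd L u v \<in> fibre L x"
    and smul: "\<And>u c. u \<in> fibre L x \<Longrightarrow> smul L c u \<in> fibre L x"
  shows "l \<in> dual L x \<Longrightarrow> l' \<in> dual L x \<Longrightarrow> (\<lambda>e\<in>fibre L x. l e + l' e) \<in> dual L x"
    and "l \<in> dual L x \<Longrightarrow> (\<lambda>e\<in>fibre L x. c * l e) \<in> dual L x"
  unfolding dual_def by (simp_all add: add smul distrib_left)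

lemma tensors_restrictI:
  assumes add: "\<And>u v. u \<in> fibre L x \<Longrightarrow> v \<in> fibre L x \<Longrightarrow> vadd L u v \<in> fibre L x"
    and smul: "\<And>u c. u \<in> fibre L x \<Longrightarrow> smul L c u \<in> fibre L x"
    and fa: "\<And>w j l. w \<in> {..<k} \<rightarrow>\<^sub>E dual L x \<Longrightarrow> j < k \<Longrightarrow> l \<in> dual L x \<Longrightarrow>
      f (w(j := \<lambda>e\<in>fibre L x. w j e + l e)) = f w + f (w(j := l))"
    and fs: "\<And>w j l c. w \<in> {..<k} \<rightarrow>\<^sub>E dual L x \<Longrightarrow> j < k \<Longrightarrow> l \<in> dual L x \<Longrightarrow>
      f (w(j := \<lambda>e\<in>fibre L x. c * l e)) = c * f (w(j := l))"
  shows "restrict f ({..<k} \<rightarrow>\<^sub>E dual L x) \<in> tensors L k x"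
  unfolding tensors_def
proof (intro CollectI conjI ballI allI impI)
  show "restrict f ({..<k} \<rightarrow>\<^sub>E dual L x) \<in> extensional ({..<k} \<rightarrow>\<^sub>E dual L x)" by (rule restrict_extensional)
  fix w j l assume w: "w \<in> {..<k} \<rightarrow>\<^sub>E dual L x" and j: "j < k" and l: "l \<in> dual L x"
  have wj: "w j \<in> dual L x" using PiE_mem[OF w, of j] j by simp
  have d1: "(\<lambda>e\<in>fibre L x. w j e + l e) \<in> dual L x"
    by (rule dual_closed(1)[OF _ _ wj l]) (rule add smul; assumption)+
  have d2: "(\<lambda>e\<in>fibre L x. c * l e) \<in> dual L x" for c
    by (rule dual_closed(2)[OF _ _ l]) (rule add smul; assumption)+
  show "restrict f ({..<k} \<rightarrow>\<^sub>E dual L x) (w(j := \<lambda>e\<in>fibre L x. w j e + l e)) =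
    restrict f ({..<k} \<rightarrow>\<^sub>E dual L x) w + restrict f ({..<k} \<rightarrow>\<^sub>E dual L x) (w(j := l))"
    unfolding restrict_apply'[OF w] restrict_apply'[OF PiE_upd[OF w j l]]
      restrict_apply'[OF PiE_upd[OF w j d1]] by (rule fa[OF w j l])
  fix c
  show "restrict f ({..<k} \<rightarrow>\<^sub>E dual L x) (w(j := \<lambda>e\<in>fibre L x. c * l e)) =
    c * restrict f ({..<k} \<rightarrow>\<^sub>E dual L x) (w(j := l))"
    unfolding restrict_apply'[OF PiE_upd[OF w j l]]
      restrict_apply'[OF PiE_upd[OF w j d2]] by (rule fs[OF w j l])
qed

lemma alternating_tensorsD:
  assumes "t \<in> alternating_tensors L k x"
  shows "t \<in> tensors L k x"
    and "\<forall>w \<in> {..<k} \<rightarrow>\<^sub>E dual L x. \<forall>i<k. \<forall>j<k. i \<noteq> j \<and> w i = w j \<longrightarrow> t w = 0"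
  using assms unfolding alternating_tensors_def mem_Collect_eq by (rule conjunct1, rule conjunct2)

context holo_bundle
begin

abbreviation "DB \<equiv> det_bundle X E"

text \<open>The wedge product of the frame given by \<open>\<phi>\<close>, as an alternating
  function of \<open>r\<close> functionals: the determinant of their values on the frame
  vectors.\<close>

definition frame_volume :: "('e \<Rightarrow> nat \<Rightarrow> complex) \<Rightarrow> 'x \<Rightarrow> (nat \<Rightarrow> 'e \<Rightarrow> complex) \<Rightarrow> complex" where
  "frame_volume \<phi> x = restrict (\<lambda>w. dt r (\<lambda>(i, k). w i (frame E \<phi> x k))) ({..<r} \<rightarrow>\<^sub>E dual E x)"

definition det_triv :: "('e \<Rightarrow> nat \<Rightarrow> complex) \<Rightarrow> 'x \<times> ((nat \<Rightarrow> 'e \<Rightarrow> complex) \<Rightarrow> complex) \<Rightarrow> nat \<Rightarrow> complex" where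
  "det_triv \<phi> = (\<lambda>(x, t) i. if i = 0 then t (\<lambda>j\<in>{..<r}. coord_form E \<phi> x j) else 0)"

lemma fibre_det:
  "x \<in> topspace (topo X) \<Longrightarrow> e \<in> fibre DB x \<longleftrightarrow> fst e = x \<and> snd e \<in> alternating_tensors E r x"
  by (cases e) (auto simp: fibre_def det_bundle_def)

context
  fixes W \<phi> x assumes W: "(W, \<phi>) \<in> trivs E" and x: "x \<in> W"
begin

interpretation tf: triv_fibre E \<phi> x by (rule triv_fibre[OF W x])

lemma frame_volume_alternating: "frame_volume \<phi> x \<in> alternating_tensors E r x"
  unfolding alternating_tensors_def
proof (intro CollectI conjI ballI allI impI)
  have upd: "dt r (\<lambda>(i, k). (w(j := u)) i (frame E \<phi> x k)) =
    dt r (\<lambda>(i, k). if i = j then u (frame E \<phi> x k) else (\<lambda>(i, k). w i (frame E \<phi> x k)) (i, k))"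
    for w j and u :: "'e \<Rightarrow> complex" by (rule dt_cong) simp
  show "frame_volume \<phi> x \<in> tensors E r x" unfolding frame_volume_def
  proof (rule tensors_restrictI[OF tf.add_closed tf.smul_closed])
    fix w j l assume w: "w \<in> {..<r} \<rightarrow>\<^sub>E dual E x" and j: "j < r" and l: "l \<in> dual E x"
    have "dt r (\<lambda>(i, k). (w(j := \<lambda>e\<in>fibre E x. w j e + l e)) i (frame E \<phi> x k)) =
      dt r (\<lambda>(i, k). if i = j then w j (frame E \<phi> x k) + l (frame E \<phi> x k) else (\<lambda>(i, k). w i (frame E \<phi> x k)) (i, k))"
      by (rule dt_cong) (simp add: tf.frame(1))
    also have "\<dots> = dt r (\<lambda>(i, k). if i = j then w j (frame E \<phi> x k) else (\<lambda>(i, k). w i (frame E \<phi> x k)) (i, k)) +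
      dt r (\<lambda>(i, k). if i = j then l (frame E \<phi> x k) else (\<lambda>(i, k). w i (frame E \<phi> x k)) (i, k))"
      by (rule dt_row_add[OF j])
    also have "dt r (\<lambda>(i, k). if i = j then w j (frame E \<phi> x k) else (\<lambda>(i, k). w i (frame E \<phi> x k)) (i, k)) =
      dt r (\<lambda>(i, k). w i (frame E \<phi> x k))" by (rule dt_cong) simp
    finally show "dt r (\<lambda>(i, k). (w(j := \<lambda>e\<in>fibre E x. w j e + l e)) i (frame E \<phi> x k)) =
      dt r (\<lambda>(i, k). w i (frame E \<phi> x k)) + dt r (\<lambda>(i, k). (w(j := l)) i (frame E \<phi> x k))"
      unfolding upd .
    fix c
    have "dt r (\<lambda>(i, k). (w(j := \<lambda>e\<in>fibre E x. c * l e)) i (frame E \<phi> x k)) =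
      dt r (\<lambda>(i, k). if i = j then c * l (frame E \<phi> x k) else (\<lambda>(i, k). w i (frame E \<phi> x k)) (i, k))"
      by (rule dt_cong) (simp add: tf.frame(1))
    also have "\<dots> = c * dt r (\<lambda>(i, k). if i = j then l (frame E \<phi> x k) else (\<lambda>(i, k). w i (frame E \<phi> x k)) (i, k))"
      by (rule dt_row_scale[OF j])
    finally show "dt r (\<lambda>(i, k). (w(j := \<lambda>e\<in>fibre E x. c * l e)) i (frame E \<phi> x k)) =
      c * dt r (\<lambda>(i, k). (w(j := l)) i (frame E \<phi> x k))"
      unfolding upd .
  qed
  fix w i j assume w: "w \<in> {..<r} \<rightarrow>\<^sub>E dual E x" and i: "i < r" and j: "j < r" and ij: "i \<noteq> j \<and> w i = w j"
  show "frame_volume \<phi> x w = 0"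
    unfolding frame_volume_def restrict_apply'[OF w]
    by (rule dt_equal_rows[OF i j]) (use ij in simp_all)
qed

lemma alternating_add:
  assumes t: "t \<in> alternating_tensors E r x" and u: "u \<in> alternating_tensors E r x"
  shows "(\<lambda>w\<in>{..<r} \<rightarrow>\<^sub>E dual E x. t w + u w) \<in> alternating_tensors E r x"
  unfolding alternating_tensors_def
proof (intro CollectI conjI ballI allI impI)
  note tT = alternating_tensorsD(1)[OF t] and uT = alternating_tensorsD(1)[OF u]
  show "(\<lambda>w\<in>{..<r} \<rightarrow>\<^sub>E dual E x. t w + u w) \<in> tensors E r x"
    by (rule tensors_restrictI[OF tf.add_closed tf.smul_closed])
      (simp_all only: tensors_linear[OF tT] tensors_linear[OF uT], simp_all only: distrib_left add_ac)
  fix w i j assume w: "w \<in> {..<r} \<rightarrow>\<^sub>E dual E x" and i: "i < r" and j: "j < r" and ij: "i \<noteq> j \<and> w i = w j"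
  have "t w = 0" by (rule alternating_tensorsD(2)[OF t, THEN bspec, OF w, rule_format, OF i j ij])
  moreover have "u w = 0" by (rule alternating_tensorsD(2)[OF u, THEN bspec, OF w, rule_format, OF i j ij])
  ultimately show "(\<lambda>w\<in>{..<r} \<rightarrow>\<^sub>E dual E x. t w + u w) w = 0" using w by simp
qed

lemma alternating_smul:
  assumes t: "t \<in> alternating_tensors E r x"
  shows "(\<lambda>w\<in>{..<r} \<rightarrow>\<^sub>E dual E x. c * t w) \<in> alternating_tensors E r x"
  unfolding alternating_tensors_def
proof (intro CollectI conjI ballI allI impI)
  note tT = alternating_tensorsD(1)[OF t]
  show "(\<lambda>w\<in>{..<r} \<rightarrow>\<^sub>E dual E x. c * t w) \<in> tensors E r x"
    by (rule tensors_restrictI[OF tf.add_closed tf.smul_closed])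
      (simp_all only: tensors_linear[OF tT], simp_all only: distrib_left mult_ac)
  fix w i j assume w: "w \<in> {..<r} \<rightarrow>\<^sub>E dual E x" and i: "i < r" and j: "j < r" and ij: "i \<noteq> j \<and> w i = w j"
  have "t w = 0" by (rule alternating_tensorsD(2)[OF t, THEN bspec, OF w, rule_format, OF i j ij])
  then show "(\<lambda>w\<in>{..<r} \<rightarrow>\<^sub>E dual E x. c * t w) w = 0" using w by simp
qed

lemma det_closed:
  shows "e \<in> fibre DB x \<Longrightarrow> e' \<in> fibre DB x \<Longrightarrow> vadd DB e e' \<in> fibre DB x"
    and "e \<in> fibre DB x \<Longrightarrow> smul DB c e \<in> fibre DB x"
  unfolding fibre_det[OF triv_subset[OF W x]]
  using alternating_add[of "snd e" "snd e'"] alternating_smul[of "snd e" c]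
  by (simp_all add: det_bundle_def tensor_add_def tensor_smul_def case_prod_unfold)

lemma coord_forms_PiE: "(\<lambda>j\<in>{..<r}. coord_form E \<phi> x j) \<in> {..<r} \<rightarrow>\<^sub>E dual E x"
proof (rule restrict_PiE_iff[THEN iffD2], rule ballI)
  fix j
  show "coord_form E \<phi> x j \<in> dual E x"
    unfolding dual_def coord_form_def by (simp add: tf.add_closed tf.smul_closed tf.\<phi>_add tf.\<phi>_smul)
qed

lemma det_coord_dual: "coord_form DB (det_triv \<phi>) x 0 \<in> dual DB x"
  unfolding dual_def
proof (intro CollectI conjI ballI allI)
  note xt = triv_subset[OF W x]
  show "coord_form DB (det_triv \<phi>) x 0 \<in> extensional (fibre DB x)" by (simp add: coord_form_def)
  fix e assume e: "e \<in> fibre DB x"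
  have ex: "fst e = x" using e unfolding fibre_det[OF xt] by simp
  have val: "coord_form DB (det_triv \<phi>) x 0 d = snd d (\<lambda>j\<in>{..<r}. coord_form E \<phi> x j)"
    if "d \<in> fibre DB x" for d
  proof -
    have "fst d = x" using that unfolding fibre_det[OF xt] by simp
    then show ?thesis unfolding coord_form_def[of DB] det_triv_def case_prod_unfold
      using that by (simp only: restrict_apply' simp_thms if_True)
  qed
  show "coord_form DB (det_triv \<phi>) x 0 (smul DB c e) = c * coord_form DB (det_triv \<phi>) x 0 e" for c
    unfolding val[OF e] val[OF det_closed(2)[OF e]]
    by (simp only: det_bundle_def vbundle.select_convs tensor_smul_def case_prod_unfold snd_conv ex
        restrict_apply'[OF coord_forms_PiE])
  fix e' assume e': "e' \<in> fibre DB x"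
  show "coord_form DB (det_triv \<phi>) x 0 (vadd DB e e') =
    coord_form DB (det_triv \<phi>) x 0 e + coord_form DB (det_triv \<phi>) x 0 e'"
    unfolding val[OF e] val[OF e'] val[OF det_closed(1)[OF e e']]
    by (simp only: det_bundle_def vbundle.select_convs tensor_add_def case_prod_unfold snd_conv ex
        restrict_apply'[OF coord_forms_PiE])
qed

lemma frame_volume_fibre: "(x, frame_volume \<phi> x) \<in> fibre DB x"
  unfolding fibre_det[OF triv_subset[OF W x]] using frame_volume_alternating by simp

end

text \<open>The coordinate forms of \<open>\<phi>'\<close>, evaluated on the frame of
  \<open>\<phi>\<close>, are the entries of the transition matrix; so the induced transition
  function of the determinant bundle is \<open>dt r T\<close>.\<close>

lemma det_coord_frame_volume:
  assumes W: "(W, \<phi>) \<in> trivs E" "x \<in> W" and W': "(W', \<phi>') \<in> trivs E" "x \<in> W'"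
    and T: "cocycle \<phi> \<phi>' x T"
  shows "coord_form DB (det_triv \<phi>') x 0 (x, frame_volume \<phi> x) = dt r T"
proof -
  interpret tf: triv_fibre E \<phi> x by (rule triv_fibre[OF W])
  have "coord_form DB (det_triv \<phi>') x 0 (x, frame_volume \<phi> x) =
    frame_volume \<phi> x (\<lambda>j\<in>{..<r}. coord_form E \<phi>' x j)"
    unfolding coord_form_def[of DB] restrict_apply'[OF frame_volume_fibre[OF W]] det_triv_def prod.case
    by (simp only: simp_thms if_True)
  also have "\<dots> = dt r (\<lambda>(i, k). (\<lambda>j\<in>{..<r}. coord_form E \<phi>' x j) i (frame E \<phi> x k))"
    unfolding frame_volume_def by (rule restrict_apply'[OF coord_forms_PiE[OF W']])
  also have "\<dots> = dt r T"
    by (rule dt_cong) (simp add: coord_form_def tf.frame(1) cocycle_frame[OF W T])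
  finally show ?thesis .
qed

lemma det_bundle_section:
  assumes R: "det_section K R"
  obtains S where "holomorphic_section X (line_power X DB K) S"
    and "\<And>x W \<phi>. (W, \<phi>) \<in> trivs E \<Longrightarrow> x \<in> W \<Longrightarrow> R \<phi> x \<noteq> 0 \<Longrightarrow> S x \<noteq> smul (line_power X DB K) 0 (S x)"
proof -
  \<comment> \<open>A trivialisation is picked at each point separately, without any continuity. The
    transformation law of \<open>R\<close> cancels the effect of the choice, as \<open>val\<close>
    shows, so holomorphy can be read off from the functions \<open>R \<phi>\<close>.\<close>
  define \<rho> where "\<rho> x = (SOME \<phi>. \<exists>W. (W, \<phi>) \<in> trivs E \<and> x \<in> W)" for x
  have \<rho>: "\<exists>W. (W, \<rho> x) \<in> trivs E \<and> x \<in> W" if "x \<in> topspace (topo X)" for x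
  proof -
    from triv_ex[OF that] have "\<exists>\<phi> W. (W, \<phi>) \<in> trivs E \<and> x \<in> W" by (elim exE) (intro exI)
    then show ?thesis unfolding \<rho>_def by (rule someI_ex)
  qed
  \<comment> \<open>The \<open>K\<close>-th tensor power of the wedge of the chosen frame, times the
    coordinate \<open>R (\<rho> x) x\<close>, written as a \<open>K\<close>-linear function on the
    dual of the determinant line.\<close>
  define t where "t x = restrict (\<lambda>w. R (\<rho> x) x * (\<Prod>j<K. w j (x, frame_volume (\<rho> x) x)))
    ({..<K} \<rightarrow>\<^sub>E dual DB x)" for x
  have tt: "t x \<in> tensors DB K x" if xt: "x \<in> topspace (topo X)" for x
  proof -
    obtain W where W: "(W, \<rho> x) \<in> trivs E" "x \<in> W" using \<rho>[OF xt] by (elim exE conjE)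
    let ?o = "(x, frame_volume (\<rho> x) x)"
    note o = frame_volume_fibre[OF W]
    have P: "(\<Prod>i<K. (w(j := u)) i ?o) = u ?o * (\<Prod>i\<in>{..<K} - {j}. w i ?o)" if "j < K" for w j u
    proof -
      have "(\<Prod>i\<in>{..<K} - {j}. (w(j := u)) i ?o) = (\<Prod>i\<in>{..<K} - {j}. w i ?o)" by (rule prod.cong) auto
      then show ?thesis using prod.remove[of "{..<K}" j "\<lambda>i. (w(j := u)) i ?o"] that by simp
    qed
    have P': "(\<Prod>i<K. w i ?o) = w j ?o * (\<Prod>i\<in>{..<K} - {j}. w i ?o)" if "j < K" for w j
      using prod.remove[of "{..<K}" j "\<lambda>i. w i ?o"] that by simp
    show ?thesis unfolding t_def
    proof (rule tensors_restrictI[OF det_closed[OF W]])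
      fix w j and l :: "'x \<times> ((nat \<Rightarrow> 'e \<Rightarrow> complex) \<Rightarrow> complex) \<Rightarrow> complex" assume j: "j < K"
      show "R (\<rho> x) x * (\<Prod>i<K. (w(j := \<lambda>e\<in>fibre DB x. w j e + l e)) i ?o) =
        R (\<rho> x) x * (\<Prod>i<K. w i ?o) + R (\<rho> x) x * (\<Prod>i<K. (w(j := l)) i ?o)"
        unfolding P[OF j] P'[OF j, of w] restrict_apply'[OF o] by (simp only: distrib_right distrib_left)
      show "R (\<rho> x) x * (\<Prod>i<K. (w(j := \<lambda>e\<in>fibre DB x. c * l e)) i ?o) =
        c * (R (\<rho> x) x * (\<Prod>i<K. (w(j := l)) i ?o))" for c
        unfolding P[OF j] restrict_apply'[OF o] by (simp only: mult_ac)
    qed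
  qed
  have kP: "(\<lambda>j\<in>{..<K}. coord_form DB (det_triv \<phi>) x 0) \<in> {..<K} \<rightarrow>\<^sub>E dual DB x"
    if "(W, \<phi>) \<in> trivs E" "x \<in> W" for W \<phi> x
    by (rule restrict_PiE_iff[THEN iffD2], rule ballI, rule det_coord_dual[OF that])
  have val: "t x (\<lambda>j\<in>{..<K}. coord_form DB (det_triv \<phi>) x 0) = R \<phi> x"
    if W: "(W, \<phi>) \<in> trivs E" "x \<in> W" for W \<phi> x
  proof -
    obtain W0 where W0: "(W0, \<rho> x) \<in> trivs E" "x \<in> W0" using \<rho>[OF triv_subset[OF W]] by (elim exE conjE)
    obtain T where T: "cocycle (\<rho> x) \<phi> x T" using cocycle_ex[OF W0(1) W(1) W0(2) W(2)] by (rule exE)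
    have "t x (\<lambda>j\<in>{..<K}. coord_form DB (det_triv \<phi>) x 0) = R (\<rho> x) x * (\<Prod>j<K. dt r T)"
      unfolding t_def restrict_apply'[OF kP[OF W]]
      by (rule arg_cong[of _ _ "\<lambda>p. R (\<rho> x) x * p"], rule prod.cong[OF refl])
        (simp only: restrict_apply' det_coord_frame_volume[OF W0 W T])
    also have "\<dots> = dt r T ^ K * R (\<rho> x) x" by (simp add: mult.commute)
    also have "\<dots> = R \<phi> x"
      using R W0 W T unfolding det_section_def by metis
    finally show ?thesis .
  qed
  define S where "S x = (x, t x)" for x
  have "holomorphic_section X (line_power X DB K) S" unfolding holomorphic_section_def
  proof (intro conjI ballI)
    show "S x \<in> fibre (line_power X DB K) x" if "x \<in> topspace (topo X)" for x
      using tt[OF that] that by (simp add: fibre_def line_power_def S_def)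
    fix V assume "V \<in> trivs (line_power X DB K)"
    then obtain W \<phi> where W: "(W, \<phi>) \<in> trivs E"
      and V: "V = (W, \<lambda>(x, t) i. if i = 0 then t (\<lambda>j\<in>{..<K}. coord_form DB (det_triv \<phi>) x 0) else 0)"
      unfolding line_power_def det_bundle_def det_triv_def vbundle.select_convs by auto
    have "holo_fun X W (R \<phi>)" by (rule R[unfolded det_section_def, THEN conjunct1, rule_format, OF W])
    then have "holo_fun X W (\<lambda>x. t x (\<lambda>j\<in>{..<K}. coord_form DB (det_triv \<phi>) x 0))"
      by (rule holo_fun_cong[OF triv_open[OF W]]) (rule val[OF W])
    then show "case V of (U, \<phi>) \<Rightarrow> \<forall>i<vrank (line_power X DB K). holo_fun X U (\<lambda>x. \<phi> (S x) i)"
      unfolding V prod.case S_def by (simp add: line_power_def)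
  qed
  moreover have "S x \<noteq> smul (line_power X DB K) 0 (S x)"
    if W: "(W, \<phi>) \<in> trivs E" "x \<in> W" and nz: "R \<phi> x \<noteq> 0" for x W \<phi>
  proof
    assume "S x = smul (line_power X DB K) 0 (S x)"
    then have "t x = (\<lambda>w\<in>{..<K} \<rightarrow>\<^sub>E dual DB x. 0 * t x w)"
      by (simp only: S_def line_power_def vbundle.select_convs tensor_smul_def prod.case prod.inject)
    then have "t x (\<lambda>j\<in>{..<K}. coord_form DB (det_triv \<phi>) x 0) =
      (\<lambda>w\<in>{..<K} \<rightarrow>\<^sub>E dual DB x. 0 * t x w) (\<lambda>j\<in>{..<K}. coord_form DB (det_triv \<phi>) x 0)"
      by (rule fun_cong)
    also have "\<dots> = 0" unfolding restrict_apply'[OF kP[OF W]] by simp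
    finally show False using nz unfolding val[OF W] by simp
  qed
  ultimately show ?thesis by (rule that)
qed

end

theorem theorem1p1:
  fixes X :: "'x cmfd" and E :: "('x, 'e) vbundle"
  assumes "complex_manifold X" and "compact_space (topo X)"
    and "holomorphic_vector_bundle X E"
    and "weakly_semiample X E"
  shows "semiample X (det_bundle X E)"
proof -
  interpret holo_bundle X E by unfold_locales (rule assms)+
  obtain m where m: "m > 0" and bpf: "base_point_free PB (line_power PB TB m)"
    using assms(4) unfolding weakly_semiample_def by (elim exE conjE)
  obtain K where K: "K > 0" "\<And>x. x \<in> topspace (topo X) \<Longrightarrow>
      \<exists>R W \<phi>. det_section K R \<and> (W, \<phi>) \<in> trivs E \<and> x \<in> W \<and> R \<phi> x \<noteq> 0"
    by (rule uniform_det_section[OF assms(2) m bpf], rule that, assumption+)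
  have "base_point_free X (line_power X DB K)" unfolding base_point_free_def
  proof
    fix x assume "x \<in> topspace (topo X)"
    from K(2)[OF this] obtain R W \<phi> where R: "det_section K R" "(W, \<phi>) \<in> trivs E" "x \<in> W" "R \<phi> x \<noteq> 0"
      by (elim exE conjE)
    obtain S where "holomorphic_section X (line_power X DB K) S"
      "\<And>x W \<phi>. (W, \<phi>) \<in> trivs E \<Longrightarrow> x \<in> W \<Longrightarrow> R \<phi> x \<noteq> 0 \<Longrightarrow> S x \<noteq> smul (line_power X DB K) 0 (S x)"
      by (rule det_bundle_section[OF R(1)], rule that, assumption+)
    then show "\<exists>s. holomorphic_section X (line_power X DB K) s \<and> s x \<noteq> smul (line_power X DB K) 0 (s x)"
      using R(2-4) by (intro exI[of _ S] conjI)
  qed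
  then show ?thesis unfolding semiample_def using K(1) by (intro exI[of _ K] conjI)
qed

end
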